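(* Suppose $u\in\mathcal{C}^{1,1}(\mathcal{D})$ is a bounded function that satisfies the following conditions: (i) $\lim_{m\to\infty}u(m,m)\le0$. (ii) $u(x,m)$ is defined for all $x\le m$ and $m\ge0$, with $u(x,m)=1$ for all $x<\alpha m$. (iii) $u_m(m,m)\ge0$ for all $m\ge0$. (iv) $\mathcal{L}^Ru(x,m)\ge0$ for all $(x,m)\in\mathcal{D}$ and for all admissible retention functions $R$. Then $u\le\psi$ on $\mathcal{D}$.
   Context: Market. $Y$ is a random variable (claim size) with c.d.f. $F_Y$, $F_Y(0)=0$, and moment generating function finite in a neighborhood of $0$. Constants: $\alpha\in[0,1)$, $\lambda>0$, $\theta\ge0$, $\eta\ge0$, and $c$ with $\lambda\mathbb{E}Y<c<(1+\theta)\lambda\mathbb{E}Y+\frac{\eta}{2}\lambda\mathbb{E}(Y^2)$; set $\kappa=(1+\theta)\lambda\mathbb{E}Y+\frac{\eta}{2}\lambda\mathbb{E}(Y^2)-c>0$. For a Borel function $R$ write $\mathbb{E}R=\mathbb{E}[R(Y)]$, $\mathbb{E}(YR)=\mathbb{E}[YR(Y)]$, etc. The domain is $\mathcal{D}=\{(x,m)\in\mathbb{R}_+^2:\alpha m\le x\le m\}$. An admissible retention function is a Borel function $R:\mathbb{R}_+\to\mathbb{R}_+$ with $0\le R(y)\le y$ for all $y\ge0$ and $c-(1+\theta)\lambda\mathbb{E}(Y-R)-\frac{\eta}{2}\lambda\mathbb{E}((Y-R)^2)>\lambda\mathbb{E}R$. Controlled surplus. On a filtered probability space $(\Omega,\mathcal{F},\{\mathcal{F}_t\}_{t\ge0},\mathbb{P})$,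 claims arrive at the jump times of a Poisson process $N$ of rate $\lambda$ with i.i.d. sizes distributed as $Y$, independent of $N$ (the claim process being a compound Poisson process relative to the filtration). An admissible retention strategy is a family $\mathcal{R}=\{R_t(\omega,y)\}_{t\ge0}$ such that: $(\omega,y)\mapsto R_t(\omega,y)$ is $\mathcal{F}_{t^-}\times\mathcal{B}(\mathbb{R}_+)$-measurable for each $t$; it is progressively measurable; $0\le R_t(\omega,y)\le y$; and, with probability one for all $t\ge0$, $c-(1+\theta)\lambda\mathbb{E}(Y-R_t)-\frac{\eta}{2}\lambda\mathbb{E}((Y-R_t)^2)>\lambda\mathbb{E}R_t$, expectations being over the claim size only ($\omega,t$ fixed). The surplus starts at $X_0=x$ and satisfies $$dX_t=\Big(c-(1+\theta)\lambda\mathbb{E}(Y-R_t)-\tfrac{\eta}{2}\lambda\mathbb{E}((Y-R_t)^2)\Big)dt-R_t\,dN_t,$$ i.e. when a claim of size $y$ occurs at time $t$ the surplus drops by $R_t(\omega,y)$. The running maximum is $M_t=\max\{\sup_{0\le s\le t}X_s,\,m\}$ with $m\ge x$; the drawdown time is $\tau_\alpha=\inf\{t\ge0:X_t<\alpha M_t\}$. The minimum probability of drawdown is $\psi(x,m)=\inf_{\mathcal{R}}\mathbb{P}^{x,m}(\tau_\alpha<\infty)$, the infimum over admissible strategies. $\mathcal{C}^{1,1}(\mathcal{D})$ denotes functions on $\mathcal{D}$ that are continuously differentiable in $x$ and in $m$. For an admissible retention function $R$ and $u\in\mathcal{C}^{1,1}(\mathcal{D})$, extended by $u(x,m)=1$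 for $x<\alpha m$, $$\mathcal{L}^Ru(x,m)=-\kappa u_x(x,m)+\lambda\Big[\Big((1+\theta)\mathbb{E}R+\eta\mathbb{E}(YR)-\tfrac{\eta}{2}\mathbb{E}(R^2)\Big)u_x(x,m)+\mathbb{E}u(x-R,m)-u(x,m)\Big].$$
   Formalization: Admissible strategies are additionally required to be predictable jointly in time, scenario and claim size; with F_{t-}-measurability only for each fixed t, a complete filtration lets the retention change exactly at claim times and the inequality u ≤ ψ fails. *)

theory Defs
  imports "HOL-Probability.Probability"
begin

section \<open>Market\<close>

text \<open>The claim size enters only through its law \<open>\<nu>\<close>, so that \<open>F\<^sub>Y = cdf \<nu>\<close>
  and \<open>\<E>[f(Y)] = (LINT y|\<nu>. f y)\<close>.\<close>

locale drawdown_market =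
  real_distribution \<nu> for \<nu> :: "real measure" +
  fixes \<alpha> lam \<theta> \<eta> c :: real
  assumes cdf_zero: "cdf \<nu> 0 = 0"
    and mgf_finite: "\<exists>\<epsilon>>0. \<forall>r. \<bar>r\<bar> < \<epsilon> \<longrightarrow> integrable \<nu> (\<lambda>y. exp (r * y))"
    and alpha: "0 \<le> \<alpha>" "\<alpha> < 1"
    and lam: "lam > 0"
    and theta: "\<theta> \<ge> 0"
    and eta: "\<eta> \<ge> 0"
    and c_lower: "lam * (LINT y|\<nu>. y) < c"
    and c_upper: "c < (1 + \<theta>) * lam * (LINT y|\<nu>. y) + \<eta> / 2 * lam * (LINT y|\<nu>. y\<^sup>2)"

definition kappa :: "real measure \<Rightarrow> real \<Rightarrow> real \<Rightarrow> real \<Rightarrow> real \<Rightarrow> real" where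
  "kappa \<nu> lam \<theta> \<eta> c =
     (1 + \<theta>) * lam * (LINT y|\<nu>. y) + \<eta> / 2 * lam * (LINT y|\<nu>. y\<^sup>2) - c"

definition domain_D :: "real \<Rightarrow> (real \<times> real) set" where
  "domain_D \<alpha> = {(x, m). 0 \<le> x \<and> 0 \<le> m \<and> \<alpha> * m \<le> x \<and> x \<le> m}"

section \<open>Retention functions\<close>

text \<open>Functions on the nonnegative half-line are represented by their extension by zero to the
  whole line; for \<open>y \<ge> 0\<close> the bound below is \<open>0 \<le> R y \<le> y\<close>.\<close>

definition retention_bounds :: "(real \<Rightarrow> real) \<Rightarrow> bool" where
  "retention_bounds R \<longleftrightarrow> (\<forall>y. 0 \<le> R y \<and> R y \<le> max 0 y)"

definition drift ::
  "real measure \<Rightarrow> real \<Rightarrow> real \<Rightarrow> real \<Rightarrow> real \<Rightarrow> (real \<Rightarrow> real) \<Rightarrow> real" where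
  "drift \<nu> lam \<theta> \<eta> c R =
     c - (1 + \<theta>) * lam * (LINT y|\<nu>. y - R y) - \<eta> / 2 * lam * (LINT y|\<nu>. (y - R y)\<^sup>2)"

definition net_profit ::
  "real measure \<Rightarrow> real \<Rightarrow> real \<Rightarrow> real \<Rightarrow> real \<Rightarrow> (real \<Rightarrow> real) \<Rightarrow> bool" where
  "net_profit \<nu> lam \<theta> \<eta> c R \<longleftrightarrow> drift \<nu> lam \<theta> \<eta> c R > lam * (LINT y|\<nu>. R y)"

definition admissible_retention ::
  "real measure \<Rightarrow> real \<Rightarrow> real \<Rightarrow> real \<Rightarrow> real \<Rightarrow> (real \<Rightarrow> real) \<Rightarrow> bool" where
  "admissible_retention \<nu> lam \<theta> \<eta> c R \<longleftrightarrow>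
     R \<in> borel_measurable borel \<and> retention_bounds R \<and> net_profit \<nu> lam \<theta> \<eta> c R"

section \<open>Claims and filtration\<close>

definition claim_total ::
  "(real \<Rightarrow> 'a \<Rightarrow> nat) \<Rightarrow> (nat \<Rightarrow> 'a \<Rightarrow> real) \<Rightarrow> real \<Rightarrow> 'a \<Rightarrow> real" where
  "claim_total N Y t \<omega> = (\<Sum>i<N t \<omega>. Y i \<omega>)"

text \<open>Only times \<open>t \<ge> 0\<close> matter; a filtration indexed by \<open>t \<ge> 0\<close> is
  continued to negative times by, say, its value at \<open>0\<close>. Claims are numbered from \<open>0\<close>.
  The last assumption says that the claim process, recorded by claim number and claim total, has
  increments independent of the past of the filtration.\<close>

locale claim_process =
  prob_space P + filtration "space P" F
  for P :: "'a measure" and F :: "real \<Rightarrow> 'a measure" +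
  fixes \<nu> :: "real measure" and lam :: real
    and N :: "real \<Rightarrow> 'a \<Rightarrow> nat" and Y :: "nat \<Rightarrow> 'a \<Rightarrow> real"
  assumes F_sub: "\<And>t. sets (F t) \<subseteq> sets P"
    and N_zero: "\<And>\<omega>. \<omega> \<in> space P \<Longrightarrow> N 0 \<omega> = 0"
    and N_mono: "\<And>\<omega>. \<omega> \<in> space P \<Longrightarrow> mono_on {0..} (\<lambda>t. N t \<omega>)"
    and N_right_cont: "\<And>\<omega> t. \<omega> \<in> space P \<Longrightarrow> 0 \<le> t \<Longrightarrow> continuous (at_right t) (\<lambda>s. N s \<omega>)"
    and N_adapted: "\<And>t. 0 \<le> t \<Longrightarrow> N t \<in> measurable (F t) (count_space UNIV)"
    and N_poisson: "\<And>s t. 0 \<le> s \<Longrightarrow> s < t \<Longrightarrow>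
        distr P (count_space UNIV) (\<lambda>\<omega>. N t \<omega> - N s \<omega>) = measure_pmf (poisson_pmf (lam * (t - s)))"
    and Y_indep: "indep_vars (\<lambda>_. borel) Y UNIV"
    and Y_law: "\<And>i. distr P borel (Y i) = \<nu>"
    and Y_N_indep: "indep_var
        (PiM UNIV (\<lambda>_. borel)) (\<lambda>\<omega> i. Y i \<omega>)
        (PiM {0..} (\<lambda>_. count_space UNIV)) (\<lambda>\<omega>. \<lambda>t\<in>{0..}. N t \<omega>)"
    and total_adapted: "\<And>t. 0 \<le> t \<Longrightarrow> claim_total N Y t \<in> borel_measurable (F t)"
    and increments_indep: "\<And>s t. 0 \<le> s \<Longrightarrow> s \<le> t \<Longrightarrow>
        indep_set (sets (F s))
          (sets (vimage_algebra (space P)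
             (\<lambda>\<omega>. (N t \<omega> - N s \<omega>, claim_total N Y t \<omega> - claim_total N Y s \<omega>))
             (count_space UNIV \<Otimes>\<^sub>M borel)))"

text \<open>Convention: the left limit at time \<open>0\<close> is \<open>F 0\<close> itself.\<close>

definition filtration_left :: "'a measure \<Rightarrow> (real \<Rightarrow> 'a measure) \<Rightarrow> real \<Rightarrow> 'a measure" where
  "filtration_left P F t =
     (if t \<le> 0 then F 0 else sigma (space P) (\<Union>s\<in>{0..<t}. sets (F s)))"

definition predictable_algebra ::
  "'a measure \<Rightarrow> (real \<Rightarrow> 'a measure) \<Rightarrow> (real \<times> 'a) measure" where
  "predictable_algebra P F =
     sigma ({0..} \<times> space P)
       ({{0} \<times> A | A. A \<in> sets (F 0)} \<union>
        {{s<..t} \<times> A | s t A. 0 \<le> s \<and> s < t \<and> A \<in> sets (F s)})"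

section \<open>Retention strategies and controlled surplus\<close>

text \<open>Measurability with respect to the left limit of the filtration expresses that the retention
  is chosen before the claim is seen. Stated for each fixed \<open>t\<close> it does not achieve this: over a
  complete filtration a field that uses one retention function at the claim times and another one
  (with a larger drift) at all other times satisfies it, since \<open>t\<close> is almost surely not a claim
  time, and it is progressively measurable too. The retention is therefore required to be
  predictable as a function of time, scenario and claim size jointly. The predictability clause
  implies the two preceding ones.\<close>

definition admissible_strategy ::
  "real measure \<Rightarrow> real \<Rightarrow> real \<Rightarrow> real \<Rightarrow> real \<Rightarrow> 'a measure \<Rightarrow> (real \<Rightarrow> 'a measure) \<Rightarrow>
    (real \<Rightarrow> 'a \<Rightarrow> real \<Rightarrow> real) \<Rightarrow> bool" where
  "admissible_strategy \<nu> lam \<theta> \<eta> c P F R \<longleftrightarrow>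
     (\<forall>t\<ge>0. (\<lambda>(\<omega>, y). R t \<omega> y) \<in> borel_measurable (filtration_left P F t \<Otimes>\<^sub>M borel)) \<and>
     (\<forall>t\<ge>0. (\<lambda>(s, \<omega>, y). R s \<omega> y)
        \<in> borel_measurable (restrict_space borel {0..t} \<Otimes>\<^sub>M F t \<Otimes>\<^sub>M borel)) \<and>
     (\<lambda>((t, \<omega>), y). R t \<omega> y) \<in> borel_measurable (predictable_algebra P F \<Otimes>\<^sub>M borel) \<and>
     (\<forall>t\<ge>0. \<forall>\<omega>\<in>space P. retention_bounds (R t \<omega>)) \<and>
     (AE \<omega> in P. \<forall>t\<ge>0. net_profit \<nu> lam \<theta> \<eta> c (R t \<omega>))"

definition claim_time :: "(real \<Rightarrow> 'a \<Rightarrow> nat) \<Rightarrow> nat \<Rightarrow> 'a \<Rightarrow> real" where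
  "claim_time N i \<omega> = Inf {t. 0 \<le> t \<and> i < N t \<omega>}"

definition surplus ::
  "real measure \<Rightarrow> real \<Rightarrow> real \<Rightarrow> real \<Rightarrow> real \<Rightarrow> (real \<Rightarrow> 'a \<Rightarrow> nat) \<Rightarrow> (nat \<Rightarrow> 'a \<Rightarrow> real) \<Rightarrow>
    (real \<Rightarrow> 'a \<Rightarrow> real \<Rightarrow> real) \<Rightarrow> real \<Rightarrow> real \<Rightarrow> 'a \<Rightarrow> real" where
  "surplus \<nu> lam \<theta> \<eta> c N Y R x t \<omega> =
     x + (LINT s:{0..t}|lborel. drift \<nu> lam \<theta> \<eta> c (R s \<omega>))
       - (\<Sum>i<N t \<omega>. R (claim_time N i \<omega>) \<omega> (Y i \<omega>))"

definition running_max :: "(real \<Rightarrow> 'a \<Rightarrow> real) \<Rightarrow> real \<Rightarrow> real \<Rightarrow> 'a \<Rightarrow> real" where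
  "running_max X m t \<omega> = max (SUP s\<in>{0..t}. X s \<omega>) m"

definition drawdown_time :: "real \<Rightarrow> (real \<Rightarrow> 'a \<Rightarrow> real) \<Rightarrow> real \<Rightarrow> 'a \<Rightarrow> ereal" where
  "drawdown_time \<alpha> X m \<omega> = Inf (ereal ` {t. 0 \<le> t \<and> X t \<omega> < \<alpha> * running_max X m t \<omega>})"

definition min_drawdown_prob ::
  "real measure \<Rightarrow> real \<Rightarrow> real \<Rightarrow> real \<Rightarrow> real \<Rightarrow> real \<Rightarrow> 'a measure \<Rightarrow> (real \<Rightarrow> 'a measure) \<Rightarrow>
    (real \<Rightarrow> 'a \<Rightarrow> nat) \<Rightarrow> (nat \<Rightarrow> 'a \<Rightarrow> real) \<Rightarrow> real \<Rightarrow> real \<Rightarrow> real" where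
  "min_drawdown_prob \<nu> \<alpha> lam \<theta> \<eta> c P F N Y x m =
     (INF R\<in>{R. admissible_strategy \<nu> lam \<theta> \<eta> c P F R}.
        measure P {\<omega>\<in>space P. drawdown_time \<alpha> (surplus \<nu> lam \<theta> \<eta> c N Y R x) m \<omega> < \<infinity>})"

section \<open>Smooth functions on the domain and the generator\<close>

text \<open>\<open>ux\<close> and \<open>um\<close> are the partial derivatives, one-sided at boundary points. Where a section of
  \<open>D\<close> is a single point, which happens only at the origin, the derivative condition is void and the
  value of the partial derivative is the limit from the rest of \<open>D\<close>, by continuity.\<close>

definition C11_on ::
  "(real \<times> real) set \<Rightarrow> (real \<Rightarrow> real \<Rightarrow> real) \<Rightarrow> (real \<Rightarrow> real \<Rightarrow> real) \<Rightarrow> (real \<Rightarrow> real \<Rightarrow> real) \<Rightarrow> bool"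
where
  "C11_on D u ux um \<longleftrightarrow>
     continuous_on D (\<lambda>(x, m). u x m) \<and>
     continuous_on D (\<lambda>(x, m). ux x m) \<and>
     continuous_on D (\<lambda>(x, m). um x m) \<and>
     (\<forall>(x, m)\<in>D.
        ((\<lambda>x'. u x' m) has_real_derivative ux x m) (at x within {x'. (x', m) \<in> D}) \<and>
        ((\<lambda>m'. u x m') has_real_derivative um x m) (at m within {m'. (x, m') \<in> D}))"

definition generator ::
  "real measure \<Rightarrow> real \<Rightarrow> real \<Rightarrow> real \<Rightarrow> real \<Rightarrow> (real \<Rightarrow> real) \<Rightarrow>
    (real \<Rightarrow> real \<Rightarrow> real) \<Rightarrow> (real \<Rightarrow> real \<Rightarrow> real) \<Rightarrow> real \<Rightarrow> real \<Rightarrow> real" where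
  "generator \<nu> lam \<theta> \<eta> c R u ux x m =
     - kappa \<nu> lam \<theta> \<eta> c * ux x m
     + lam * (((1 + \<theta>) * (LINT y|\<nu>. R y) + \<eta> * (LINT y|\<nu>. y * R y)
                 - \<eta> / 2 * (LINT y|\<nu>. (R y)\<^sup>2)) * ux x m
              + (LINT y|\<nu>. u (x - R y) m) - u x m)"

end

(* Fix a strategy and a level n > m with u(n,n) <= e. Along a path, the surplus increases
   continuously between claims; while it runs along the diagonal, the condition u_m(m,m) >= 0 makes
   u grow at least like its x-part, so up to the first time of drawdown or of M reaching n the sum of
   the jumps of u and of the integral of u_x times the drift is at most the increment of u.
   The expectation of this sum is computed by the compensation formula of the claim process; by
   L^R u >= 0 it is nonnegative. Hence u(x,m) <= P(drawdown) + e + C * P(neither happens before K),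
   and the last probability tends to 0 because exp(- g x), cut off below -1, has a generator bounded
   away from 0 on bounded sets: an admissible retention function cannot be close to zero.

   The compensation formula needs the measure counting the claims with size in B, which is not given
   directly: increments independent of the past give a deterministic intensity measure, and testing
   it with the indicators of {N_{s-} = j} determines its moments against exp(- lam s), since claim
   number j is independent of N at integer times. *)

theory Submission
  imports Defs
begin

section \<open>A mean value inequality along the diagonal\<close>

text \<open>A strategy is only measurable in time, so the drift has no continuity and no chain rule
  holds pointwise along a path. It is replaced by an inequality that is additive over adjacent
  intervals and local in time, hence can be glued by bisection. Stopping is encoded by the predicate
  \<open>active\<close>, which looks strictly before the current time, and not by a stopping time:
  the claim that causes the drawdown is still counted, everything after it is not, and the
  integrands remain predictable, as the compensation formula demands. Path arguments are carried out
  for one fixed scenario; probability enters through measurability and a single expectation,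
  \<open>dynkin\<close>. That estimate is used twice: with \<open>lyap\<close> and \<delta> > 0 it
  bounds the probability of still running at time K by a multiple of 1 / K, and with the candidate
  and \<delta> = 0 it yields the comparison. The horizon K is an integer because claim sizes and
  counts are known to be independent only at integer times.\<close>

lemma C11_onD:
  assumes "C11_on D u ux um"
  shows "continuous_on D (\<lambda>(x, m). u x m)" "continuous_on D (\<lambda>(x, m). ux x m)"
    "continuous_on D (\<lambda>(x, m). um x m)"
    "\<And>x m. (x, m) \<in> D \<Longrightarrow>
      ((\<lambda>x'. u x' m) has_real_derivative ux x m) (at x within {x'. (x', m) \<in> D})"
    "\<And>x m. (x, m) \<in> D \<Longrightarrow>
      ((\<lambda>m'. u x m') has_real_derivative um x m) (at m within {m'. (x, m') \<in> D})"
  using assms unfolding C11_on_def by auto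

text \<open>The function stays abstract because the path inequality is applied to two of them: a
  cut-off version of the candidate \<open>u\<close>, and the exponential \<open>lyap\<close>, which
  does not take the value 1 below the drawdown level.\<close>

locale smooth_on_domain =
  fixes \<alpha> :: real and w wx wm :: "real \<Rightarrow> real \<Rightarrow> real"
  assumes alpha: "0 \<le> \<alpha>" "\<alpha> < 1"
    and smooth: "C11_on (domain_D \<alpha>) w wx wm"
    and diag: "\<And>m. 0 \<le> m \<Longrightarrow> wm m m \<ge> 0"
begin

lemma in_domain_iff: "(x, m) \<in> domain_D \<alpha> \<longleftrightarrow> 0 \<le> x \<and> 0 \<le> m \<and> \<alpha> * m \<le> x \<and> x \<le> m"
  by (simp add: domain_D_def)

lemma diag_in_domain: "0 \<le> z \<Longrightarrow> (z, z) \<in> domain_D \<alpha>"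
  using alpha by (auto simp: in_domain_iff mult_left_le_one_le)

lemma mvt_x:
  assumes "0 \<le> m" "\<alpha> * m \<le> a" "a < b" "b \<le> m"
  shows "\<exists>\<xi>\<in>{a<..<b}. w b m - w a m = (b - a) * wx \<xi> m"
proof -
  have a0: "0 \<le> a" using assms alpha by (smt (verit) mult_nonneg_nonneg)
  have "\<exists>\<xi>\<in>{a<..<b}. w b m - w a m = (\<lambda>h. h * wx \<xi> m) (b - a)"
  proof (rule mvt_simple[where f = "\<lambda>x. w x m" and f' = "\<lambda>x h. h * wx x m", OF assms(3)])
    fix x assume "a \<le> x" "x \<le> b"
    then have "(x, m) \<in> domain_D \<alpha>" using assms a0 by (auto simp: in_domain_iff)
    then have "((\<lambda>x. w x m) has_real_derivative wx x m) (at x within {x'. (x', m) \<in> domain_D \<alpha>})"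
      by (rule C11_onD(4)[OF smooth])
    then have "((\<lambda>x. w x m) has_real_derivative wx x m) (at x within {a..b})"
      by (rule has_field_derivative_subset) (use assms a0 in \<open>auto simp: in_domain_iff\<close>)
    then show "((\<lambda>x. w x m) has_derivative (\<lambda>h. h * wx x m)) (at x within {a..b})"
      by (simp add: has_field_derivative_def mult.commute[of _ "wx x m"])
  qed
  then show ?thesis by auto
qed

lemma mvt_m:
  assumes "0 \<le> a" "a < b" "\<alpha> * b \<le> a"
  shows "\<exists>\<mu>\<in>{a<..<b}. w a b - w a a = (b - a) * wm a \<mu>"
proof -
  have "\<exists>\<xi>\<in>{a<..<b}. w a b - w a a = (\<lambda>h. h * wm a \<xi>) (b - a)"
  proof (rule mvt_simple[where f = "\<lambda>x. w a x" and f' = "\<lambda>x h. h * wm a x", OF assms(2)])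
    fix x assume x: "a \<le> x" "x \<le> b"
    have *: "(a, x) \<in> domain_D \<alpha>" if "a \<le> x" "x \<le> b" for x
      using assms that alpha by (auto simp: in_domain_iff intro: order_trans[OF mult_left_mono])
    have "((\<lambda>x. w a x) has_real_derivative wm a x) (at x within {x'. (a, x') \<in> domain_D \<alpha>})"
      by (rule C11_onD(5)[OF smooth *[OF x]])
    then have "((\<lambda>x. w a x) has_real_derivative wm a x) (at x within {a..b})"
      by (rule has_field_derivative_subset) (use * in auto)
    then show "((\<lambda>x. w a x) has_derivative (\<lambda>h. h * wm a x)) (at x within {a..b})"
      by (simp add: has_field_derivative_def mult.commute[of _ "wm a x"])
  qed
  then show ?thesis by auto
qed

lemma dist_pair_lt: "\<bar>x - a\<bar> < d/2 \<Longrightarrow> \<bar>y - b\<bar> < d/2 \<Longrightarrow> dist (x, y) (a, b) < (d::real)"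
  using sqrt_sum_squares_le_sum_abs[of "x - a" "y - b"] unfolding dist_Pair_Pair dist_real_def
  by simp

lemma continuous_on_domain_near:
  assumes f: "continuous_on (domain_D \<alpha>) (\<lambda>(x, m). f x m)" and z: "0 \<le> z" and e: "0 < (e::real)"
  shows "\<exists>d>0. \<forall>x m. (x, m) \<in> domain_D \<alpha> \<and> \<bar>x - z\<bar> < d \<and> \<bar>m - z\<bar> < d \<longrightarrow> \<bar>f x m - f z z\<bar> < e"
proof -
  obtain d where d: "d > 0" "\<And>p. p \<in> domain_D \<alpha> \<Longrightarrow> dist p (z, z) < d \<Longrightarrow>
      dist ((\<lambda>(x, m). f x m) p) ((\<lambda>(x, m). f x m) (z, z)) < e"
    using f diag_in_domain[OF z] e unfolding continuous_on_iff by metis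
  have "\<bar>f x m - f z z\<bar> < e"
    if "(x, m) \<in> domain_D \<alpha>" "\<bar>x - z\<bar> < d/2" "\<bar>m - z\<bar> < d/2" for x m
    using d(2)[OF that(1) dist_pair_lt[OF that(2,3)]] by (simp add: dist_real_def)
  then show ?thesis using d(1) by (intro exI[of _ "d/2"]) auto
qed

text \<open>Only partial derivatives are given, so the increment is split along the legs from (a, a)
  to (a, b) and from (a, b) to (b, b), with a one-variable mean value theorem on each; joint
  continuity of both partials gives the limit. The corner (a, b) has to lie in the domain, which is
  where z > 0 enters.\<close>

lemma diagonal_derivative:
  assumes z: "0 < z"
  shows "((\<lambda>z. w z z) has_real_derivative wx z z + wm z z) (at z)"
  unfolding has_field_derivative_def has_derivative_at_alt
proof (intro conjI allI impI)
  show "bounded_linear ((*) (wx z z + wm z z))" by (rule bounded_linear_mult_right)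
  fix e :: real assume e: "0 < e"
  obtain d1 where d1: "d1 > 0" "\<And>x m. (x, m) \<in> domain_D \<alpha> \<Longrightarrow> \<bar>x - z\<bar> < d1 \<Longrightarrow> \<bar>m - z\<bar> < d1 \<Longrightarrow>
      \<bar>wx x m - wx z z\<bar> < e / 2"
    using continuous_on_domain_near[OF C11_onD(2)[OF smooth], of z "e/2"] z e by auto
  obtain d2 where d2: "d2 > 0" "\<And>x m. (x, m) \<in> domain_D \<alpha> \<Longrightarrow> \<bar>x - z\<bar> < d2 \<Longrightarrow> \<bar>m - z\<bar> < d2 \<Longrightarrow>
      \<bar>wm x m - wm z z\<bar> < e / 2"
    using continuous_on_domain_near[OF C11_onD(3)[OF smooth], of z "e/2"] z e by auto
  \<comment> \<open>The bound z keeps a nonnegative; (1 - \<alpha>) * z / 2 gives \<alpha> * b \<le>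
    a, i.e. the corner is in the domain, whether z is the left or the right endpoint.\<close>
  define d where "d = min (min d1 d2) (min z ((1 - \<alpha>) * z / 2))"
  have dpos: "d > 0" using d1 d2 z alpha by (simp add: d_def)
  have key: "\<bar>w b b - w a a - (wx z z + wm z z) * (b - a)\<bar> \<le> e * (b - a)"
    if ab: "a < b" "\<bar>a - z\<bar> < d" "\<bar>b - z\<bar> < d" "a = z \<or> b = z" for a b
  proof -
    have dz: "d \<le> z" "d \<le> (1 - \<alpha>) * z / 2" "d \<le> d1" "d \<le> d2" by (auto simp: d_def)
    have a0: "0 \<le> a" using ab dz by auto
    have adm: "\<alpha> * b \<le> a"
    proof -
      have ad: "\<alpha> * d \<le> d" using alpha dpos by (simp add: mult_left_le_one_le)
      from ab(4) show ?thesis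
      proof
        assume "a = z"
        then have "\<alpha> * b \<le> \<alpha> * (z + d)" using ab alpha by (intro mult_left_mono) auto
        also have "\<dots> \<le> z"
        proof -
          have "\<alpha> * (z + d) \<le> \<alpha> * z + d" unfolding distrib_left using ad by (rule add_left_mono)
          moreover have "d + d \<le> z - \<alpha> * z" using dz(2) by (simp add: algebra_simps)
          ultimately show ?thesis using dpos by simp
        qed
        finally show ?thesis using \<open>a = z\<close> by simp
      next
        assume "b = z"
        have "(1 - \<alpha>) * z \<ge> 0" using alpha z by simp
        then show ?thesis using \<open>b = z\<close> ab dz(2) by (simp add: algebra_simps)
      qed
    qed
    obtain \<mu> where mu: "\<mu> \<in> {a<..<b}" "w a b - w a a = (b - a) * wm a \<mu>"
      using mvt_m[OF a0 ab(1) adm] by auto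
    obtain \<xi> where xi: "\<xi> \<in> {a<..<b}" "w b b - w a b = (b - a) * wx \<xi> b"
      using mvt_x[of b a b] a0 ab adm by auto
    have dom: "(a, \<mu>) \<in> domain_D \<alpha>" "(\<xi>, b) \<in> domain_D \<alpha>"
      using a0 ab adm mu xi alpha
      by (auto simp: in_domain_iff intro: order_trans[OF mult_left_mono[of \<mu> b]])
    have "\<bar>wx \<xi> b - wx z z\<bar> < e / 2" using d1(2)[OF dom(2)] ab xi dz by auto
    moreover have "\<bar>wm a \<mu> - wm z z\<bar> < e / 2" using d2(2)[OF dom(1)] ab mu dz by auto
    ultimately have *: "\<bar>(wx \<xi> b - wx z z) + (wm a \<mu> - wm z z)\<bar> \<le> e" by linarith
    have "w b b - w a a - (wx z z + wm z z) * (b - a)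
        = ((wx \<xi> b - wx z z) + (wm a \<mu> - wm z z)) * (b - a)"
      using mu(2) xi(2) by (simp add: algebra_simps)
    then show ?thesis using * ab(1) by (simp add: abs_mult mult_right_mono)
  qed
  have "norm (w y y - w z z - (wx z z + wm z z) * (y - z)) \<le> e * norm (y - z)"
    if "norm (y - z) < d" for y
  proof (cases y z rule: linorder_cases)
    case less
    have "w z z - w y y - (wx z z + wm z z) * (z - y) = -(w y y - w z z - (wx z z + wm z z) * (y - z))"
      by (simp add: algebra_simps)
    with key[of y z] less that dpos show ?thesis by (simp add: abs_minus_commute)
  next
    case greater
    with key[of z y] that dpos show ?thesis by simp
  qed simp
  then show "\<exists>d>0. \<forall>y. norm (y - z) < d \<longrightarrow>
      norm (w y y - w z z - (wx z z + wm z z) * (y - z)) \<le> e * norm (y - z)"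
    using dpos by blast
qed

text \<open>This is where the sign condition on the diagonal enters: the \<open>wm\<close> part of
  the diagonal derivative is nonnegative and is dropped. The derivative is taken only inside the
  interval; at a = 0 continuity suffices.\<close>

lemma mvt_diagonal:
  assumes "0 \<le> a" "a < b"
  shows "\<exists>\<xi>\<in>{a<..<b}. w b b - w a a \<ge> (b - a) * wx \<xi> \<xi>"
proof -
  have "continuous_on {a..b} ((\<lambda>(x, m). w x m) \<circ> (\<lambda>z. (z, z)))"
    using diag_in_domain assms
    by (intro continuous_on_compose continuous_intros continuous_on_subset[OF C11_onD(1)[OF smooth]]) auto
  then have cont: "continuous_on {a..b} (\<lambda>z. w z z)" by (simp add: o_def)
  have "((\<lambda>z. w z z) has_derivative (*) (wx x x + wm x x)) (at x)" if "a < x" "x < b" for x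
    using diagonal_derivative[of x] assms that by (simp add: has_field_derivative_def)
  then obtain \<xi> where xi: "a < \<xi>" "\<xi> < b" "w b b - w a a = (wx \<xi> \<xi> + wm \<xi> \<xi>) * (b - a)"
    using mvt[OF assms(2) cont, where f' = "\<lambda>x. (*) (wx x x + wm x x)"] by blast
  have "wm \<xi> \<xi> * (b - a) \<ge> 0" using diag[of \<xi>] xi assms by simp
  then show ?thesis using xi by (intro bexI[of _ \<xi>]) (auto simp: algebra_simps)
qed

text \<open>The point (z, max z m) moves horizontally until z reaches m and then along the diagonal.
  If both pieces occur, the increment is at least b - a times a convex combination of two values of
  \<open>wx\<close>, hence at least b - a times the smaller one, so a single intermediate point
  suffices.\<close>

lemma mvt_reflected:
  assumes "0 \<le> m" "\<alpha> * m \<le> a" "a \<le> b"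
  shows "\<exists>\<xi>\<in>{a..b}. w b (max b m) - w a (max a m) \<ge> (b - a) * wx \<xi> (max \<xi> m)"
proof (cases "a = b")
  case True then show ?thesis by auto
next
  case False
  then have ab: "a < b" using assms by simp
  have a0: "0 \<le> a" using assms alpha by (smt (verit) mult_nonneg_nonneg)
  consider "b \<le> m" | "m \<le> a" | "a < m" "m < b" by linarith
  then show ?thesis
  proof cases
    case 1
    then obtain \<xi> where "\<xi> \<in> {a<..<b}" "w b m - w a m = (b - a) * wx \<xi> m"
      using mvt_x[OF assms(1,2) ab] by auto
    with 1 ab show ?thesis by (intro bexI[of _ \<xi>]) (auto simp: max_def)
  next
    case 2
    then obtain \<xi> where "\<xi> \<in> {a<..<b}" "w b b - w a a \<ge> (b - a) * wx \<xi> \<xi>"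
      using mvt_diagonal[OF a0 ab] by auto
    with 2 ab show ?thesis by (intro bexI[of _ \<xi>]) (auto simp: max_def)
  next
    case 3
    obtain x1 where x1: "x1 \<in> {a<..<m}" "w m m - w a m = (m - a) * wx x1 m"
      using mvt_x[OF assms(1,2) 3(1)] by auto
    obtain x2 where x2: "x2 \<in> {m<..<b}" "w b b - w m m \<ge> (b - m) * wx x2 x2"
      using mvt_diagonal[OF assms(1) 3(2)] by auto
    have sum: "w b b - w a m \<ge> (m - a) * wx x1 m + (b - m) * wx x2 x2" using x1 x2 by linarith
    show ?thesis
    proof (cases "wx x1 m \<le> wx x2 x2")
      case True
      then have "(b - m) * wx x1 m \<le> (b - m) * wx x2 x2" using 3 by (intro mult_left_mono) auto
      then have "w b b - w a m \<ge> (b - a) * wx x1 m" using sum by (simp add: algebra_simps)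
      then show ?thesis using 3 x1 by (intro bexI[of _ x1]) (auto simp: max_def)
    next
      case False
      then have "(m - a) * wx x2 x2 \<le> (m - a) * wx x1 m" using 3 by (intro mult_left_mono) auto
      then have "w b b - w a m \<ge> (b - a) * wx x2 x2" using sum by (simp add: algebra_simps)
      then show ?thesis using 3 x2 by (intro bexI[of _ x2]) (auto simp: max_def)
    qed
  qed
qed

end

section \<open>Absolutely continuous increasing paths reflected into the diagonal\<close>

lemma set_integral_combine:
  fixes f :: "real \<Rightarrow> real"
  assumes "a \<le> b" "b \<le> c" "set_integrable lborel {a..c} f"
  shows "(LINT s:{a..c}|lborel. f s) = (LINT s:{a..b}|lborel. f s) + (LINT s:{b..c}|lborel. f s)"
proof -
  have *: "set_integrable lborel {a..b} f" "set_integrable lborel {b..c} f"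
    using assms by (auto intro: set_integrable_subset[OF assms(3)])
  show ?thesis
    using set_borel_integral_eq_integral[OF *(1)] set_borel_integral_eq_integral[OF *(2)]
      set_borel_integral_eq_integral[OF assms(3)]
      Henstock_Kurzweil_Integration.integral_combine[OF assms(1,2), of f]
    by linarith
qed

lemma continuous_on_set_integral:
  fixes f :: "real \<Rightarrow> real"
  assumes "set_integrable lborel {a..b} f"
  shows "continuous_on {a..b} (\<lambda>r. LINT s:{a..r}|lborel. f s)"
proof -
  have "continuous_on {a..b} (\<lambda>r. integral {a..r} f)"
    using set_borel_integral_eq_integral(1)[OF assms] by (rule indefinite_integral_continuous_1)
  moreover have "(LINT s:{a..r}|lborel. f s) = integral {a..r} f" if "r \<in> {a..b}" for r
    by (rule set_borel_integral_eq_integral(2)[OF set_integrable_subset[OF assms]]) (use that in auto)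
  ultimately show ?thesis by (metis (no_types, lifting) continuous_on_cong)
qed

lemma set_integrable_continuous_mult:
  fixes f g :: "real \<Rightarrow> real"
  assumes f: "set_integrable lborel {a..b} f" and g: "continuous_on {a..b} g"
  shows "set_integrable lborel {a..b} (\<lambda>s. g s * f s)"
proof -
  have "bounded (g ` {a..b})" by (rule compact_imp_bounded[OF compact_continuous_image[OF g]]) simp
  then obtain B where B: "\<And>s. s \<in> {a..b} \<Longrightarrow> \<bar>g s\<bar> \<le> B" unfolding bounded_iff by (metis imageI real_norm_def)
  have gm: "(\<lambda>s. indicator {a..b} s *\<^sub>R g s) \<in> borel_measurable borel"
    by (rule borel_measurable_continuous_on_indicator[OF _ g]) simp
  have fm: "(\<lambda>s. indicator {a..b} s *\<^sub>R f s) \<in> borel_measurable borel"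
    using borel_measurable_integrable[OF f[unfolded set_integrable_def]] by simp
  have eq: "(\<lambda>s. indicator {a..b} s *\<^sub>R (g s * f s)) =
      (\<lambda>s. (indicator {a..b} s *\<^sub>R g s) * (indicator {a..b} s *\<^sub>R f s))"
    by (auto simp: indicator_def)
  show ?thesis unfolding set_integrable_def
  proof (rule Bochner_Integration.integrable_bound[where f = "\<lambda>s. B * (indicator {a..b} s *\<^sub>R f s)"])
    show "integrable lborel (\<lambda>s. B * (indicator {a..b} s *\<^sub>R f s))"
      using f unfolding set_integrable_def by simp
    show "(\<lambda>s. indicator {a..b} s *\<^sub>R (g s * f s)) \<in> borel_measurable lborel"
      unfolding eq using gm fm by simp
    show "AE s in lborel. norm (indicator {a..b} s *\<^sub>R (g s * f s)) \<le> norm (B * (indicator {a..b} s *\<^sub>R f s))"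
      by (rule AE_I2) (auto simp: indicator_def abs_mult intro!: mult_right_mono order_trans[OF B])
  qed
qed

context smooth_on_domain
begin

lemma continuous_on_reflected:
  assumes f: "continuous_on (domain_D \<alpha>) (\<lambda>(x, m). f x m)"
    and X: "continuous_on S X" and m0: "0 \<le> m0" and low: "\<And>s. s \<in> S \<Longrightarrow> \<alpha> * m0 \<le> X s"
  shows "continuous_on S (\<lambda>s. f (X s) (max (X s) m0))"
proof -
  have "(X s, max (X s) m0) \<in> domain_D \<alpha>" if "s \<in> S" for s
  proof -
    have "0 \<le> \<alpha> * m0" using m0 alpha by simp
    then have "0 \<le> X s" using low[OF that] by simp
    then have "\<alpha> * X s \<le> X s" using alpha by (simp add: mult_left_le_one_le)
    then show ?thesis using low[OF that] m0 \<open>0 \<le> X s\<close> by (auto simp: in_domain_iff max_def)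
  qed
  then have "continuous_on S ((\<lambda>(x, m). f x m) \<circ> (\<lambda>s. (X s, max (X s) m0)))"
    by (intro continuous_on_compose continuous_intros X continuous_on_subset[OF f]) auto
  then show ?thesis by (simp add: o_def)
qed

text \<open>\<open>X\<close> is merely absolutely continuous. The inequality is first proved with
  the error e * (X b - X a), on intervals so short that \<open>wx\<close> varies by less than e
  along the path. This error is additive over adjacent intervals, so the pieces combine, and then e
  tends to 0.\<close>

lemma reflected_path_bound:
  fixes p q m0 X0 :: real and d X :: "real \<Rightarrow> real"
  assumes pq: "p \<le> q" and int: "set_integrable lborel {p..q} d"
    and d0: "\<And>s. s \<in> {p..q} \<Longrightarrow> 0 \<le> d s"
    and X: "\<And>r. r \<in> {p..q} \<Longrightarrow> X r = X0 + (LINT s:{p..r}|lborel. d s)"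
    and m0: "0 \<le> m0" and X0: "\<alpha> * m0 \<le> X0"
  shows "(LINT s:{p..q}|lborel. wx (X s) (max (X s) m0) * d s)
      \<le> w (X q) (max (X q) m0) - w (X p) (max (X p) m0)"
proof -
  define g where "g s = wx (X s) (max (X s) m0)" for s
  define \<Phi> where "\<Phi> s = w (X s) (max (X s) m0)" for s
  have sub: "set_integrable lborel {a..b} d" if "p \<le> a" "b \<le> q" for a b
    by (rule set_integrable_subset[OF int]) (use that in auto)
  have incr: "X b - X a = (LINT s:{a..b}|lborel. d s)" if "p \<le> a" "a \<le> b" "b \<le> q" for a b
    using set_integral_combine[OF that(1,2) sub[OF order_refl that(3)]] that by (simp add: X)
  have mono: "X a \<le> X b" if "p \<le> a" "a \<le> b" "b \<le> q" for a b
  proof -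
    have "0 \<le> (LINT s:{a..b}|lborel. d s)" unfolding set_lebesgue_integral_def
      by (rule integral_nonneg_AE) (use that d0 in \<open>auto simp: indicator_def\<close>)
    then show ?thesis using incr[OF that] by simp
  qed
  have Xp: "X p = X0"
    using X[of p] pq set_borel_integral_eq_integral(2)[OF sub[of p p]] by simp
  have low: "\<alpha> * m0 \<le> X s" if "s \<in> {p..q}" for s
    using mono[of p s] that X0 Xp by auto
  have contX: "continuous_on {p..q} X"
    using continuous_on_set_integral[OF int] X
    by (subst continuous_on_cong[OF refl X]) (auto intro!: continuous_intros)
  have contg: "continuous_on {p..q} g"
    unfolding g_def by (rule continuous_on_reflected[OF C11_onD(2)[OF smooth] contX m0 low])
  have gint: "set_integrable lborel {p..q} (\<lambda>s. g s * d s)"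
    by (rule set_integrable_continuous_mult[OF int contg])
  have gsub: "set_integrable lborel {a..b} (\<lambda>s. g s * d s)" if "p \<le> a" "b \<le> q" for a b
    by (rule set_integrable_subset[OF gint]) (use that in auto)
  have main: "(LINT s:{p..q}|lborel. g s * d s) - e * (X q - X p) \<le> \<Phi> q - \<Phi> p" if e: "0 < e" for e
  proof -
    obtain \<delta> where \<delta>: "\<delta> > 0" "\<And>s t. s \<in> {p..q} \<Longrightarrow> t \<in> {p..q} \<Longrightarrow> \<bar>t - s\<bar> < \<delta> \<Longrightarrow> \<bar>g t - g s\<bar> < e"
      using compact_uniformly_continuous[OF contg] e unfolding uniformly_continuous_on_def dist_real_def
      by (metis compact_Icc)
    \<comment> \<open>All terms, including the error, add up over adjacent intervals, as
      \<open>Bolzano\<close> requires. The guard makes the claim vacuous for the intervals around a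
      point that stick out of {p..q}.\<close>
    define Q where "Q a b \<longleftrightarrow> (p \<le> a \<and> b \<le> q \<longrightarrow>
        (LINT s:{a..b}|lborel. g s * d s) - e * (X b - X a) \<le> \<Phi> b - \<Phi> a)" for a b
    have "Q p q"
    proof (rule Bolzano[OF pq])
      show "Q a c" if "Q a b" "Q b c" "a \<le> b" "b \<le> c" for a b c
        unfolding Q_def
      proof
        assume ac: "p \<le> a \<and> c \<le> q"
        have "(LINT s:{a..c}|lborel. g s * d s) =
            (LINT s:{a..b}|lborel. g s * d s) + (LINT s:{b..c}|lborel. g s * d s)"
          using that ac by (intro set_integral_combine gsub) auto
        moreover have "e * (X c - X a) = e * (X c - X b) + e * (X b - X a)"
          by (simp add: algebra_simps)
        ultimately show "(LINT s:{a..c}|lborel. g s * d s) - e * (X c - X a) \<le> \<Phi> c - \<Phi> a"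
          using that ac unfolding Q_def by auto
      qed
      fix x :: real
      show "\<exists>\<delta>>0. \<forall>a b. a \<le> x \<and> x \<le> b \<and> b - a < \<delta> \<longrightarrow> Q a b"
      proof (intro exI[of _ \<delta>] conjI allI impI \<delta>(1))
        fix a b assume ab: "a \<le> x \<and> x \<le> b \<and> b - a < \<delta>"
        show "Q a b" unfolding Q_def
        proof
          assume pab: "p \<le> a \<and> b \<le> q"
          obtain \<xi> where xi: "\<xi> \<in> {X a..X b}"
            "w (X b) (max (X b) m0) - w (X a) (max (X a) m0) \<ge> (X b - X a) * wx \<xi> (max \<xi> m0)"
            using mvt_reflected[OF m0 low[of a] mono[of a b]] ab pab by auto
          have "continuous_on {a..b} X" using contX by (rule continuous_on_subset) (use pab in auto)
          \<comment> \<open>The mean value theorem yields a level \<xi> of the path; the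
            intermediate value theorem turns it into a time t, so that \<open>wx\<close> at \<xi>
            becomes g t and uniform continuity compares it with g s.\<close>
          then obtain t where t: "t \<in> {a..b}" "X t = \<xi>"
            using IVT'[of X a \<xi> b] xi ab by auto
          have "(LINT s:{a..b}|lborel. g s * d s) \<le> (LINT s:{a..b}|lborel. (g t + e) * d s)"
          proof (rule set_integral_mono)
            show "set_integrable lborel {a..b} (\<lambda>s. (g t + e) * d s)"
              by (intro set_integrable_mult_right sub) (use pab in auto)
            show "g s * d s \<le> (g t + e) * d s" if "s \<in> {a..b}" for s
            proof (rule mult_right_mono)
              show "0 \<le> d s" using that pab by (intro d0) auto
              show "g s \<le> g t + e" using \<delta>(2)[of t s] that t pab ab by (auto simp: abs_less_iff)
            qed
          qed (use gsub pab in auto)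
          also have "\<dots> = (g t + e) * (X b - X a)"
            using incr[of a b] pab ab by simp
          also have "\<dots> = (X b - X a) * g t + e * (X b - X a)" by (simp add: algebra_simps)
          finally show "(LINT s:{a..b}|lborel. g s * d s) - e * (X b - X a) \<le> \<Phi> b - \<Phi> a"
            using xi(2) t(2) unfolding g_def \<Phi>_def by simp
        qed
      qed
    qed
    then show ?thesis unfolding Q_def by simp
  qed
  have "(LINT s:{p..q}|lborel. g s * d s) \<le> \<Phi> q - \<Phi> p"
  proof (rule field_le_epsilon)
    fix e :: real assume e: "0 < e"
    have pos: "0 \<le> X q - X p" using mono[of p q] pq by simp
    \<comment> \<open>The summand 1 covers a constant path, for which X q - X p = 0.\<close>
    define e' where "e' = e / (X q - X p + 1)"
    have "e' > 0" using e pos by (simp add: e'_def)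
    have "e' * (X q - X p) \<le> e' * (X q - X p + 1)" using \<open>e' > 0\<close> by simp
    also have "\<dots> = e" using pos by (simp add: e'_def)
    finally show "(LINT s:{p..q}|lborel. g s * d s) \<le> \<Phi> q - \<Phi> p + e"
      using main[OF \<open>e' > 0\<close>] by linarith
  qed
  then show ?thesis by (simp add: g_def \<Phi>_def)
qed

end

section \<open>Paths of the controlled surplus\<close>

text \<open>One scenario with all randomness fixed: \<open>V i\<close> is the retained part of claim
  number i and \<open>d\<close> the drift under the chosen retention. The upper bound C keeps the
  suprema behind the running maximum finite on bounded time intervals.\<close>

locale surplus_path =
  fixes N :: "real \<Rightarrow> nat" and V :: "nat \<Rightarrow> real" and d :: "real \<Rightarrow> real" and x m C :: real
  assumes N_0: "N 0 = 0"
    and N_mono: "\<And>s t. 0 \<le> s \<Longrightarrow> s \<le> t \<Longrightarrow> N s \<le> N t"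
    and N_right: "\<And>t. 0 \<le> t \<Longrightarrow> \<exists>\<delta>>0. \<forall>s. t \<le> s \<and> s < t + \<delta> \<longrightarrow> N s = N t"
    and V_nonneg: "\<And>i. 0 \<le> V i"
    and d_int: "\<And>t. set_integrable lborel {0..t} d"
    and d_bound: "\<And>s. 0 \<le> s \<Longrightarrow> d s \<le> C"
    and C_nonneg: "0 \<le> C"
begin

definition X :: "real \<Rightarrow> real" where
  "X t = x + (LINT s:{0..t}|lborel. d s) - (\<Sum>i<N t. V i)"

definition M :: "real \<Rightarrow> real" where "M t = max (SUP s\<in>{0..t}. X s) m"

definition T :: "nat \<Rightarrow> real" where "T i = Inf {t. 0 \<le> t \<and> i < N t}"

text \<open>The left limits of \<open>X\<close> and \<open>M\<close>, written with countably many values of \<open>X\<close> at earlier times so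
  that they are predictable whenever \<open>X\<close> is adapted. They are meant for \<open>s > 0\<close> only.\<close>

definition Xl :: "real \<Rightarrow> real" where
  "Xl s = lim (\<lambda>k. X ((of_int \<lceil>2 ^ k * s\<rceil> - 1) / 2 ^ k))"

definition Ml :: "real \<Rightarrow> real" where
  "Ml s = max (SUP q\<in>\<rat> \<inter> {0..}. if q < s then X q else x) m"

lemma d_int_sub: "0 \<le> a \<Longrightarrow> set_integrable lborel {a..b} d"
  by (rule set_integrable_subset[OF d_int[of b]]) auto

lemma X_0: "X 0 = x"
  using set_borel_integral_eq_integral(2)[OF d_int[of 0]] by (simp add: X_def N_0)

lemma X_incr:
  assumes "0 \<le> p" "p \<le> q" "N p = N q"
  shows "X q = X p + (LINT s:{p..q}|lborel. d s)"
  using set_integral_combine[OF assms(1,2) d_int] assms(3) by (simp add: X_def)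

lemma X_right:
  assumes t: "0 \<le> t" and e: "0 < e"
  shows "\<exists>\<delta>>0. \<forall>s. t \<le> s \<and> s < t + \<delta> \<longrightarrow> \<bar>X s - X t\<bar> < e"
proof -
  obtain \<delta> where \<delta>: "\<delta> > 0" "\<And>s. t \<le> s \<Longrightarrow> s < t + \<delta> \<Longrightarrow> N s = N t" using N_right[OF t] by auto
  have "continuous_on {t..t+1} (\<lambda>r. LINT s:{t..r}|lborel. d s)"
    by (rule continuous_on_set_integral[OF d_int_sub[OF t]])
  then obtain \<delta>' where \<delta>': "\<delta>' > 0" "\<And>r. r \<in> {t..t+1} \<Longrightarrow> dist r t < \<delta>' \<Longrightarrow>
      dist (LINT s:{t..r}|lborel. d s) (LINT s:{t..t}|lborel. d s) < e"
    unfolding continuous_on_iff using e by (metis atLeastAtMost_iff le_add_same_cancel1 order_refl zero_le_one)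
  have z: "(LINT s:{t..t}|lborel. d s) = 0"
    using set_borel_integral_eq_integral(2)[OF d_int_sub[OF t, of t]] by simp
  show ?thesis
  proof (intro exI[of _ "min 1 (min \<delta> \<delta>')"] conjI allI impI)
    show "0 < min 1 (min \<delta> \<delta>')" using \<delta> \<delta>' by simp
    fix s assume s: "t \<le> s \<and> s < t + min 1 (min \<delta> \<delta>')"
    have "N s = N t" by (rule \<delta>(2)) (use s in auto)
    then have Ns: "N t = N s" by (rule sym)
    have "dist (LINT r:{t..s}|lborel. d r) (LINT r:{t..t}|lborel. d r) < e"
      using s by (intro \<delta>'(2)) (auto simp: dist_real_def)
    then show "\<bar>X s - X t\<bar> < e" using X_incr[OF t _ Ns] s z by (simp add: dist_real_def)
  qed
qed

lemma X_bound:
  assumes "0 \<le> s" "s \<le> t" shows "X s \<le> x + C * t"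
proof -
  have "(LINT r:{0..s}|lborel. d r) \<le> (LINT r:{0..s}|lborel. C)"
    by (rule set_integral_mono[OF d_int borel_integrable_atLeastAtMost']) (use d_bound in auto)
  also have "\<dots> = C * s" using assms by (simp add: set_lebesgue_integral_def)
  also have "\<dots> \<le> C * t" using assms C_nonneg by (intro mult_left_mono) auto
  finally show ?thesis using sum_nonneg[of "{..<N s}" V] V_nonneg by (simp add: X_def)
qed

lemma M_le_iff:
  assumes "0 \<le> t" shows "M t \<le> b \<longleftrightarrow> m \<le> b \<and> (\<forall>r\<in>{0..t}. X r \<le> b)"
proof -
  have "bdd_above (X ` {0..t})" by (rule bdd_aboveI2[where M = "x + C * t"]) (use X_bound in auto)
  then have "(SUP s\<in>{0..t}. X s) \<le> b \<longleftrightarrow> (\<forall>r\<in>{0..t}. X r \<le> b)"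
    using assms by (intro cSUP_le_iff) auto
  then show ?thesis by (auto simp: M_def)
qed

lemma Ml_bdd: "bdd_above ((\<lambda>q. if q < (s::real) then X q else x) ` (\<rat> \<inter> {0..}))"
proof (rule bdd_aboveI2[where M = "x + C * max 0 s"])
  fix q :: real assume "q \<in> \<rat> \<inter> {0..}"
  then show "(if q < s then X q else x) \<le> x + C * max 0 s"
    using X_bound[of q s] C_nonneg by (auto simp: max_def)
qed

text \<open>By right continuity, for every r < s some rational time in (r, s) has a surplus
  arbitrarily close to X r. The filler value x in \<open>Ml\<close> adds nothing: it equals X 0,
  which occurs because 0 < s.\<close>

lemma Ml_le_iff:
  assumes s: "0 < s" shows "Ml s \<le> b \<longleftrightarrow> m \<le> b \<and> (\<forall>r\<in>{0..<s}. X r \<le> b)"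
proof -
  have "(SUP q\<in>\<rat> \<inter> {0..}. if q < s then X q else x) \<le> b \<longleftrightarrow>
      (\<forall>q\<in>\<rat> \<inter> {0..}. (if q < s then X q else x) \<le> b)"
    by (rule cSUP_le_iff[OF _ Ml_bdd]) (auto intro!: exI[of _ 0])
  also have "\<dots> \<longleftrightarrow> (\<forall>q\<in>\<rat> \<inter> {0..<s}. X q \<le> b)"
    using s X_0 by (auto split: if_splits) (metis IntI Rats_0 atLeastLessThan_iff order_refl)
  also have "\<dots> \<longleftrightarrow> (\<forall>r\<in>{0..<s}. X r \<le> b)"
  proof (intro iffI ballI)
    fix r assume *: "\<forall>q\<in>\<rat> \<inter> {0..<s}. X q \<le> b" and r: "r \<in> {0..<s}"
    show "X r \<le> b"
    proof (rule field_le_epsilon)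
      fix e :: real assume "0 < e"
      then obtain \<delta> where \<delta>: "\<delta> > 0" "\<And>q. r \<le> q \<Longrightarrow> q < r + \<delta> \<Longrightarrow> \<bar>X q - X r\<bar> < e"
        using X_right[of r e] r by auto
      obtain q where q: "q \<in> \<rat>" "r < q" "q < min s (r + \<delta>)"
        using Rats_dense_in_real[of r "min s (r + \<delta>)"] r \<delta>(1) by auto
      then have "X q \<le> b" using * r by auto
      moreover have "\<bar>X q - X r\<bar> < e" using q by (intro \<delta>(2)) auto
      ultimately show "X r \<le> b + e" by linarith
    qed
  qed auto
  finally show ?thesis by (auto simp: Ml_def)
qed

text \<open>Identities between running maxima are proved by comparing their upper bounds, so that
  suprema are unfolded only in \<open>M_le_iff\<close> and \<open>Ml_le_iff\<close>.\<close>

lemma eq_by_upper_bounds: "(\<And>b::real. a \<le> b \<longleftrightarrow> a' \<le> b) \<Longrightarrow> a = a'"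
  by (meson order_antisym order_refl)

lemma M_eq: "0 < t \<Longrightarrow> M t = max (Ml t) (X t)"
proof (rule eq_by_upper_bounds)
  fix b assume "0 < t"
  moreover from this have "{0..t} = insert t {0..<t}" by auto
  ultimately show "M t \<le> b \<longleftrightarrow> max (Ml t) (X t) \<le> b" by (auto simp: M_le_iff Ml_le_iff)
qed

lemma M_0: "M 0 = max x m"
  by (rule eq_by_upper_bounds) (auto simp: M_le_iff X_0)

lemma M_ge: "0 \<le> t \<Longrightarrow> m \<le> M t" "0 \<le> r \<Longrightarrow> r \<le> t \<Longrightarrow> X r \<le> M t"
  using M_le_iff[of t "M t"] by auto

lemma M_mono: "0 \<le> s \<Longrightarrow> s \<le> t \<Longrightarrow> M s \<le> M t"
  using M_le_iff[of t "M t"] by (subst M_le_iff) auto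

lemma M_le_Ml: "0 \<le> s \<Longrightarrow> s < t \<Longrightarrow> M s \<le> Ml t"
  using Ml_le_iff[of t "Ml t"] by (subst M_le_iff) auto

lemma Ml_le_M: "0 < s \<Longrightarrow> s \<le> t \<Longrightarrow> Ml s \<le> M t"
  using M_le_iff[of t "M t"] by (subst Ml_le_iff) auto

lemma T_le: "0 \<le> t \<Longrightarrow> i < N t \<Longrightarrow> T i \<le> t"
  unfolding T_def by (rule cInf_lower) (auto intro: bdd_belowI[where m = 0])

text \<open>The strict inequality comes from right continuity: the count keeps the value N t for
  some time after t.\<close>

lemma T_gt:
  assumes "0 \<le> t" "N t \<le> i" "i < N t'" "0 \<le> t'"
  shows "t < T i"
proof -
  obtain \<delta> where \<delta>: "\<delta> > 0" "\<And>s. t \<le> s \<Longrightarrow> s < t + \<delta> \<Longrightarrow> N s = N t" using N_right[OF assms(1)] by auto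
  have "t + \<delta> \<le> T i" unfolding T_def
  proof (rule cInf_greatest)
    fix s assume s: "s \<in> {t. 0 \<le> t \<and> i < N t}"
    show "t + \<delta> \<le> s"
    proof (rule ccontr)
      assume "\<not> t + \<delta> \<le> s"
      moreover have "t \<le> s" using N_mono[of s t] s assms by (cases "t \<le> s") auto
      ultimately show False using \<delta>(2)[of s] s assms by auto
    qed
  qed (use assms in auto)
  then show ?thesis using \<delta>(1) by simp
qed

text \<open>Drawdown persists for a moment, since X is right continuous and \<alpha> * M does not
  decrease. Rational times therefore detect it, which makes the drawdown event measurable and
  \<open>active\<close> predictable.\<close>

lemma drawdown_later:
  assumes r: "0 \<le> r" "X r < \<alpha> * M r" "r < s" and \<alpha>: "0 \<le> \<alpha>"
  shows "\<exists>q\<in>\<rat>. r < q \<and> q < s \<and> X q < \<alpha> * M q"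
proof -
  obtain \<delta> where \<delta>: "\<delta> > 0" "\<And>q. r \<le> q \<Longrightarrow> q < r + \<delta> \<Longrightarrow> \<bar>X q - X r\<bar> < \<alpha> * M r - X r"
    using X_right[OF r(1), of "\<alpha> * M r - X r"] r by auto
  obtain q where q: "q \<in> \<rat>" "r < q" "q < min s (r + \<delta>)"
    using Rats_dense_in_real[of r "min s (r + \<delta>)"] r \<delta>(1) by auto
  have "X q < \<alpha> * M r" using \<delta>(2)[of q] q by auto
  also have "\<dots> \<le> \<alpha> * M q" using q r \<alpha> by (intro mult_left_mono M_mono) auto
  finally show ?thesis using q by auto
qed

lemma drawdown_rational:
  assumes "0 \<le> \<alpha>"
  shows "(\<exists>t\<ge>0. X t < \<alpha> * M t) \<longleftrightarrow> (\<exists>q\<in>\<rat>. 0 \<le> q \<and> X q < \<alpha> * M q)"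
proof
  assume "\<exists>t\<ge>0. X t < \<alpha> * M t"
  then obtain t where t: "0 \<le> t" "X t < \<alpha> * M t" by auto
  then show "\<exists>q\<in>\<rat>. 0 \<le> q \<and> X q < \<alpha> * M q"
    using drawdown_later[OF t, of "t + 1"] assms by force
qed auto

end

section \<open>Behaviour of a path between two consecutive claims\<close>

locale smooth_surplus_path = surplus_path N V d x m C + smooth_on_domain \<alpha> w wx wm
  for N V d x m C \<alpha> w wx wm +
  fixes n :: real
  assumes d_nonneg: "\<And>s. 0 \<le> s \<Longrightarrow> 0 \<le> d s"
    and N_simple: "\<And>t. 0 < t \<Longrightarrow> \<exists>s. 0 \<le> s \<and> s < t \<and> N t \<le> N s + 1"
    and m_nonneg: "0 \<le> m"
begin

text \<open>The predictable form of "not yet stopped": it uses only times strictly before s, and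
  only rational ones. A claim at s that itself causes the drawdown is still active, so its jump is
  counted.\<close>

definition active :: "real \<Rightarrow> bool" where
  "active s \<longleftrightarrow> 0 < s \<and> (\<forall>q\<in>\<rat>. 0 \<le> q \<and> q < s \<longrightarrow> \<alpha> * M q \<le> X q) \<and> Ml s < n"

text \<open>The adapted counterpart of \<open>active\<close>, with time t included. It can fail
  while \<open>active\<close> holds, namely when a claim at t causes the drawdown.\<close>

definition alive :: "real \<Rightarrow> bool" where
  "alive t \<longleftrightarrow> (\<forall>r\<in>{0..t}. \<alpha> * M r \<le> X r) \<and> M t < n"

definition jump_gain :: "nat \<Rightarrow> real" where
  "jump_gain i = (if active (T i) then w (Xl (T i) - V i) (Ml (T i)) - w (Xl (T i)) (Ml (T i)) else 0)"

definition drift_gain :: "real \<Rightarrow> real" where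
  "drift_gain s = (if active s then wx (Xl s) (Ml s) * d s else 0)"

lemma active_iff: "active s \<longleftrightarrow> 0 < s \<and> (\<forall>r. 0 \<le> r \<and> r < s \<longrightarrow> \<alpha> * M r \<le> X r) \<and> Ml s < n"
proof -
  have "\<alpha> * M r \<le> X r" if "active s" "0 \<le> r" "r < s" for r
  proof (rule ccontr)
    assume "\<not> \<alpha> * M r \<le> X r"
    then have "\<exists>q\<in>\<rat>. r < q \<and> q < s \<and> X q < \<alpha> * M q"
      using that alpha(1) by (intro drawdown_later) auto
    with that show False unfolding active_def by force
  qed
  then show ?thesis by (auto simp: active_def)
qed

lemma alive_imp_active: "alive t \<Longrightarrow> 0 < s \<Longrightarrow> s \<le> t \<Longrightarrow> active s"
  unfolding active_iff alive_def using Ml_le_M[of s t] by force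

lemma not_alive_imp_inactive: "\<not> alive t \<Longrightarrow> 0 \<le> t \<Longrightarrow> t < s \<Longrightarrow> \<not> active s"
  unfolding active_iff alive_def using M_le_Ml[of t s] by force

lemma not_alive_later: "\<not> alive s \<Longrightarrow> 0 \<le> s \<Longrightarrow> s \<le> t \<Longrightarrow> \<not> alive t"
  unfolding alive_def using M_mono[of s t] by force

lemma integral_d_mono:
  assumes "0 \<le> p" "p \<le> r" "r \<le> s"
  shows "(LINT u:{p..r}|lborel. d u) \<le> (LINT u:{p..s}|lborel. d u)"
proof -
  have "0 \<le> (LINT u:{r..s}|lborel. d u)" unfolding set_lebesgue_integral_def
    by (rule integral_nonneg_AE) (use assms d_nonneg in \<open>auto simp: indicator_def\<close>)
  then show ?thesis using set_integral_combine[OF assms(2,3) d_int_sub[OF assms(1)]] by simp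
qed

context
  fixes p s :: real
  assumes p: "0 \<le> p" "p < s" and const: "\<And>r. p \<le> r \<Longrightarrow> r < s \<Longrightarrow> N r = N p"
begin

lemma X_between: "p \<le> r \<Longrightarrow> r < s \<Longrightarrow> X r = X p + (LINT u:{p..r}|lborel. d u)"
  by (rule X_incr[OF p(1) _ const[symmetric]])

text \<open>The sampling time q k is the largest dyadic of level k strictly below r and lies within
  2^-k of r. Eventually it is in (p, r), where X follows the continuous integral. The formula thus
  also holds at r = s, where X itself may jump.\<close>

lemma Xl_between:
  assumes r: "p < r" "r \<le> s"
  shows "Xl r = X p + (LINT u:{p..r}|lborel. d u)"
proof -
  define q :: "nat \<Rightarrow> real" where "q k = (of_int \<lceil>2 ^ k * r\<rceil> - 1) / 2 ^ k" for k
  have q_less: "q k < r" for k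
  proof -
    have "of_int \<lceil>2 ^ k * r\<rceil> - 1 < 2 ^ k * r" by linarith
    then show ?thesis unfolding q_def by (subst pos_divide_less_eq) (auto simp: mult.commute[of r])
  qed
  have q_ge: "r - 1 / 2 ^ k \<le> q k" for k
  proof -
    have "2 ^ k * r \<le> of_int \<lceil>2 ^ k * r\<rceil>" by linarith
    then have "(2 ^ k * r - 1) / 2 ^ k \<le> q k" unfolding q_def by (intro divide_right_mono) auto
    moreover have "(2 ^ k * r - 1) / 2 ^ k = r - 1 / 2 ^ k" by (simp add: diff_divide_distrib)
    ultimately show ?thesis by simp
  qed
  have q_lim: "q \<longlonglongrightarrow> r"
  proof (rule tendsto_sandwich[where f = "\<lambda>k. r - 1 / 2 ^ k" and h = "\<lambda>_. r"])
    have "(\<lambda>k. r - (1/2) ^ k) \<longlonglongrightarrow> r - 0"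
      by (intro tendsto_intros LIMSEQ_power_zero) auto
    then show "(\<lambda>k. r - 1 / 2 ^ k) \<longlonglongrightarrow> r" by (simp add: power_divide)
    show "\<forall>\<^sub>F k in sequentially. r - 1 / 2 ^ k \<le> q k" using q_ge by (intro always_eventually allI)
    show "\<forall>\<^sub>F k in sequentially. q k \<le> r" using q_less by (intro always_eventually allI less_imp_le)
  qed (rule tendsto_const)
  have ev: "eventually (\<lambda>k. p < q k) sequentially" using order_tendstoD(1)[OF q_lim r(1)] .
  have cont: "continuous_on {p..r} (\<lambda>r. LINT u:{p..r}|lborel. d u)"
    by (rule continuous_on_set_integral[OF d_int_sub[OF p(1)]])
  have "(\<lambda>k. LINT u:{p..q k}|lborel. d u) \<longlonglongrightarrow> (LINT u:{p..r}|lborel. d u)"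
  proof (rule continuous_on_tendsto_compose[OF cont q_lim])
    show "r \<in> {p..r}" using r by simp
    show "\<forall>\<^sub>F k in sequentially. q k \<in> {p..r}"
      using ev
    proof eventually_elim
      case (elim k)
      then show ?case using q_less[of k] by simp
    qed
  qed
  then have "(\<lambda>k. X p + (LINT u:{p..q k}|lborel. d u)) \<longlonglongrightarrow> X p + (LINT u:{p..r}|lborel. d u)"
    by (intro tendsto_intros)
  moreover have "eventually (\<lambda>k. X p + (LINT u:{p..q k}|lborel. d u) = X (q k)) sequentially"
    using ev
  proof eventually_elim
    case (elim k)
    then show ?case using X_between[of "q k"] q_less[of k] r by simp
  qed
  ultimately have "(\<lambda>k. X (q k)) \<longlonglongrightarrow> X p + (LINT u:{p..r}|lborel. d u)"
    by (rule Lim_transform_eventually)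
  then show ?thesis unfolding Xl_def q_def by (rule limI)
qed

text \<open>On [p, r) the path is nondecreasing, so its supremum there is its left limit; the times
  up to p contribute \<open>M p\<close>.\<close>

lemma Ml_between:
  assumes r: "p < r" "r \<le> s"
  shows "Ml r = max (Xl r) (M p)"
proof (rule eq_by_upper_bounds)
  fix b
  have "(\<forall>t\<in>{p..<r}. X t \<le> b) \<longleftrightarrow> Xl r \<le> b"
  proof
    assume *: "\<forall>t\<in>{p..<r}. X t \<le> b"
    have "continuous_on {p..r} (\<lambda>r. X p + (LINT u:{p..r}|lborel. d u))"
      by (intro continuous_intros continuous_on_set_integral[OF d_int_sub[OF p(1)]])
    then have "((\<lambda>t. X p + (LINT u:{p..t}|lborel. d u)) \<longlongrightarrow> Xl r) (at_left r)"
      unfolding Xl_between[OF r] using r(1) by (rule continuous_on_Icc_at_leftD)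
    moreover have "eventually (\<lambda>t. X p + (LINT u:{p..t}|lborel. d u) \<le> b) (at_left r)"
      using eventually_at_left_real[OF r(1)]
    proof eventually_elim
      case (elim t)
      then have "X t \<le> b" using * by auto
      moreover have "X t = X p + (LINT u:{p..t}|lborel. d u)" using elim r by (intro X_between) auto
      ultimately show ?case by simp
    qed
    ultimately show "Xl r \<le> b" by (rule tendsto_upperbound) simp
  next
    assume Xl: "Xl r \<le> b"
    show "\<forall>t\<in>{p..<r}. X t \<le> b"
    proof
      fix t assume t: "t \<in> {p..<r}"
      then have "X t = X p + (LINT u:{p..t}|lborel. d u)" using r by (intro X_between) auto
      also have "\<dots> \<le> Xl r" unfolding Xl_between[OF r] using integral_d_mono[OF p(1), of t r] t by simp
      finally show "X t \<le> b" using Xl by simp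
    qed
  qed
  moreover have "(\<forall>t\<in>{0..<r}. X t \<le> b) \<longleftrightarrow> (\<forall>t\<in>{0..p}. X t \<le> b) \<and> (\<forall>t\<in>{p..<r}. X t \<le> b)"
  proof -
    have "{0..<r} = {0..p} \<union> {p..<r}" using p r by auto
    then show ?thesis by blast
  qed
  ultimately show "Ml r \<le> b \<longleftrightarrow> max (Xl r) (M p) \<le> b"
    using p r by (auto simp: Ml_le_iff M_le_iff)
qed

text \<open>Between claims X rises. Either the maximum is still M p, and X has only moved away from
  \<alpha> * M p, or the maximum is X itself, and \<alpha> * X r \<le> X r because X r is
  nonnegative and \<alpha> < 1.\<close>

lemma no_drawdown_between:
  assumes "alive p" "p \<le> r" "r < s"
  shows "\<alpha> * M r \<le> X r"
proof (cases "r = p")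
  case True then show ?thesis using assms(1) p by (auto simp: alive_def)
next
  case False
  then have r: "p < r" "r \<le> s" using assms by auto
  have Xr: "X r = Xl r" using X_between[of r] Xl_between[OF r] assms by simp
  have "X p \<le> X r" using X_between[of r] X_between[of p] integral_d_mono[of p p r] assms p r by simp
  moreover have ap: "\<alpha> * M p \<le> X p" using assms(1) p by (auto simp: alive_def)
  moreover have "0 \<le> \<alpha> * M p" using M_ge(1)[OF p(1)] m_nonneg alpha by simp
  ultimately have "\<alpha> * X r \<le> X r" "\<alpha> * M p \<le> X r"
    using alpha by (auto intro!: mult_left_le_one_le)
  moreover have "M r = max (X r) (M p)" using M_eq[of r] Ml_between[OF r] Xr p r by auto
  ultimately show ?thesis by (auto simp: max_def)
qed

lemma active_between:
  assumes "alive p" "p < r" "r \<le> s"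
  shows "active r \<longleftrightarrow> Ml r < n"
proof -
  have "\<alpha> * M t \<le> X t" if "0 \<le> t" "t < r" for t
  proof (cases "t \<le> p")
    case True then show ?thesis using assms(1) that by (auto simp: alive_def)
  next
    case False then show ?thesis using no_drawdown_between[OF assms(1), of t] that assms by auto
  qed
  then show ?thesis using p assms by (auto simp: active_iff)
qed

end

end

text \<open>The times with f at least l form a compact set; at its least element a value above l
  would force a crossing of l even earlier.\<close>

lemma first_hitting_time:
  fixes f :: "real \<Rightarrow> real"
  assumes f: "continuous_on {p..s} f" and ps: "p \<le> s" and l: "f p < l" "l \<le> f s"
  shows "\<exists>v\<in>{p..s}. f v = l \<and> (\<forall>r\<in>{p..<v}. f r < l)"
proof -
  define S where "S = {r \<in> {p..s}. l \<le> f r}"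
  have "closed S" unfolding S_def
    by (rule continuous_on_closed_Collect_le[OF continuous_on_const f]) simp
  moreover have "{p..s} \<inter> S = S" by (auto simp: S_def)
  ultimately have "compact S" using compact_Int_closed[OF compact_Icc[of p s], of S] by simp
  moreover have "s \<in> S" using l ps by (auto simp: S_def)
  ultimately obtain v where v: "v \<in> S" "\<And>t. t \<in> S \<Longrightarrow> v \<le> t"
    using compact_attains_inf[of S] by blast
  have less: "f r < l" if "r \<in> {p..<v}" for r
    using v(2)[of r] that v(1) by (force simp: S_def)
  have "f v = l"
  proof (rule ccontr)
    assume "f v \<noteq> l"
    then have "l < f v" using v(1) by (auto simp: S_def)
    moreover have "continuous_on {p..v} f" by (rule continuous_on_subset[OF f]) (use v(1) in \<open>auto simp: S_def\<close>)
    ultimately obtain t where "p \<le> t" "t \<le> v" "f t = l"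
      using IVT'[of f p l v] l v(1) by (auto simp: S_def)
    with less[of t] \<open>f v \<noteq> l\<close> show False by (cases "t = v") auto
  qed
  with less v(1) show ?thesis by (auto simp: S_def)
qed

text \<open>The formulas for \<open>Xl\<close> and \<open>Ml\<close> are available only after the
  left endpoint of an interval, so integrands are compared away from the two endpoints.\<close>

lemma set_integral_cong_open:
  fixes f g :: "real \<Rightarrow> real"
  assumes "set_integrable lborel {a..b} f" "set_integrable lborel {a..b} g"
    and eq: "\<And>x. a < x \<Longrightarrow> x < b \<Longrightarrow> f x = g x"
  shows "(LINT s:{a..b}|lborel. f s) = (LINT s:{a..b}|lborel. g s)"
proof -
  have "integral {a..b} f = integral {a..b} g"
    by (rule integral_spike[where S = "{a, b}"]) (use eq in auto)
  then show ?thesis using set_borel_integral_eq_integral(2)[OF assms(1)]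
      set_borel_integral_eq_integral(2)[OF assms(2)] by simp
qed

section \<open>The gain inequality along a whole path\<close>

context smooth_surplus_path
begin

definition value_at :: "real \<Rightarrow> real" where "value_at t = w (X t) (M t)"

definition gain :: "real \<Rightarrow> real \<Rightarrow> real" where
  "gain p q = (\<Sum>i\<in>{N p..<N q}. jump_gain i) + (LINT s:{p..q}|lborel. drift_gain s)"

text \<open>An invariant that composes over adjacent intervals. Once the path has stopped, the gain
  is frozen, so it is compared with a value z fixed at stopping: \<open>w n n\<close> if level n was
  reached, otherwise the value at some drawdown time.\<close>

definition gain_bound :: "real \<Rightarrow> real \<Rightarrow> bool" where
  "gain_bound p q \<longleftrightarrow> 0 \<le> p \<and> alive p \<longrightarrow>
     (alive q \<and> gain p q \<le> value_at q - value_at p) \<or>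
     (\<not> alive q \<and> (\<exists>z. (z = w n n \<or> (\<exists>r\<ge>0. X r < \<alpha> * M r \<and> z = value_at r)) \<and>
        gain p q \<le> z - value_at p))"

text \<open>As long as the maximum is below n, the integrand is that of the reflected path and
  \<open>reflected_path_bound\<close> applies. If n is reached, then by the path itself, since M p <
  n; the integral is cut at the first hitting time, where the state is (n, n), and the integrand
  vanishes afterwards.\<close>

lemma drift_gain_bound:
  assumes p: "0 \<le> p" "p < s" and const: "\<And>r. p \<le> r \<Longrightarrow> r < s \<Longrightarrow> N r = N p"
    and int: "set_integrable lborel {p..s} drift_gain" and al: "alive p"
  shows "(LINT r:{p..s}|lborel. drift_gain r) \<le>
    (if Ml s < n then w (Xl s) (Ml s) else w n n) - value_at p"
proof -
  note between = p const
  define Y where "Y r = X p + (LINT u:{p..r}|lborel. d u)" for r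
  have Yl: "Xl r = Y r" if "p < r" "r \<le> s" for r
    unfolding Y_def by (rule Xl_between[OF between that])
  have Ml: "Ml r = max (Y r) (M p)" if "p < r" "r \<le> s" for r
    using Ml_between[OF between that] Yl[OF that] by simp
  have act: "active r \<longleftrightarrow> max (Y r) (M p) < n" if "p < r" "r \<le> s" for r
    using active_between[OF between al that] Ml[OF that] by simp
  have m0: "0 \<le> M p" using M_ge(1)[OF p(1)] m_nonneg by simp
  have low: "\<alpha> * M p \<le> X p" using al p by (auto simp: alive_def)
  have "(LINT u:{p..p}|lborel. d u) = 0"
    using set_borel_integral_eq_integral(2)[OF d_int_sub[OF p(1), of p]] by simp
  then have Yp: "Y p = X p" by (simp add: Y_def)
  have XM: "X p \<le> M p" using M_ge(2)[OF p(1), of p] by simp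
  have vp: "w (Y p) (max (Y p) (M p)) = value_at p" using XM by (simp add: Yp value_at_def max_def)
  have contY: "continuous_on {p..s} Y" unfolding Y_def
    by (intro continuous_intros continuous_on_set_integral[OF d_int_sub[OF p(1)]])
  have monoY: "Y a \<le> Y b" if "p \<le> a" "a \<le> b" for a b
    using integral_d_mono[OF p(1) that] by (simp add: Y_def)
  have lowY: "\<alpha> * M p \<le> Y r" if "p \<le> r" for r using low monoY[of p r] Yp that by simp
  have contg: "continuous_on {p..s} (\<lambda>r. wx (Y r) (max (Y r) (M p)))"
    by (rule continuous_on_reflected[OF C11_onD(2)[OF smooth] contY m0]) (use lowY in auto)
  have gint: "set_integrable lborel {p..v} (\<lambda>r. wx (Y r) (max (Y r) (M p)) * d r)" if "v \<le> s" for v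
    by (rule set_integrable_subset[OF set_integrable_continuous_mult[OF d_int_sub[OF p(1)] contg]])
      (use that in auto)
  have dint: "set_integrable lborel {a..b} drift_gain" if "p \<le> a" "b \<le> s" for a b
    by (rule set_integrable_subset[OF int]) (use that in auto)
  have upto: "(LINT r:{p..v}|lborel. drift_gain r) \<le> w (Y v) (max (Y v) (M p)) - value_at p"
    if v: "p \<le> v" "v \<le> s" and lt: "\<And>r. p < r \<Longrightarrow> r < v \<Longrightarrow> max (Y r) (M p) < n" for v
  proof -
    have "(LINT r:{p..v}|lborel. drift_gain r) = (LINT r:{p..v}|lborel. wx (Y r) (max (Y r) (M p)) * d r)"
    proof (rule set_integral_cong_open)
      fix r assume r: "p < r" "r < v"
      then have "p < r" "r \<le> s" using v by auto
      then show "drift_gain r = wx (Y r) (max (Y r) (M p)) * d r"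
        using act[of r] lt[OF r] by (simp add: drift_gain_def Yl Ml)
    qed (use v dint gint in auto)
    also have "\<dots> \<le> w (Y v) (max (Y v) (M p)) - w (Y p) (max (Y p) (M p))"
    proof (rule reflected_path_bound[OF v(1) d_int_sub[OF p(1)] _ _ m0 low])
      show "0 \<le> d u" if "u \<in> {p..v}" for u using that p by (intro d_nonneg) auto
    qed (simp add: Y_def)
    finally show ?thesis using vp by simp
  qed
  show ?thesis
  proof (cases "Ml s < n")
    case True
    have "max (Y r) (M p) < n" if "p < r" "r < s" for r
      using True Ml[of s] monoY[of r s] that p by auto
    from upto[OF _ order_refl this] p show ?thesis using True Ml[of s] Yl[of s] by auto
  next
    case False
    have Mp: "M p < n" using al by (simp add: alive_def)
    have "n \<le> Y s" using False Ml[of s] Mp p by auto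
    moreover have "Y p < n" using Yp XM Mp by simp
    ultimately obtain v where v: "v \<in> {p..s}" "Y v = n" "\<And>r. r \<in> {p..<v} \<Longrightarrow> Y r < n"
      using first_hitting_time[OF contY, of n] p by auto
    have "(LINT r:{p..v}|lborel. drift_gain r) \<le> w n n - value_at p"
      using upto[of v] v Mp by (auto simp: max_def split: if_splits)
    moreover have "(LINT r:{v..s}|lborel. drift_gain r) = (LINT r:{v..s}|lborel. 0)"
    proof (rule set_integral_cong_open)
      fix r assume r: "v < r" "r < s"
      then have "n \<le> Y r" using monoY[of v r] v by auto
      then show "drift_gain r = 0" using act[of r] r v by (auto simp: drift_gain_def)
    qed (use v dint in \<open>auto simp: set_integrable_def\<close>)
    moreover have "(LINT r:{p..s}|lborel. drift_gain r) =
        (LINT r:{p..v}|lborel. drift_gain r) + (LINT r:{v..s}|lborel. drift_gain r)"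
      using v by (intro set_integral_combine int) auto
    ultimately show ?thesis using False by simp
  qed
qed

lemma alive_end:
  assumes p: "0 \<le> p" "p < s" and const: "\<And>r. p \<le> r \<Longrightarrow> r < s \<Longrightarrow> N r = N p"
    and al: "alive p"
  shows "alive s \<longleftrightarrow> \<alpha> * M s \<le> X s \<and> M s < n"
proof -
  have "\<alpha> * M r \<le> X r" if "0 \<le> r" "r < s" for r
  proof (cases "r \<le> p")
    case True then show ?thesis using al that by (auto simp: alive_def)
  next
    case False then show ?thesis using no_drawdown_between[OF p const al, of r] that by auto
  qed
  moreover have "{0..s} = insert s {0..<s}" using p by auto
  ultimately show ?thesis by (simp add: alive_def)
qed

lemma gain_bound_smooth:
  assumes p: "0 \<le> p" "p < s" and const: "\<And>r. p \<le> r \<Longrightarrow> r \<le> s \<Longrightarrow> N r = N p"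
    and int: "set_integrable lborel {p..s} drift_gain"
  shows "gain_bound p s"
  unfolding gain_bound_def
proof
  assume al: "0 \<le> p \<and> alive p"
  have const': "\<And>r. p \<le> r \<Longrightarrow> r < s \<Longrightarrow> N r = N p" by (rule const) simp_all
  have X: "X s = Xl s" using X_incr[OF p(1) _ const[of s, symmetric]] Xl_between[OF p const', of s] p by simp
  have XlMl: "Xl s \<le> Ml s" using Ml_between[OF p const', of s] p by simp
  have M: "M s = Ml s" using M_eq[of s] X XlMl p by simp
  have "gain p s = (LINT r:{p..s}|lborel. drift_gain r)" using const[of s] p by (simp add: gain_def)
  also have "\<dots> \<le> (if Ml s < n then w (Xl s) (Ml s) else w n n) - value_at p"
    using drift_gain_bound[OF p const' int] al by blast
  also have "w (Xl s) (Ml s) = value_at s" by (simp add: value_at_def X M)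
  finally have g: "gain p s \<le> (if M s < n then value_at s else w n n) - value_at p"
    unfolding M .
  have "\<alpha> * M s \<le> X s"
  proof -
    have pos: "0 \<le> \<alpha> * M p" using M_ge(1)[OF p(1)] m_nonneg alpha by simp
    have "\<alpha> * M p \<le> X p" using al by (auto simp: alive_def)
    also have "X p \<le> X s"
      using X_incr[OF p(1) _ const[of s, symmetric]] integral_d_mono[OF p(1), of p s] p X_incr[OF p(1), of p] by simp
    finally have "\<alpha> * M p \<le> X s" .
    moreover from this pos have "\<alpha> * X s \<le> X s" using alpha by (auto intro!: mult_left_le_one_le)
    moreover have "M s = max (X s) (M p)" using M Ml_between[OF p const', of s] X p by simp
    ultimately show ?thesis by (auto simp: max_def)
  qed
  with alive_end[OF p const'] al have "alive s \<longleftrightarrow> M s < n" by blast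
  with g show "alive s \<and> gain p s \<le> value_at s - value_at p \<or>
    \<not> alive s \<and> (\<exists>z. (z = w n n \<or> (\<exists>r\<ge>0. X r < \<alpha> * M r \<and> z = value_at r)) \<and> gain p s \<le> z - value_at p)"
    by auto
qed

text \<open>The drift part ends at the left limits (Xl s, Ml s), where the jump term begins, so the
  two telescope to the value after the claim. A claim only lowers the surplus and leaves the maximum
  at Ml s; if that is at least n, the jump is not counted and the level case remains.\<close>

lemma gain_bound_jump:
  assumes p: "0 \<le> p" "p < s" and const: "\<And>r. p \<le> r \<Longrightarrow> r < s \<Longrightarrow> N r = N p" and jump: "N s = Suc (N p)"
    and int: "set_integrable lborel {p..s} drift_gain"
  shows "gain_bound p s"
  unfolding gain_bound_def
proof
  assume al: "0 \<le> p \<and> alive p"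
  have T: "T (N p) = s"
  proof (rule antisym)
    show "T (N p) \<le> s" using T_le[of s "N p"] jump p by simp
    show "s \<le> T (N p)"
    proof (rule ccontr)
      assume *: "\<not> s \<le> T (N p)"
      define r where "r = max p (T (N p))"
      have r: "p \<le> r" "r < s" using * p by (auto simp: r_def)
      have "r < T (N p)"
        by (rule T_gt[of _ _ s]) (use const[OF r] r p jump in auto)
      then show False by (simp add: r_def)
    qed
  qed
  have "X s = x + (LINT u:{0..s}|lborel. d u) - (\<Sum>i<N p. V i) - V (N p)"
    by (simp add: X_def jump)
  also have "\<dots> = Xl s - V (N p)"
    using Xl_between[OF p const, of s] set_integral_combine[OF p(1) _ d_int, of s] p by (simp add: X_def)
  finally have X: "X s = Xl s - V (N p)" .
  have XlMl: "Xl s \<le> Ml s" using Ml_between[OF p const, of s] p by simp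
  have M: "M s = Ml s" using M_eq[of s] X XlMl V_nonneg[of "N p"] p by simp
  have act: "active s \<longleftrightarrow> M s < n" using active_between[OF p const _ p(2) order_refl] al M by simp
  have eq: "gain p s = jump_gain (N p) + (LINT r:{p..s}|lborel. drift_gain r)"
    by (simp add: gain_def jump)
  have jg: "jump_gain (N p) = (if M s < n then value_at s - w (Xl s) (Ml s) else 0)"
    unfolding jump_gain_def T act by (simp add: value_at_def X M)
  have "(LINT r:{p..s}|lborel. drift_gain r) \<le>
      (if M s < n then w (Xl s) (Ml s) else w n n) - value_at p"
    unfolding M using drift_gain_bound[OF p const int] al by blast
  then have g: "gain p s \<le> (if M s < n then value_at s else w n n) - value_at p"
    unfolding eq jg by (cases "M s < n") simp_all
  have "alive s \<longleftrightarrow> \<alpha> * M s \<le> X s \<and> M s < n" using alive_end[OF p const] al by blast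
  moreover have "0 \<le> s" using p by simp
  ultimately show "alive s \<and> gain p s \<le> value_at s - value_at p \<or>
    \<not> alive s \<and> (\<exists>z. (z = w n n \<or> (\<exists>r\<ge>0. X r < \<alpha> * M r \<and> z = value_at r)) \<and> gain p s \<le> z - value_at p)"
    using g by (metis not_le)
qed

lemma gain_add:
  assumes "0 \<le> a" "a \<le> b" "b \<le> c" "set_integrable lborel {a..c} drift_gain"
  shows "gain a c = gain a b + gain b c"
proof -
  have "{N a..<N c} = {N a..<N b} \<union> {N b..<N c}" using N_mono[of a b] N_mono[of b c] assms by auto
  then have "sum jump_gain {N a..<N c} = sum jump_gain {N a..<N b} + sum jump_gain {N b..<N c}"
    by (simp add: sum.union_disjoint)
  with set_integral_combine[OF assms(2-4)] show ?thesis by (simp add: gain_def)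
qed

text \<open>By \<open>T_gt\<close> the claims numbered from N b on occur strictly after b, when the
  path is no longer active.\<close>

lemma gain_dead:
  assumes "\<not> alive b" "0 \<le> b" "b \<le> c" "set_integrable lborel {b..c} drift_gain"
  shows "gain b c = 0"
proof -
  have "jump_gain i = 0" if "i \<in> {N b..<N c}" for i
    using not_alive_imp_inactive[OF assms(1,2) T_gt[OF assms(2), of i c]] that assms
    by (auto simp: jump_gain_def)
  moreover have "(LINT s:{b..c}|lborel. drift_gain s) = (LINT s:{b..c}|lborel. 0)"
    by (rule set_integral_cong_open[OF assms(4)])
      (use not_alive_imp_inactive[OF assms(1,2)] in \<open>auto simp: drift_gain_def set_integrable_def\<close>)
  ultimately show ?thesis by (simp add: gain_def)
qed

text \<open>If the path is stopped by time b, the gain on the second interval is 0 and the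
  comparison value z of the first interval is kept.\<close>

lemma gain_bound_trans:
  assumes ab: "gain_bound a b" and bc: "gain_bound b c" and abc: "a \<le> b" "b \<le> c"
    and int: "0 \<le> a \<Longrightarrow> set_integrable lborel {a..c} drift_gain"
  shows "gain_bound a c"
  unfolding gain_bound_def
proof
  assume al: "0 \<le> a \<and> alive a"
  then have add: "gain a c = gain a b + gain b c" using gain_add abc int by auto
  show "alive c \<and> gain a c \<le> value_at c - value_at a \<or>
    \<not> alive c \<and> (\<exists>z. (z = w n n \<or> (\<exists>r\<ge>0. X r < \<alpha> * M r \<and> z = value_at r)) \<and> gain a c \<le> z - value_at a)"
  proof (cases "alive b")
    case True
    then have g: "gain a b \<le> value_at b - value_at a" using ab al by (auto simp: gain_bound_def)
    have "0 \<le> b \<and> alive b" using True al abc by auto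
    with bc consider "alive c" "gain b c \<le> value_at c - value_at b"
      | z where "\<not> alive c" "z = w n n \<or> (\<exists>r\<ge>0. X r < \<alpha> * M r \<and> z = value_at r)" "gain b c \<le> z - value_at b"
      unfolding gain_bound_def by blast
    then show ?thesis
    proof cases
      case 1 then show ?thesis using g add by simp
    next
      case 2
      moreover from 2(3) have "gain a c \<le> z - value_at a" using g add by simp
      ultimately show ?thesis by blast
    qed
  next
    case False
    have "gain b c = 0"
    proof (rule gain_dead[OF False])
      show "set_integrable lborel {b..c} drift_gain"
        by (rule set_integrable_subset[OF int]) (use al abc in auto)
    qed (use al abc in auto)
    moreover have "\<not> alive c" using not_alive_later[OF False] al abc by auto
    ultimately show ?thesis using ab al False add unfolding gain_bound_def by auto
  qed
qed

lemma gain_bound_refl: "gain_bound p p"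
proof -
  have "(LINT s:{p..p}|lborel. drift_gain s) = 0"
    unfolding set_lebesgue_integral_def
  proof (rule integral_eq_zero_AE)
    show "AE s in lborel. indicator {p..p} s *\<^sub>R drift_gain s = 0"
      using AE_lborel_singleton[of p] by eventually_elim (auto simp: indicator_def)
  qed
  then show ?thesis by (simp add: gain_bound_def gain_def)
qed

text \<open>The counts before t are bounded by N t, so they attain a maximum, and by monotonicity
  they are constant from there up to t. Starting late enough, at the time given by
  \<open>N_simple\<close>, also limits the jump at t to one.\<close>

lemma N_left:
  assumes "0 < t"
  shows "\<exists>p. 0 \<le> p \<and> p < t \<and> (\<forall>a r. p \<le> a \<and> a \<le> r \<and> r < t \<longrightarrow> N r = N a) \<and> N t \<le> Suc (N p)"
proof -
  obtain s0 where s0: "0 \<le> s0" "s0 < t" "N t \<le> N s0 + 1" using N_simple[OF assms] by auto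
  have "\<exists>p. (0 \<le> p \<and> p < t) \<and> (\<forall>r. (0 \<le> r \<and> r < t) \<longrightarrow> N r \<le> N p)"
    by (rule Lattices_Big.ex_has_greatest_nat[of _ s0 _ "Suc (N t)"]) (use s0 N_mono[of _ t] in \<open>auto simp: less_Suc_eq_le\<close>)
  then obtain p where p: "0 \<le> p" "p < t" "\<And>r. 0 \<le> r \<Longrightarrow> r < t \<Longrightarrow> N r \<le> N p" by auto
  have "N r = N a" if "max p s0 \<le> a" "a \<le> r" "r < t" for a r
    using p(3)[of r] N_mono[of p a] N_mono[of a r] that p(1,2) s0(1) by simp
  moreover have "N t \<le> Suc (N (max p s0))" using s0 p N_mono[of s0 "max p s0"] by simp
  ultimately show ?thesis using p s0 by (intro exI[of _ "max p s0"]) auto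
qed

text \<open>Compactness replaces an induction over the claims: each t has a neighbourhood without
  claims to its right and with no claim up to and including t, except possibly one at t itself. Each
  half is then a smooth interval or one that ends in a single jump.\<close>

theorem gain_bound_all:
  assumes K: "0 \<le> K" and int: "set_integrable lborel {0..K} drift_gain"
  shows "gain_bound 0 K"
proof -
  have sub: "set_integrable lborel {a..b} drift_gain" if "0 \<le> a" "b \<le> K" for a b
    by (rule set_integrable_subset[OF int]) (use that in auto)
  have "0 \<le> (0::real) \<and> K \<le> K \<longrightarrow> gain_bound 0 K"
  proof (rule Bolzano[OF K, where P = "\<lambda>a b. 0 \<le> a \<and> b \<le> K \<longrightarrow> gain_bound a b"])
    fix a b c :: real
    assume *: "0 \<le> a \<and> b \<le> K \<longrightarrow> gain_bound a b" "0 \<le> b \<and> c \<le> K \<longrightarrow> gain_bound b c" "a \<le> b" "b \<le> c"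
    show "0 \<le> a \<and> c \<le> K \<longrightarrow> gain_bound a c"
    proof
      assume ac: "0 \<le> a \<and> c \<le> K"
      show "gain_bound a c" by (rule gain_bound_trans[OF _ _ *(3,4)]) (use * ac sub in auto)
    qed
  next
    fix t :: real assume t: "0 \<le> t" "t \<le> K"
    obtain \<delta>1 where d1: "\<delta>1 > 0" "\<And>s. t \<le> s \<Longrightarrow> s < t + \<delta>1 \<Longrightarrow> N s = N t" using N_right[OF t(1)] by auto
    have "\<exists>\<delta>2>0. \<forall>a. 0 \<le> a \<and> t - \<delta>2 < a \<and> a < t \<longrightarrow>
      (\<forall>r. a \<le> r \<and> r < t \<longrightarrow> N r = N a) \<and> N t \<le> Suc (N a)"
    proof (cases "t = 0")
      case True then show ?thesis by (intro exI[of _ 1]) auto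
    next
      case False
      then obtain p where p: "0 \<le> p" "p < t" "\<And>a r. p \<le> a \<Longrightarrow> a \<le> r \<Longrightarrow> r < t \<Longrightarrow> N r = N a" "N t \<le> Suc (N p)"
        using N_left[of t] t by auto
      have "N t \<le> Suc (N a)" if "p \<le> a" for a using N_mono[OF p(1) that] p(4) by simp
      then show ?thesis using p(2,3) by (intro exI[of _ "t - p"]) auto
    qed
    then obtain \<delta>2 where d2: "\<delta>2 > 0" and
      left: "\<And>a. 0 \<le> a \<and> t - \<delta>2 < a \<and> a < t \<Longrightarrow>
        (\<forall>r. a \<le> r \<and> r < t \<longrightarrow> N r = N a) \<and> N t \<le> Suc (N a)" by blast
    have "gain_bound a b" if ab: "a \<le> t" "t \<le> b" "b - a < min \<delta>1 \<delta>2" "0 \<le> a" "b \<le> K" for a b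
    proof (rule gain_bound_trans[of a t b])
      show "gain_bound a t"
      proof (cases "a = t")
        case True then show ?thesis by (simp add: gain_bound_refl)
      next
        case False
        then have a: "a < t" "t - \<delta>2 < a" using ab by auto
        have left_a: "(\<forall>r. a \<le> r \<and> r < t \<longrightarrow> N r = N a) \<and> N t \<le> Suc (N a)"
          by (rule left) (use ab a in auto)
        then have const: "N r = N a" if "a \<le> r" "r < t" for r using that by blast
        consider "N t = N a" | "N t = Suc (N a)"
          using conjunct2[OF left_a] N_mono[OF ab(4,1)] by linarith
        then show ?thesis
        proof cases
          case 1
          show ?thesis
          proof (rule gain_bound_smooth[OF ab(4) a(1) _ sub[OF ab(4) t(2)]])
            show "N r = N a" if "a \<le> r" "r \<le> t" for r
            proof (cases "r = t")
              case True show ?thesis unfolding True by (rule 1)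
            next
              case False then show ?thesis using that by (intro const) auto
            qed
          qed
        next
          case 2
          show ?thesis by (rule gain_bound_jump[OF ab(4) a(1) const 2 sub[OF ab(4) t(2)]])
        qed
      qed
      show "gain_bound t b"
      proof (cases "t = b")
        case True then show ?thesis by (simp add: gain_bound_refl)
      next
        case False
        then have tb: "t < b" using ab by simp
        show ?thesis
        proof (rule gain_bound_smooth[OF t(1) tb _ sub[OF t(1) ab(5)]])
          show "N r = N t" if "t \<le> r" "r \<le> b" for r by (rule d1(2)) (use that ab in auto)
        qed
      qed
    qed (use ab sub in auto)
    then show "\<exists>\<delta>>0. \<forall>a b. a \<le> t \<and> t \<le> b \<and> b - a < \<delta> \<longrightarrow> 0 \<le> a \<and> b \<le> K \<longrightarrow> gain_bound a b"
      using d1(1) d2 by (intro exI[of _ "min \<delta>1 \<delta>2"]) auto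
  qed
  then show ?thesis by simp
qed

end

section \<open>Claims\<close>

text \<open>The quadratic order is what counts: over 2^l cells of length proportional to 2^-l these
  bounds add up to order 2^-l.\<close>

lemma poisson_at_least_two:
  assumes "0 < r"
  shows "measure (measure_pmf (poisson_pmf r)) {2..} \<le> r\<^sup>2"
proof -
  have "measure (measure_pmf (poisson_pmf r)) {0, 1} = (\<Sum>k\<in>{0, 1::nat}. pmf (poisson_pmf r) k)"
    by (rule measure_measure_pmf_finite) simp
  also have "\<dots> = (1 + r) * exp (- r)" using assms by (simp add: algebra_simps)
  also have "\<dots> \<ge> (1 + r) * (1 - r)"
    using exp_ge_add_one_self[of "- r"] assms by (intro mult_left_mono) auto
  finally have "measure (measure_pmf (poisson_pmf r)) {0, 1} \<ge> 1 - r\<^sup>2"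
    by (simp add: algebra_simps power2_eq_square)
  moreover have "{2..} = UNIV - {0, 1::nat}" by auto
  then have "measure (measure_pmf (poisson_pmf r)) {2..} = 1 - measure (measure_pmf (poisson_pmf r)) {0, 1}"
    using measure_pmf.prob_compl[of "{0, 1::nat}" "poisson_pmf r"] by simp
  ultimately show ?thesis by simp
qed

lemma nn_integral_poisson:
  assumes "0 < r"
  shows "(\<integral>\<^sup>+k. ennreal (real k) \<partial>measure_pmf (poisson_pmf r)) = ennreal r"
proof -
  have "(\<lambda>k. r ^ k / fact k) sums exp r"
    using exp_converges[of r] by (simp add: divide_inverse mult.commute)
  then have "(\<lambda>k. r * exp (- r) * (r ^ k / fact k)) sums (r * exp (- r) * exp r)" by (rule sums_mult)
  also have "r * exp (- r) * exp r = r" by (simp add: exp_minus)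
  also have "(\<lambda>k. r * exp (- r) * (r ^ k / fact k)) =
      (\<lambda>k. pmf (poisson_pmf r) (Suc k) * real (Suc k))"
  proof
    fix k :: nat
    have "pmf (poisson_pmf r) (Suc k) * real (Suc k) =
        r ^ Suc k / (real (Suc k) * fact k) * exp (- r) * real (Suc k)"
      by (simp only: pmf_poisson[OF assms] fact_Suc of_nat_mult of_nat_fact)
    then show "r * exp (- r) * (r ^ k / fact k) = pmf (poisson_pmf r) (Suc k) * real (Suc k)"
      by (simp del: of_nat_Suc)
  qed
  finally have "(\<lambda>k. pmf (poisson_pmf r) k * real k) sums r" by (subst (asm) sums_Suc_iff) simp
  then have "(\<Sum>k. ennreal (pmf (poisson_pmf r) k * real k)) = ennreal r"
    by (intro suminf_ennreal_eq) auto
  moreover have "(\<integral>\<^sup>+k. ennreal (real k) \<partial>measure_pmf (poisson_pmf r)) =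
      (\<Sum>k. ennreal (pmf (poisson_pmf r) k * real k))"
    unfolding nn_integral_measure_pmf nn_integral_count_space_nat
    by (rule suminf_cong) (rule ennreal_mult[symmetric], auto)
  ultimately show ?thesis by simp
qed

locale claims = claim_process P F \<nu> lam N Y
  for P :: "'a measure" and F :: "real \<Rightarrow> 'a measure" and \<nu> lam N Y +
  assumes lam_pos: "0 < lam"
begin

section \<open>Dyadic grids and the unit jumps of the claim count\<close>

definition grid :: "real \<Rightarrow> real \<Rightarrow> nat \<Rightarrow> nat \<Rightarrow> real" where
  "grid a b l k = a + (b - a) * real k / 2 ^ l"

definition simple_on :: "real \<Rightarrow> real \<Rightarrow> nat \<Rightarrow> 'a \<Rightarrow> bool" where
  "simple_on a b l \<omega> \<longleftrightarrow> (\<forall>k<2 ^ l. N (grid a b l (Suc k)) \<omega> \<le> Suc (N (grid a b l k) \<omega>))"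

lemma N_le: "\<omega> \<in> space P \<Longrightarrow> 0 \<le> s \<Longrightarrow> s \<le> t \<Longrightarrow> N s \<omega> \<le> N t \<omega>"
  using N_mono[of \<omega>] by (auto simp: mono_on_def)

lemma N_right:
  assumes "\<omega> \<in> space P" "0 \<le> t"
  shows "\<exists>\<delta>>0. \<forall>s. t \<le> s \<and> s < t + \<delta> \<longrightarrow> N s \<omega> = N t \<omega>"
proof -
  have "((\<lambda>s. N s \<omega>) \<longlongrightarrow> N t \<omega>) (at_right t)"
    using N_right_cont[OF assms] by (simp add: continuous_within)
  then have "eventually (\<lambda>s. N s \<omega> \<in> {N t \<omega>}) (at_right t)"
    by (simp add: tendsto_discrete)
  then obtain b where "b > t" "\<And>s. t < s \<Longrightarrow> s < b \<Longrightarrow> N s \<omega> = N t \<omega>"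
    unfolding eventually_at_right_field by auto
  then show ?thesis by (intro exI[of _ "b - t"]) (auto simp: order_le_less)
qed

lemma subalgebra_F: "subalgebra P (F t)"
  using F_sub[of t] space_F[of t] by (auto simp: subalgebra_def)

lemma N_measurable_F: "0 \<le> s \<Longrightarrow> s \<le> t \<Longrightarrow> N s \<in> measurable (F t) (count_space UNIV)"
  using N_adapted[of s] sets_F_mono[of s t] by (auto simp: measurable_def space_F)

lemma N_measurable: "0 \<le> t \<Longrightarrow> N t \<in> measurable P (count_space UNIV)"
  by (rule measurable_from_subalg[OF subalgebra_F N_adapted])

lemma Y_measurable: "Y i \<in> borel_measurable P"
  using Y_indep by (auto simp: indep_vars_def)

lemma grid_0: "grid a b l 0 = a" by (simp add: grid_def)

lemma grid_end: "grid a b l (2 ^ l) = b" by (simp add: grid_def)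

lemma grid_refine: "grid a b l k = grid a b (Suc l) (2 * k)"
  by (simp add: grid_def)

lemma grid_mono: "a \<le> b \<Longrightarrow> k \<le> k' \<Longrightarrow> grid a b l k \<le> grid a b l k'"
  by (auto simp: grid_def intro!: divide_right_mono mult_left_mono)

lemma grid_ge: "a \<le> b \<Longrightarrow> a \<le> grid a b l k"
  using grid_mono[of a b 0 k l] by (simp add: grid_0)

lemma grid_le: "a \<le> b \<Longrightarrow> k \<le> 2 ^ l \<Longrightarrow> grid a b l k \<le> b"
  using grid_mono[of a b k "2 ^ l" l] by (simp add: grid_end)

lemma grid_step: "grid a b l (Suc k) - grid a b l k = (b - a) / 2 ^ l"
  by (simp add: grid_def add_divide_distrib distrib_left)

text \<open>Every finer cell lies in one coarser cell, the one with index k div 2. Hence simplicity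
  at one level settles all later levels.\<close>

lemma simple_on_Suc:
  assumes \<omega>: "\<omega> \<in> space P" and ab: "0 \<le> a" "a \<le> b" and s: "simple_on a b l \<omega>"
  shows "simple_on a b (Suc l) \<omega>"
  unfolding simple_on_def
proof (intro allI impI)
  fix k :: nat assume k: "k < 2 ^ Suc l"
  define j where "j = k div 2"
  have j: "j < 2 ^ l" "2 * j \<le> k" "Suc k \<le> 2 * Suc j" using k by (auto simp: j_def)
  have g: "0 \<le> grid a b i k" for i k using grid_ge[OF ab(2), of i k] ab by simp
  have "N (grid a b (Suc l) (Suc k)) \<omega> \<le> N (grid a b l (Suc j)) \<omega>"
    unfolding grid_refine[of a b l] by (rule N_le[OF \<omega> g]) (rule grid_mono[OF ab(2) j(3)])
  also have "\<dots> \<le> Suc (N (grid a b l j) \<omega>)" using s j by (simp add: simple_on_def)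
  also have "N (grid a b l j) \<omega> \<le> N (grid a b (Suc l) k) \<omega>"
    unfolding grid_refine[of a b l j] by (rule N_le[OF \<omega> g]) (rule grid_mono[OF ab(2) j(2)])
  finally show "N (grid a b (Suc l) (Suc k)) \<omega> \<le> Suc (N (grid a b (Suc l) k) \<omega>)" by simp
qed

lemma simple_on_mono:
  assumes "\<omega> \<in> space P" "0 \<le> a" "a \<le> b" "simple_on a b l \<omega>" "l \<le> l'"
  shows "simple_on a b l' \<omega>"
  using assms(5) by (induction rule: dec_induct) (use assms simple_on_Suc in auto)

lemma prob_jump_two:
  assumes "0 \<le> s" "s < t"
  shows "prob {\<omega> \<in> space P. N t \<omega> - N s \<omega> \<ge> 2} \<le> (lam * (t - s))\<^sup>2"
proof -
  have [measurable]: "N s \<in> measurable P (count_space UNIV)" "N t \<in> measurable P (count_space UNIV)"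
    using N_measurable assms by auto
  have "prob {\<omega> \<in> space P. N t \<omega> - N s \<omega> \<ge> 2} =
      measure (distr P (count_space UNIV) (\<lambda>\<omega>. N t \<omega> - N s \<omega>)) {2..}"
    by (subst measure_distr) (auto intro!: arg_cong[where f = prob])
  then show ?thesis
    using poisson_at_least_two[of "lam * (t - s)"] N_poisson[OF assms] lam_pos assms by simp
qed

text \<open>The probability of a cell with two claims at level l is of order 2^-l, so all levels
  fail together only on a null set. Outside it some level is simple, and with it every finer one; a
  Borel-Cantelli argument is avoided.\<close>

lemma AE_simple_on:
  assumes ab: "0 \<le> a" "a < b"
  shows "AE \<omega> in P. \<exists>l0. \<forall>l\<ge>l0. simple_on a b l \<omega>"
proof -
  define B where "B l = (\<Union>k<2 ^ l. {\<omega> \<in> space P. N (grid a b l (Suc k)) \<omega> - N (grid a b l k) \<omega> \<ge> 2})" for l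
  have g: "0 \<le> grid a b l k" for l k using grid_ge[of a b l k] ab by simp
  have [measurable]: "N (grid a b l k) \<in> measurable P (count_space UNIV)" for l k
    by (rule N_measurable[OF g])
  have sets: "{\<omega> \<in> space P. N (grid a b l (Suc k)) \<omega> - N (grid a b l k) \<omega> \<ge> 2} \<in> sets P" for l k
    by measurable
  then have [measurable]: "B l \<in> sets P" for l unfolding B_def by auto
  have Bl: "prob (B l) \<le> (lam * (b - a))\<^sup>2 * (1/2) ^ l" for l
  proof -
    have "prob (B l) \<le> (\<Sum>k<2 ^ l. prob {\<omega> \<in> space P. N (grid a b l (Suc k)) \<omega> - N (grid a b l k) \<omega> \<ge> 2})"
      unfolding B_def using sets by (intro finite_measure_subadditive_finite) auto
    also have "\<dots> \<le> (\<Sum>k::nat<2 ^ l. (lam * ((b - a) / 2 ^ l))\<^sup>2)"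
    proof (rule sum_mono)
      fix k :: nat
      have "grid a b l k < grid a b l (Suc k)"
      proof -
        have "0 < (b - a) / 2 ^ l" using ab by simp
        then show ?thesis unfolding grid_step[of a b l k, symmetric] by simp
      qed
      from prob_jump_two[OF g this]
      show "prob {\<omega> \<in> space P. N (grid a b l (Suc k)) \<omega> - N (grid a b l k) \<omega> \<ge> 2}
          \<le> (lam * ((b - a) / 2 ^ l))\<^sup>2" unfolding grid_step .
    qed
    also have "\<dots> = (lam * (b - a))\<^sup>2 * (1/2) ^ l"
      by (simp add: power2_eq_square power_divide field_simps)
    finally show ?thesis .
  qed
  have "prob (\<Inter>l. B l) \<le> 0"
  proof (rule LIMSEQ_le_const)
    have "(\<lambda>l. (lam * (b - a))\<^sup>2 * (1/2) ^ l) \<longlonglongrightarrow> (lam * (b - a))\<^sup>2 * 0"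
      by (intro tendsto_intros LIMSEQ_power_zero) auto
    then show "(\<lambda>l. (lam * (b - a))\<^sup>2 * (1/2) ^ l) \<longlonglongrightarrow> 0" by simp
    have "prob (\<Inter>l. B l) \<le> (lam * (b - a))\<^sup>2 * (1/2) ^ l" for l
    proof -
      have "(\<Inter>l. B l) \<subseteq> B l" by auto
      then have "prob (\<Inter>l. B l) \<le> prob (B l)" by (rule finite_measure_mono) simp
      with Bl[of l] show ?thesis by linarith
    qed
    then show "\<exists>k. \<forall>l\<ge>k. prob (\<Inter>l. B l) \<le> (lam * (b - a))\<^sup>2 * (1/2) ^ l" by blast
  qed
  then have "prob (\<Inter>l. B l) = 0" by (simp add: measure_le_0_iff)
  then have "emeasure P (\<Inter>l. B l) = 0" by (simp add: emeasure_eq_measure)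
  then have "(\<Inter>l. B l) \<in> null_sets P" by (intro null_setsI) auto
  then have "AE \<omega> in P. \<omega> \<notin> (\<Inter>l. B l)" by (rule AE_not_in)
  then show ?thesis
  proof (rule AE_mp, intro AE_I2 impI)
    fix \<omega> assume \<omega>: "\<omega> \<in> space P" "\<omega> \<notin> (\<Inter>l. B l)"
    then obtain l where "\<omega> \<notin> B l" by auto
    have "simple_on a b l \<omega>" unfolding simple_on_def
    proof (intro allI impI)
      fix k :: nat assume "k < 2 ^ l"
      with \<open>\<omega> \<notin> B l\<close> \<omega>(1) have "N (grid a b l (Suc k)) \<omega> - N (grid a b l k) \<omega> < 2"
        by (auto simp: B_def not_le)
      then show "N (grid a b l (Suc k)) \<omega> \<le> Suc (N (grid a b l k) \<omega>)" by linarith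
    qed
    then show "\<exists>l0. \<forall>l\<ge>l0. simple_on a b l \<omega>"
      using simple_on_mono[OF \<omega>(1) ab(1) less_imp_le[OF ab(2)]] by blast
  qed
qed

text \<open>The witness is the last point before t on a simple grid over an interval that contains
  t; N t is at most the count at the next grid point.\<close>

lemma AE_N_simple:
  "AE \<omega> in P. \<forall>t>0. \<exists>s. 0 \<le> s \<and> s < t \<and> N t \<omega> \<le> N s \<omega> + 1"
proof -
  have "AE \<omega> in P. \<forall>K::nat. \<exists>l0. \<forall>l\<ge>l0. simple_on 0 (real (Suc K)) l \<omega>"
    unfolding AE_all_countable by (intro allI AE_simple_on) auto
  then show ?thesis
  proof (rule AE_mp, intro AE_I2 impI allI)
    fix \<omega> and t :: real
    assume \<omega>: "\<omega> \<in> space P" and s: "\<forall>K::nat. \<exists>l0. \<forall>l\<ge>l0. simple_on 0 (real (Suc K)) l \<omega>" and t: "0 < t"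
    define K where "K = nat \<lceil>t\<rceil>"
    have K: "t \<le> real (Suc K)" unfolding K_def by linarith
    obtain l where l: "simple_on 0 (real (Suc K)) l \<omega>" using s by blast
    define j where "j = (LEAST j. t \<le> grid 0 (real (Suc K)) l j)"
    have ex: "t \<le> grid 0 (real (Suc K)) l (2 ^ l)" using K by (simp add: grid_end)
    have j: "t \<le> grid 0 (real (Suc K)) l j" unfolding j_def by (rule LeastI[of _ "2 ^ l"]) (rule ex)
    have j_le: "j \<le> 2 ^ l" unfolding j_def by (rule Least_le) (rule ex)
    have "j \<noteq> 0"
    proof
      assume "j = 0"
      then show False using j t grid_0[of 0 "real (Suc K)" l] by simp
    qed
    then obtain i where i: "j = Suc i" by (cases j) auto
    have less: "grid 0 (real (Suc K)) l i < t"
      using not_less_Least[of i "\<lambda>j. t \<le> grid 0 (real (Suc K)) l j"] i unfolding j_def by simp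
    have "N t \<omega> \<le> N (grid 0 (real (Suc K)) l (Suc i)) \<omega>" using j i t \<omega> by (intro N_le) auto
    also have "\<dots> \<le> Suc (N (grid 0 (real (Suc K)) l i) \<omega>)"
      using l i j_le by (auto simp: simple_on_def)
    finally show "\<exists>s. 0 \<le> s \<and> s < t \<and> N t \<omega> \<le> N s \<omega> + 1"
      using less grid_ge[of 0 "real (Suc K)" l i] by auto
  qed
qed

definition S :: "real \<Rightarrow> 'a \<Rightarrow> real" where "S = claim_total N Y"

text \<open>Reads single claims off the increments of \<open>N\<close> and \<open>S\<close>: in a
  cell with one claim, the increment of \<open>S\<close> is its size and the count at the left end
  is its number. This turns adaptedness and independence, which are assumed for \<open>N\<close> and
  \<open>S\<close>, into statements about individual claims.\<close>

definition grid_sum :: "real \<Rightarrow> real \<Rightarrow> (nat \<Rightarrow> real \<Rightarrow> real) \<Rightarrow> nat \<Rightarrow> 'a \<Rightarrow> real" where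
  "grid_sum a b \<phi> l \<omega> = (\<Sum>k<2 ^ l. if N (grid a b l (Suc k)) \<omega> = Suc (N (grid a b l k) \<omega>)
     then \<phi> (N (grid a b l k) \<omega>) (S (grid a b l (Suc k)) \<omega> - S (grid a b l k) \<omega>) else 0)"

lemma grid_sum_eq:
  assumes \<omega>: "\<omega> \<in> space P" and ab: "0 \<le> a" "a \<le> b" and s: "simple_on a b l \<omega>"
  shows "grid_sum a b \<phi> l \<omega> = (\<Sum>i\<in>{N a \<omega>..<N b \<omega>}. \<phi> i (Y i \<omega>))"
proof -
  let ?g = "grid a b l"
  have "(\<Sum>k<j. if N (?g (Suc k)) \<omega> = Suc (N (?g k) \<omega>)
      then \<phi> (N (?g k) \<omega>) (S (?g (Suc k)) \<omega> - S (?g k) \<omega>) else 0) =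
      (\<Sum>i\<in>{N a \<omega>..<N (?g j) \<omega>}. \<phi> i (Y i \<omega>))" if "j \<le> 2 ^ l" for j
    using that
  proof (induction j)
    case 0 then show ?case by (simp add: grid_0)
  next
    case (Suc j)
    have le: "N (?g j) \<omega> \<le> N (?g (Suc j)) \<omega>" "N a \<omega> \<le> N (?g j) \<omega>"
      using grid_ge[OF ab(2), of l j] grid_mono[OF ab(2), of j "Suc j" l] ab \<omega> by (auto intro!: N_le)
    have "N (?g (Suc j)) \<omega> \<le> Suc (N (?g j) \<omega>)" using s Suc.prems by (simp add: simple_on_def)
    then consider "N (?g (Suc j)) \<omega> = N (?g j) \<omega>" | "N (?g (Suc j)) \<omega> = Suc (N (?g j) \<omega>)"
      using le by linarith
    then show ?case
    proof cases
      case 1 then show ?thesis using Suc by simp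
    next
      case 2
      then have "S (?g (Suc j)) \<omega> - S (?g j) \<omega> = Y (N (?g j) \<omega>) \<omega>"
        by (simp add: S_def claim_total_def)
      then show ?thesis using Suc 2 le by simp
    qed
  qed
  from this[of "2 ^ l"] show ?thesis by (simp add: grid_sum_def grid_end)
qed

lemma grid_sum_limit:
  assumes "0 \<le> a" "a < b"
  shows "AE \<omega> in P. (\<lambda>l. grid_sum a b \<phi> l \<omega>) \<longlonglongrightarrow> (\<Sum>i\<in>{N a \<omega>..<N b \<omega>}. \<phi> i (Y i \<omega>))"
  using AE_simple_on[OF assms]
proof (rule AE_mp, intro AE_I2 impI)
  fix \<omega> assume \<omega>: "\<omega> \<in> space P" and "\<exists>l0. \<forall>l\<ge>l0. simple_on a b l \<omega>"
  then obtain l0 where "\<And>l. l \<ge> l0 \<Longrightarrow> simple_on a b l \<omega>" by auto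
  then have "eventually (\<lambda>l. grid_sum a b \<phi> l \<omega> = (\<Sum>i\<in>{N a \<omega>..<N b \<omega>}. \<phi> i (Y i \<omega>))) sequentially"
    using grid_sum_eq[OF \<omega>] assms unfolding eventually_sequentially by (metis less_imp_le)
  then show "(\<lambda>l. grid_sum a b \<phi> l \<omega>) \<longlonglongrightarrow> (\<Sum>i\<in>{N a \<omega>..<N b \<omega>}. \<phi> i (Y i \<omega>))"
    by (rule tendsto_eventually)
qed

lemma S_measurable_F: "0 \<le> s \<Longrightarrow> s \<le> t \<Longrightarrow> S s \<in> borel_measurable (F t)"
  using total_adapted[of s] sets_F_mono[of s t] by (auto simp: S_def measurable_def space_F)

lemma nn_integral_N:
  assumes "0 \<le> s" "s < t"
  shows "(\<integral>\<^sup>+\<omega>. ennreal (real (N t \<omega> - N s \<omega>)) \<partial>P) = ennreal (lam * (t - s))"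
proof -
  have [measurable]: "N s \<in> measurable P (count_space UNIV)" "N t \<in> measurable P (count_space UNIV)"
    using N_measurable assms by auto
  have "(\<integral>\<^sup>+\<omega>. ennreal (real (N t \<omega> - N s \<omega>)) \<partial>P) =
      (\<integral>\<^sup>+k. ennreal (real k) \<partial>distr P (count_space UNIV) (\<lambda>\<omega>. N t \<omega> - N s \<omega>))"
    by (subst nn_integral_distr) auto
  also have "\<dots> = ennreal (lam * (t - s))"
    unfolding N_poisson[OF assms] using lam_pos assms by (intro nn_integral_poisson) simp
  finally show ?thesis .
qed

lemma integrable_N:
  assumes "0 \<le> s" "s < t"
  shows "integrable P (\<lambda>\<omega>. real (N t \<omega> - N s \<omega>))"
    "(\<integral>\<omega>. real (N t \<omega> - N s \<omega>) \<partial>P) = lam * (t - s)"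
proof -
  have [measurable]: "N s \<in> measurable P (count_space UNIV)" "N t \<in> measurable P (count_space UNIV)"
    using N_measurable assms by auto
  have pos: "0 \<le> lam * (t - s)" using lam_pos assms by simp
  show "integrable P (\<lambda>\<omega>. real (N t \<omega> - N s \<omega>))"
    by (rule integrableI_nn_integral_finite[OF _ _ nn_integral_N[OF assms]]) (use pos in auto)
  show "(\<integral>\<omega>. real (N t \<omega> - N s \<omega>) \<partial>P) = lam * (t - s)"
    by (subst integral_eq_nn_integral) (use nn_integral_N[OF assms] pos in auto)
qed

end

section \<open>Null-set augmentation, adaptedness of single claims, independence of claim
  counts\<close>

context claims
begin

text \<open>Claim counts are limits of sums over grids only almost surely, so they are adapted only to the
  filtration augmented by the null sets.\<close>

definition aug :: "real \<Rightarrow> 'a measure" where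
  "aug t = sigma (space P) {A \<in> sets P. \<exists>B\<in>sets (F t). AE \<omega> in P. \<omega> \<in> A \<longleftrightarrow> \<omega> \<in> B}"

text \<open>The generating family is already a \<sigma>-algebra: for countably many sets, the
  representatives in F t are combined outside one common null set.\<close>

lemma sets_aug: "sets (aug t) = {A \<in> sets P. \<exists>B\<in>sets (F t). AE \<omega> in P. \<omega> \<in> A \<longleftrightarrow> \<omega> \<in> B}" (is "_ = ?M")
proof -
  have "sigma_algebra (space P) ?M"
    unfolding sigma_algebra_iff2
  proof (intro conjI ballI allI impI)
    show "?M \<subseteq> Pow (space P)" by (auto dest: sets.sets_into_space)
    show "{} \<in> ?M" by (auto intro!: bexI[of _ "{}"])
    show "space P - A \<in> ?M" if "A \<in> ?M" for A
    proof -
      from that obtain B where B: "A \<in> sets P" "B \<in> sets (F t)" "AE \<omega> in P. \<omega> \<in> A \<longleftrightarrow> \<omega> \<in> B" by auto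
      have "space P - B \<in> sets (F t)" using sets.compl_sets[OF B(2)] by (simp add: space_F)
      moreover have "AE \<omega> in P. \<omega> \<in> space P - A \<longleftrightarrow> \<omega> \<in> space P - B"
        using B(3) by eventually_elim auto
      ultimately show ?thesis using B(1) by blast
    qed
    show "(\<Union>i. A i) \<in> ?M" if A: "range A \<subseteq> ?M" for A :: "nat \<Rightarrow> _"
    proof -
      have "\<forall>i. \<exists>B\<in>sets (F t). AE \<omega> in P. \<omega> \<in> A i \<longleftrightarrow> \<omega> \<in> B" using A by auto
      then obtain B where B: "\<And>i. B i \<in> sets (F t)" "\<And>i. AE \<omega> in P. \<omega> \<in> A i \<longleftrightarrow> \<omega> \<in> B i" by metis
      have "AE \<omega> in P. \<forall>i. \<omega> \<in> A i \<longleftrightarrow> \<omega> \<in> B i" using B(2) by (simp add: AE_all_countable)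
      then have "AE \<omega> in P. \<omega> \<in> (\<Union>i. A i) \<longleftrightarrow> \<omega> \<in> (\<Union>i. B i)" by eventually_elim auto
      moreover have "(\<Union>i. B i) \<in> sets (F t)" "(\<Union>i. A i) \<in> sets P" using B(1) A by auto
      ultimately show ?thesis by blast
    qed
  qed
  then show ?thesis unfolding aug_def by (rule sigma_algebra.sets_measure_of_eq)
qed

lemma space_aug: "space (aug t) = space P"
  unfolding aug_def by (rule space_measure_of) (auto dest: sets.sets_into_space)

lemma sets_aug_mono: "s \<le> t \<Longrightarrow> sets (aug s) \<subseteq> sets (aug t)"
  unfolding sets_aug using sets_F_mono[of s t] by auto

lemma sets_F_aug: "sets (F t) \<subseteq> sets (aug t)"
  unfolding sets_aug using F_sub[of t] by (auto intro: AE_I2)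

lemma sets_aug_P: "sets (aug t) \<subseteq> sets P" by (auto simp: sets_aug)

lemma measurable_aug_P: "f \<in> measurable (aug t) M \<Longrightarrow> f \<in> measurable P M"
  using sets_aug_P[of t] by (auto simp: measurable_def space_aug)

lemma measurable_F_aug: "f \<in> measurable (F t) M \<Longrightarrow> f \<in> measurable (aug t) M"
  using sets_F_aug[of t] by (auto simp: measurable_def space_aug space_F)

lemma measurable_aug_mono: "f \<in> measurable (aug s) M \<Longrightarrow> s \<le> t \<Longrightarrow> f \<in> measurable (aug t) M"
  using sets_aug_mono[of s t] by (auto simp: measurable_def space_aug)

lemma measurable_aug_AE:
  assumes f: "f \<in> measurable (F t) M" and g: "g \<in> measurable P M" and eq: "AE \<omega> in P. f \<omega> = g \<omega>"
  shows "g \<in> measurable (aug t) M"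
proof (rule measurableI)
  fix \<omega> assume "\<omega> \<in> space (aug t)"
  then show "g \<omega> \<in> space M" using measurable_space[OF g] by (simp add: space_aug)
next
  fix B assume B: "B \<in> sets M"
  have "f -` B \<inter> space P \<in> sets (F t)" using measurable_sets[OF f B] by (simp add: space_F)
  moreover have "g -` B \<inter> space P \<in> sets P" by (rule measurable_sets[OF g B])
  moreover have "AE \<omega> in P. \<omega> \<in> g -` B \<inter> space P \<longleftrightarrow> \<omega> \<in> f -` B \<inter> space P"
    using eq by eventually_elim auto
  ultimately show "g -` B \<inter> space (aug t) \<in> sets (aug t)"
    unfolding space_aug unfolding sets_aug by blast
qed

lemma S_measurable: "0 \<le> t \<Longrightarrow> S t \<in> borel_measurable P"
  by (rule measurable_from_subalg[OF subalgebra_F S_measurable_F[OF _ order_refl]])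

text \<open>Replacing A by its representative in F s changes no probability, so the assumed
  independence extends to the augmented past.\<close>

lemma indep_aug:
  assumes st: "0 \<le> s" "s \<le> t" and A: "A \<in> sets (aug s)" and Z: "Z \<in> sets (count_space UNIV \<Otimes>\<^sub>M borel)"
  defines "E \<equiv> {\<omega> \<in> space P. (N t \<omega> - N s \<omega>, S t \<omega> - S s \<omega>) \<in> Z}"
  shows "prob (A \<inter> E) = prob A * prob E"
proof -
  let ?f = "\<lambda>\<omega>. (N t \<omega> - N s \<omega>, claim_total N Y t \<omega> - claim_total N Y s \<omega>)"
  obtain B where B: "A \<in> sets P" "B \<in> sets (F s)" "AE \<omega> in P. \<omega> \<in> A \<longleftrightarrow> \<omega> \<in> B"
    using A by (auto simp: sets_aug)
  have B': "B \<in> sets P" using B(2) F_sub by auto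
  have "N s \<in> measurable P (count_space UNIV)" "N t \<in> measurable P (count_space UNIV)"
    "S s \<in> borel_measurable P" "S t \<in> borel_measurable P"
    using st N_measurable S_measurable by auto
  then have [measurable]: "?f \<in> measurable P (count_space UNIV \<Otimes>\<^sub>M borel)"
    unfolding S_def by measurable
  have E: "E = ?f -` Z \<inter> space P" by (auto simp: E_def S_def)
  have E': "E \<in> sets (vimage_algebra (space P) ?f (count_space UNIV \<Otimes>\<^sub>M borel))"
    unfolding E by (rule in_vimage_algebra[OF Z])
  have EP: "E \<in> sets P" unfolding E using Z by measurable
  have "prob (B \<inter> E) = prob B * prob E"
    by (rule indep_setD[OF increments_indep[OF st] B(2) E'])
  moreover have "prob (A \<inter> E) = prob (B \<inter> E)"
    by (rule measure_eq_AE) (use B B' EP in \<open>auto elim!: eventually_mono\<close>)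
  moreover have "prob A = prob B" by (rule measure_eq_AE) (use B B' in auto)
  ultimately show ?thesis by simp
qed

definition claim_count :: "real \<Rightarrow> real \<Rightarrow> real set \<Rightarrow> 'a \<Rightarrow> real" where
  "claim_count a b B \<omega> = (\<Sum>i\<in>{N a \<omega>..<N b \<omega>}. indicator B (Y i \<omega>))"

text \<open>That a cell contains exactly one claim, with increment of \<open>S\<close> in B, is an
  event of the increments over that cell, hence independent of A, which belongs to the augmented
  past of every grid point. Summation over the cells and dominated convergence, with N b - N a as
  majorant, transfer this to the count.\<close>

lemma claim_count_indep:
  assumes ab: "0 \<le> a" "a < b" and A: "A \<in> sets (aug a)" and B: "B \<in> sets borel"
  shows "(\<integral>\<omega>. indicator A \<omega> * claim_count a b B \<omega> \<partial>P) = prob A * (\<integral>\<omega>. claim_count a b B \<omega> \<partial>P)"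
proof -
  let ?\<phi> = "\<lambda>(i::nat) y. indicator B y :: real"
  have g: "0 \<le> grid a b l k" for l k using grid_ge[of a b l k] ab by simp
  have [measurable]: "N (grid a b l k) \<in> measurable P (count_space UNIV)" for l k by (rule N_measurable[OF g])
  have [measurable]: "S (grid a b l k) \<in> borel_measurable P" for l k
    by (rule measurable_from_subalg[OF subalgebra_F S_measurable_F[OF g order_refl]])
  have [measurable]: "B \<in> sets borel" "A \<in> sets P" using A B sets_aug_P by auto
  have mono: "N (grid a b l k) \<omega> \<le> N (grid a b l (Suc k)) \<omega>" if "\<omega> \<in> space P" for l k \<omega>
    using grid_mono[of a b k "Suc k" l] ab that by (intro N_le g) auto
  define E where "E l k = {\<omega> \<in> space P. (N (grid a b l (Suc k)) \<omega> - N (grid a b l k) \<omega>,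
      S (grid a b l (Suc k)) \<omega> - S (grid a b l k) \<omega>) \<in> {1} \<times> B}" for l k
  have [measurable]: "E l k \<in> sets P" for l k
  proof -
    have "E l k = {\<omega> \<in> space P. N (grid a b l (Suc k)) \<omega> - N (grid a b l k) \<omega> = 1 \<and>
        S (grid a b l (Suc k)) \<omega> - S (grid a b l k) \<omega> \<in> B}" by (auto simp: E_def)
    also have "\<dots> \<in> sets P" by measurable
    finally show ?thesis .
  qed
  have gs: "grid_sum a b ?\<phi> l \<omega> = (\<Sum>k<2 ^ l. indicator (E l k) \<omega>)" if "\<omega> \<in> space P" for l \<omega>
    unfolding grid_sum_def
  proof (rule sum.cong[OF refl])
    fix k
    have "N (grid a b l (Suc k)) \<omega> = Suc (N (grid a b l k) \<omega>) \<longleftrightarrow>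
        N (grid a b l (Suc k)) \<omega> - N (grid a b l k) \<omega> = 1"
      using mono[OF that, of l k] by linarith
    then show "(if N (grid a b l (Suc k)) \<omega> = Suc (N (grid a b l k) \<omega>)
        then indicator B (S (grid a b l (Suc k)) \<omega> - S (grid a b l k) \<omega>) else 0) = (indicator (E l k) \<omega> :: real)"
      using that by (simp add: E_def indicator_def)
  qed
  have bound: "(\<Sum>k<2 ^ l. indicator (E l k) \<omega>) \<le> real (N b \<omega> - N a \<omega>)" if "\<omega> \<in> space P" for l \<omega>
  proof -
    have "(\<Sum>k<2 ^ l. indicator (E l k) \<omega>) \<le>
        (\<Sum>k<2 ^ l. real (N (grid a b l (Suc k)) \<omega>) - real (N (grid a b l k) \<omega>))"
    proof (rule sum_mono)
      fix k
      show "indicator (E l k) \<omega> \<le> real (N (grid a b l (Suc k)) \<omega>) - real (N (grid a b l k) \<omega>)"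
        using mono[OF that, of l k] by (auto simp: E_def indicator_def)
    qed
    also have "\<dots> = real (N (grid a b l (2 ^ l)) \<omega>) - real (N (grid a b l 0) \<omega>)"
      by (rule sum_lessThan_telescope)
    also have "\<dots> = real (N b \<omega> - N a \<omega>)"
      using N_le[OF that, of a b] ab by (simp add: grid_0 grid_end of_nat_diff)
    finally show ?thesis .
  qed
  have [measurable]: "N a \<in> measurable P (count_space UNIV)" "N b \<in> measurable P (count_space UNIV)"
    using N_measurable ab by auto
  have lim: "AE \<omega> in P. (\<lambda>l. \<Sum>k<2 ^ l. indicator (E l k) \<omega>) \<longlonglongrightarrow> claim_count a b B \<omega>"
    using grid_sum_limit[OF ab, of ?\<phi>] AE_space
    by eventually_elim (simp add: gs claim_count_def)
  have [measurable]: "claim_count a b B \<in> borel_measurable P"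
  proof -
    have "(\<lambda>\<omega>. \<Sum>i. if N a \<omega> \<le> i \<and> i < N b \<omega> then indicator B (Y i \<omega>) else (0::real)) \<in> borel_measurable P"
      using Y_measurable by measurable
    also have "(\<lambda>\<omega>. \<Sum>i. if N a \<omega> \<le> i \<and> i < N b \<omega> then indicator B (Y i \<omega>) else (0::real)) = claim_count a b B"
      by (intro ext, unfold claim_count_def, subst suminf_finite[of "{N a _..<N b _}"]) auto
    finally show ?thesis .
  qed
  have lim_A: "(\<lambda>l. \<integral>\<omega>. indicator A \<omega> * (\<Sum>k<2 ^ l. indicator (E l k) \<omega>) \<partial>P) \<longlonglongrightarrow>
      (\<integral>\<omega>. indicator A \<omega> * claim_count a b B \<omega> \<partial>P)" if "A \<in> sets P" for A
  proof (rule integral_dominated_convergence[where w = "\<lambda>\<omega>. real (N b \<omega> - N a \<omega>)"])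
    note that[measurable]
    show "(\<lambda>\<omega>. indicator A \<omega> * claim_count a b B \<omega>) \<in> borel_measurable P" by measurable
    show "(\<lambda>\<omega>. indicator A \<omega> * (\<Sum>k<2 ^ l. indicator (E l k) \<omega>) :: real) \<in> borel_measurable P" for l
      by (intro borel_measurable_times borel_measurable_sum borel_measurable_indicator) (use that in auto)
    show "integrable P (\<lambda>\<omega>. real (N b \<omega> - N a \<omega>))" by (rule integrable_N(1)[OF ab])
    show "AE \<omega> in P. (\<lambda>l. indicator A \<omega> * (\<Sum>k<2 ^ l. indicator (E l k) \<omega>)) \<longlonglongrightarrow>
        indicator A \<omega> * claim_count a b B \<omega>"
      using lim by eventually_elim (intro tendsto_intros)
    show "AE \<omega> in P. norm (indicator A \<omega> * (\<Sum>k<2 ^ l. indicator (E l k) \<omega>) :: real) \<le> real (N b \<omega> - N a \<omega>)" for l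
    proof (rule AE_I2)
      fix \<omega> assume "\<omega> \<in> space P"
      from bound[OF this, of l]
      show "norm (indicator A \<omega> * (\<Sum>k<2 ^ l. indicator (E l k) \<omega>) :: real) \<le> real (N b \<omega> - N a \<omega>)"
        by (auto simp: indicator_def[of A] abs_of_nonneg sum_nonneg)
    qed
  qed
  have pre: "(\<integral>\<omega>. indicator A \<omega> * (\<Sum>k<2 ^ l. indicator (E l k) \<omega>) \<partial>P) = (\<Sum>k<2 ^ l. prob (A \<inter> E l k))"
    if [measurable]: "A \<in> sets P" for A l
  proof -
    have "(\<integral>\<omega>. indicator A \<omega> * (\<Sum>k<2 ^ l. indicator (E l k) \<omega>) \<partial>P) =
        (\<integral>\<omega>. (\<Sum>k<2 ^ l. indicator (A \<inter> E l k) \<omega> :: real) \<partial>P)"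
      by (simp add: sum_distrib_left indicator_inter_arith)
    also have "\<dots> = (\<Sum>k<2 ^ l. prob (A \<inter> E l k))"
      by (subst Bochner_Integration.integral_sum) (auto simp: emeasure_eq_measure)
    finally show ?thesis .
  qed
  have "prob (A \<inter> E l k) = prob A * prob (E l k)" for l k
    unfolding E_def
  proof (rule indep_aug)
    show "A \<in> sets (aug (grid a b l k))" using A sets_aug_mono[of a "grid a b l k"] grid_ge[of a b l k] ab by auto
    show "grid a b l k \<le> grid a b l (Suc k)" using ab by (intro grid_mono) auto
  qed (use g B in auto)
  then have "(\<lambda>l. prob A * (\<Sum>k<2 ^ l. prob (E l k))) \<longlonglongrightarrow> (\<integral>\<omega>. indicator A \<omega> * claim_count a b B \<omega> \<partial>P)"
    using lim_A[of A] pre[of A] by (simp add: sum_distrib_left)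
  moreover have "(\<lambda>l. prob A * (\<Sum>k<2 ^ l. prob (E l k))) \<longlonglongrightarrow> prob A * (\<integral>\<omega>. claim_count a b B \<omega> \<partial>P)"
  proof (intro tendsto_intros)
    have "space P \<inter> E l k = E l k" for l k by (auto simp: E_def)
    then have "(\<lambda>l. \<Sum>k<2 ^ l. prob (E l k)) \<longlonglongrightarrow> (\<integral>\<omega>. indicator (space P) \<omega> * claim_count a b B \<omega> \<partial>P)"
      using lim_A[of "space P"] pre[of "space P"] by simp
    also have "(\<integral>\<omega>. indicator (space P) \<omega> * claim_count a b B \<omega> \<partial>P) = (\<integral>\<omega>. claim_count a b B \<omega> \<partial>P)"
      by (rule Bochner_Integration.integral_cong) auto
    finally show "(\<lambda>l. \<Sum>k<2 ^ l. prob (E l k)) \<longlonglongrightarrow> (\<integral>\<omega>. claim_count a b B \<omega> \<partial>P)" .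
  qed
  ultimately show ?thesis by (rule LIMSEQ_unique)
qed

lemma measurable_single_step:
  assumes n: "n \<in> measurable M (count_space UNIV)" "n' \<in> measurable M (count_space UNIV)"
    and [measurable]: "s \<in> borel_measurable M" "s' \<in> borel_measurable M"
  shows "(\<lambda>\<omega>. if n' \<omega> = Suc (n \<omega>) then if n \<omega> = i then s' \<omega> - s \<omega> else 0 else (0::real)) \<in> borel_measurable M"
proof -
  have "n -` {i} \<inter> space M \<inter> (n' -` {Suc i} \<inter> space M) \<in> sets M"
    using measurable_sets[OF n(1), of "{i}"] measurable_sets[OF n(2), of "{Suc i}"] by auto
  then have "(\<lambda>\<omega>. indicator (n -` {i} \<inter> space M \<inter> (n' -` {Suc i} \<inter> space M)) \<omega> * (s' \<omega> - s \<omega>)) \<in> borel_measurable M"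
    by measurable
  then show ?thesis
    by (rule measurable_cong[THEN iffD1, rotated]) (auto simp: indicator_def)
qed

text \<open>With \<phi> selecting claim number i, the grid sums are adapted to F and converge almost
  surely to its size; the exceptional null set is what forces \<open>aug\<close>.\<close>

lemma Y_adapted:
  assumes q: "0 \<le> q"
  shows "(\<lambda>\<omega>. if i < N q \<omega> then Y i \<omega> else 0) \<in> borel_measurable (aug q)"
proof (cases "q = 0")
  case True
  then have "(\<lambda>\<omega>. if i < N q \<omega> then Y i \<omega> else 0) \<in> borel_measurable (aug q) \<longleftrightarrow>
      (\<lambda>_. 0::real) \<in> borel_measurable (aug q)"
    by (intro measurable_cong) (auto simp: N_zero space_aug)
  then show ?thesis by simp
next
  case False
  then have q0: "0 < q" using q by simp
  let ?\<phi> = "\<lambda>j y. if j = i then y else (0::real)"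
  have g: "0 \<le> grid 0 q l k" for l k using grid_ge[of 0 q l k] q by simp
  have gs: "grid_sum 0 q ?\<phi> l \<in> borel_measurable (F q)" for l
    unfolding grid_sum_def
  proof (rule borel_measurable_sum)
    fix k :: nat assume k: "k \<in> {..<2 ^ l}"
    have le: "grid 0 q l k \<le> q" "grid 0 q l (Suc k) \<le> q" using k q by (auto intro!: grid_le)
    show "(\<lambda>\<omega>. if N (grid 0 q l (Suc k)) \<omega> = Suc (N (grid 0 q l k) \<omega>)
        then ?\<phi> (N (grid 0 q l k) \<omega>) (S (grid 0 q l (Suc k)) \<omega> - S (grid 0 q l k) \<omega>) else 0)
        \<in> borel_measurable (F q)"
      by (intro measurable_single_step N_measurable_F[OF g] S_measurable_F[OF g] le)
  qed
  have lim: "AE \<omega> in P. lim (\<lambda>l. grid_sum 0 q ?\<phi> l \<omega>) = (if i < N q \<omega> then Y i \<omega> else 0)"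
    using grid_sum_limit[OF order_refl q0, of ?\<phi>] AE_space
  proof eventually_elim
    case (elim \<omega>)
    have "(\<Sum>j\<in>{N 0 \<omega>..<N q \<omega>}. ?\<phi> j (Y j \<omega>)) = (if i < N q \<omega> then Y i \<omega> else 0)"
      using elim(2) by (simp add: N_zero)
    with elim(1) show ?case by (simp add: limI)
  qed
  show ?thesis
  proof (rule measurable_aug_AE[OF borel_measurable_lim_metric[OF gs] _ lim])
    note [measurable] = N_measurable[OF q] Y_measurable
    show "(\<lambda>\<omega>. if i < N q \<omega> then Y i \<omega> else 0) \<in> borel_measurable P" by measurable
  qed
qed

text \<open>A path without payments and drift. It serves to reuse the facts about claim times from
  the path locale, which concern \<open>N\<close> alone.\<close>

lemma surplus_path_zero: "\<omega> \<in> space P \<Longrightarrow> surplus_path (\<lambda>t. N t \<omega>) (\<lambda>_. 0) (\<lambda>_. 0) 0"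
  by unfold_locales (use N_zero N_le N_right in \<open>auto simp: set_integrable_def\<close>)

lemma T_eq_claim_time: "surplus_path.T (\<lambda>t. N t \<omega>) i = claim_time N i \<omega>" if "\<omega> \<in> space P"
  using surplus_path.T_def[OF surplus_path_zero[OF that]] by (simp add: claim_time_def)

lemma claim_time_le: "\<omega> \<in> space P \<Longrightarrow> 0 \<le> t \<Longrightarrow> i < N t \<omega> \<Longrightarrow> claim_time N i \<omega> \<le> t"
  using surplus_path.T_le[OF surplus_path_zero] by (simp add: T_eq_claim_time)

lemma claim_time_gt:
  "\<omega> \<in> space P \<Longrightarrow> 0 \<le> t \<Longrightarrow> N t \<omega> \<le> i \<Longrightarrow> i < N t' \<omega> \<Longrightarrow> 0 \<le> t' \<Longrightarrow> t < claim_time N i \<omega>"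
  using surplus_path.T_gt[OF surplus_path_zero] by (simp add: T_eq_claim_time)

lemma claim_time_le_iff:
  "\<omega> \<in> space P \<Longrightarrow> 0 \<le> t \<Longrightarrow> 0 \<le> t' \<Longrightarrow> i < N t' \<omega> \<Longrightarrow> claim_time N i \<omega> \<le> t \<longleftrightarrow> i < N t \<omega>"
  using claim_time_le[of \<omega> t i] claim_time_gt[of \<omega> t i t'] by (meson linorder_not_le)

lemma claim_time_pos: "\<omega> \<in> space P \<Longrightarrow> 0 \<le> t \<Longrightarrow> i < N t \<omega> \<Longrightarrow> 0 < claim_time N i \<omega>"
  using claim_time_gt[of \<omega> 0 i t] by (simp add: N_zero)

text \<open>Among the scenarios with i < N q, having claim time at most s is by
  \<open>claim_time_le_iff\<close> a condition on N s, which is known at q if s < q; the other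
  scenarios get the value 0.\<close>

lemma claim_time_adapted:
  assumes q: "0 \<le> q"
  shows "(\<lambda>\<omega>. if i < N q \<omega> then claim_time N i \<omega> else 0) \<in> borel_measurable (F q)"
  unfolding borel_measurable_iff_le
proof (intro allI)
  fix s
  consider "s < 0" | "0 \<le> s" "s < q" | "q \<le> s" by linarith
  then show "{\<omega> \<in> space (F q). (if i < N q \<omega> then claim_time N i \<omega> else 0) \<le> s} \<in> sets (F q)"
  proof cases
    case 1
    have "0 \<le> (if i < N q \<omega> then claim_time N i \<omega> else 0)" if "\<omega> \<in> space P" for \<omega>
      using claim_time_pos[OF that q] by (auto intro: less_imp_le)
    with 1 have "{\<omega> \<in> space (F q). (if i < N q \<omega> then claim_time N i \<omega> else 0) \<le> s} = {}"
      unfolding space_F by fastforce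
    then show ?thesis by (simp only: sets.empty_sets)
  next
    case 2
    note [measurable] = N_measurable_F[OF q order_refl] N_measurable_F[OF 2(1) less_imp_le[OF 2(2)]]
    have "{\<omega> \<in> space (F q). (if i < N q \<omega> then claim_time N i \<omega> else 0) \<le> s} =
        {\<omega> \<in> space (F q). i < N s \<omega> \<or> \<not> i < N q \<omega>}"
      using claim_time_le_iff[OF _ 2(1) q] 2 by (auto simp: space_F split: if_splits)
    also have "\<dots> \<in> sets (F q)" by measurable
    finally show ?thesis .
  next
    case 3
    then have "{\<omega> \<in> space (F q). (if i < N q \<omega> then claim_time N i \<omega> else 0) \<le> s} = space (F q)"
      using claim_time_le[OF _ q] q by (force simp: space_F split: if_splits)
    then show ?thesis by simp
  qed
qed

end

section \<open>Uniqueness of weighted moments on a compact interval\<close>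

text \<open>Approximate f / \<rho> uniformly by a polynomial g on the compact interval. The weighted
  moments make the integrals of \<rho> * g agree, and \<rho> * g differs from f by at most e times a
  bound of \<rho>.\<close>

lemma integral_eq_of_moments:
  fixes f \<rho> :: "real \<Rightarrow> real"
  assumes fin: "finite_measure \<mu>" "finite_measure \<mu>'" and sets: "sets \<mu> = sets borel" "sets \<mu>' = sets borel"
    and null: "AE s in \<mu>. s \<in> {0..K}" "AE s in \<mu>'. s \<in> {0..K}"
    and \<rho>: "continuous_on UNIV \<rho>" "\<And>s. 0 < \<rho> s"
    and moments: "\<And>j::nat. (\<integral>s. \<rho> s * s ^ j \<partial>\<mu>) = (\<integral>s. \<rho> s * s ^ j \<partial>\<mu>')"
    and f: "continuous_on UNIV f"
  shows "(\<integral>s. f s \<partial>\<mu>) = (\<integral>s. f s \<partial>\<mu>')"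
proof -
  interpret \<mu>: finite_measure \<mu> by fact
  interpret \<mu>': finite_measure \<mu>' by fact
  have bnd: "\<exists>B. \<forall>s\<in>{0..K}. norm (g s) \<le> B" if "continuous_on UNIV g" for g :: "real \<Rightarrow> real"
    using compact_imp_bounded[OF compact_continuous_image[OF continuous_on_subset[OF that subset_UNIV] compact_Icc[of 0 K]]]
    by (auto simp: bounded_iff)
  have int: "integrable \<mu> g" "integrable \<mu>' g" if g: "continuous_on UNIV g" for g :: "real \<Rightarrow> real"
  proof -
    from bnd[OF g] obtain B where B: "\<And>s. s \<in> {0..K} \<Longrightarrow> norm (g s) \<le> B" by blast
    have meas: "g \<in> borel_measurable \<mu>" "g \<in> borel_measurable \<mu>'"
      unfolding measurable_cong_sets[OF sets(1) refl] measurable_cong_sets[OF sets(2) refl]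
      by (rule borel_measurable_continuous_onI[OF g])+
    show "integrable \<mu> g"
      by (rule \<mu>.integrable_const_bound[where B = B])
        (use null(1) B meas in \<open>auto elim: eventually_mono\<close>)
    show "integrable \<mu>' g"
      by (rule \<mu>'.integrable_const_bound[where B = B])
        (use null(2) B meas in \<open>auto elim: eventually_mono\<close>)
  qed
  from bnd[OF \<rho>(1)] obtain R where R: "\<And>s. s \<in> {0..K} \<Longrightarrow> norm (\<rho> s) \<le> R" by blast
  define C where "C = \<bar>R\<bar> * (measure \<mu> (space \<mu>) + measure \<mu>' (space \<mu>'))"
  have C0: "0 \<le> C" by (simp add: C_def)
  have main: "\<bar>(\<integral>s. f s \<partial>\<mu>) - (\<integral>s. f s \<partial>\<mu>')\<bar> \<le> e * C" if e: "0 < e" for e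
  proof -
    have "continuous_on {0..K} (\<lambda>s. f s / \<rho> s)"
    proof (rule continuous_on_divide)
      show "\<forall>s\<in>{0..K}. \<rho> s \<noteq> 0" using \<rho>(2) by (metis less_irrefl)
    qed (rule continuous_on_subset[OF f subset_UNIV], rule continuous_on_subset[OF \<rho>(1) subset_UNIV])
    then obtain g where g: "real_polynomial_function g" "\<And>s. s \<in> {0..K} \<Longrightarrow> \<bar>f s / \<rho> s - g s\<bar> < e"
      using Stone_Weierstrass_real_polynomial_function[OF compact_Icc _ e] by blast
    obtain a n where a: "g = (\<lambda>s. \<Sum>i\<le>n. a i * s ^ i)" using g(1) by (auto simp: real_polynomial_function_iff_sum)
    have gc: "continuous_on UNIV (\<lambda>s. \<rho> s * g s)" unfolding a by (intro continuous_intros \<rho>)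
    have intm: "integrable \<mu> (\<lambda>s. \<rho> s * s ^ j)" "integrable \<mu>' (\<lambda>s. \<rho> s * s ^ j)" for j
      by (intro int continuous_intros \<rho>)+
    have eq: "(\<integral>s. \<rho> s * g s \<partial>\<mu>) = (\<integral>s. \<rho> s * g s \<partial>\<mu>')"
    proof -
      have "(\<lambda>s. \<rho> s * g s) = (\<lambda>s. \<Sum>i\<le>n. a i * (\<rho> s * s ^ i))"
        by (auto simp: a sum_distrib_left mult_ac)
      then show ?thesis using intm by (simp add: moments)
    qed
    have close: "\<bar>f s - \<rho> s * g s\<bar> \<le> e * \<bar>R\<bar>" if s: "s \<in> {0..K}" for s
    proof -
      have "f s - \<rho> s * g s = \<rho> s * (f s / \<rho> s - g s)" using \<rho>(2)[of s] by (simp add: right_diff_distrib)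
      then have "\<bar>f s - \<rho> s * g s\<bar> = \<rho> s * \<bar>f s / \<rho> s - g s\<bar>" using \<rho>(2)[of s] by (simp add: abs_mult)
      also have "\<dots> \<le> \<bar>R\<bar> * e" using R[OF s] g(2)[OF s] \<rho>(2)[of s] by (intro mult_mono) auto
      finally show ?thesis by (simp add: mult.commute)
    qed
    have est: "\<bar>(\<integral>s. f s \<partial>M) - (\<integral>s. \<rho> s * g s \<partial>M)\<bar> \<le> e * \<bar>R\<bar> * measure M (space M)"
      if M: "finite_measure M" "AE s in M. s \<in> {0..K}" "integrable M f" "integrable M (\<lambda>s. \<rho> s * g s)" for M
    proof -
      interpret M: finite_measure M by fact
      have "\<bar>(\<integral>s. f s - \<rho> s * g s \<partial>M)\<bar> \<le> (\<integral>s. \<bar>f s - \<rho> s * g s\<bar> \<partial>M)" by (rule integral_abs_bound)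
      also have "\<dots> \<le> (\<integral>s. e * \<bar>R\<bar> \<partial>M)"
        by (rule integral_mono_AE) (use M close in \<open>auto elim: eventually_mono\<close>)
      finally show ?thesis using M(3,4) by (simp add: mult_ac)
    qed
    have "\<bar>(\<integral>s. f s \<partial>\<mu>) - (\<integral>s. f s \<partial>\<mu>')\<bar> \<le>
        e * \<bar>R\<bar> * measure \<mu> (space \<mu>) + e * \<bar>R\<bar> * measure \<mu>' (space \<mu>')"
      using est[OF fin(1) null(1) int(1)[OF f] int(1)[OF gc]] est[OF fin(2) null(2) int(2)[OF f] int(2)[OF gc]] eq
      by linarith
    then show ?thesis by (simp add: C_def algebra_simps)
  qed
  have "\<bar>(\<integral>s. f s \<partial>\<mu>) - (\<integral>s. f s \<partial>\<mu>')\<bar> \<le> 0"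
  proof (rule field_le_epsilon)
    fix e :: real assume e: "0 < e"
    have "e / (C + 1) * C \<le> e / (C + 1) * (C + 1)" using e C0 by (intro mult_left_mono) auto
    also have "\<dots> = e" using C0 by simp
    finally show "\<bar>(\<integral>s. f s \<partial>\<mu>) - (\<integral>s. f s \<partial>\<mu>')\<bar> \<le> 0 + e"
      using main[of "e / (C + 1)"] e C0 by simp
  qed
  then show ?thesis by simp
qed

lemma measure_eqI_moments:
  fixes \<rho> :: "real \<Rightarrow> real"
  assumes fin: "finite_measure \<mu>" "finite_measure \<mu>'" and sets: "sets \<mu> = sets borel" "sets \<mu>' = sets borel"
    and null: "AE s in \<mu>. s \<in> {0..K}" "AE s in \<mu>'. s \<in> {0..K}"
    and \<rho>: "continuous_on UNIV \<rho>" "\<And>s. 0 < \<rho> s"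
    and moments: "\<And>j::nat. (\<integral>s. \<rho> s * s ^ j \<partial>\<mu>) = (\<integral>s. \<rho> s * s ^ j \<partial>\<mu>')"
  shows "\<mu> = \<mu>'"
proof (rule cdf_unique')
  show "finite_borel_measure \<mu>" "finite_borel_measure \<mu>'"
    using fin sets by (auto simp: finite_borel_measure_def finite_borel_measure_axioms_def)
  show "cdf \<mu> = cdf \<mu>'"
  proof
    fix t :: real
    \<comment> \<open>Continuous ramps that equal 1 up to t and fall to 0 with slope -k; they
      converge to the indicator of {..t}, so their integrals converge to the distribution
      function.\<close>
    define f where "f k s = max 0 (min 1 (1 - real k * (s - t)))" for k s
    have fc: "continuous_on UNIV (f k)" for k unfolding f_def by (intro continuous_intros)
    have fl: "(\<lambda>k. f k s) \<longlonglongrightarrow> indicator {..t} s" for s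
    proof (cases "s \<le> t")
      case True
      then have "f k s = 1" for k
        using mult_nonneg_nonpos[of "real k" "s - t"] by (simp add: f_def)
      then show ?thesis using True by simp
    next
      case False
      obtain k0 where k0: "1 / (s - t) < real k0" using reals_Archimedean2 by blast
      have "f k s = 0" if "k0 \<le> k" for k
      proof -
        have "1 / (s - t) < real k" using k0 that by simp
        then have "1 < real k * (s - t)" using False by (simp add: divide_less_eq)
        then show ?thesis by (simp add: f_def)
      qed
      then have "eventually (\<lambda>k. f k s = indicator {..t} s) sequentially"
        using False by (auto simp: eventually_sequentially)
      then show ?thesis by (rule tendsto_eventually)
    qed
    have lim: "(\<lambda>k. \<integral>s. f k s \<partial>M) \<longlonglongrightarrow> cdf M t"
      if M: "finite_measure M" "sets M = sets borel" for M
    proof -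
      interpret M: finite_measure M by fact
      have "(\<lambda>k. \<integral>s. f k s \<partial>M) \<longlonglongrightarrow> (\<integral>s. indicator {..t} s \<partial>M)"
      proof (rule integral_dominated_convergence[where w = "\<lambda>_. 1"])
        show "f k \<in> borel_measurable M" for k
          unfolding measurable_cong_sets[OF M(2) refl] by (rule borel_measurable_continuous_onI[OF fc])
        show "(indicator {..t} :: real \<Rightarrow> real) \<in> borel_measurable M" by (intro borel_measurable_indicator) (simp add: M(2))
        show "AE s in M. norm (f k s) \<le> 1" for k by (rule AE_I2) (simp add: f_def)
      qed (use fl in auto)
      also have "(\<integral>s. indicator {..t} s \<partial>M) = cdf M t" by (simp add: cdf_def M(2) sets_eq_imp_space_eq[OF M(2)])
      finally show ?thesis .
    qed
    have "(\<integral>s. f k s \<partial>\<mu>) = (\<integral>s. f k s \<partial>\<mu>')" for k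
      by (rule integral_eq_of_moments[OF fin sets null \<rho> moments fc])
    then show "cdf \<mu> t = cdf \<mu>' t"
      using lim[OF fin(1) sets(1)] lim[OF fin(2) sets(2)] by (auto intro: LIMSEQ_unique)
  qed
qed

section \<open>The compensation formula\<close>

lemma measurable_nat_pair:
  assumes "\<And>i::nat. f i \<in> measurable M L"
  shows "(\<lambda>(i, \<omega>). f i \<omega>) \<in> measurable (count_space UNIV \<Otimes>\<^sub>M M) L"
  by (rule measurable_pair_measure_countable1) (use assms in auto)

context claims
begin

text \<open>Built over the augmented filtration because the surplus involves single claim sizes,
  which are adapted only there. A strategy that is predictable for F is predictable in this sense
  too.\<close>

definition pred :: "(real \<times> 'a) measure" where "pred = predictable_algebra P aug"

definition pred_gen :: "(real \<times> 'a) set set" where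
  "pred_gen = {{0} \<times> A | A. A \<in> sets (aug 0)} \<union>
     {{s<..t} \<times> A | s t A. 0 \<le> s \<and> s < t \<and> A \<in> sets (aug s)}"

lemma pred_gen_sub: "pred_gen \<subseteq> Pow ({0..} \<times> space P)"
  using sets.sets_into_space[of _ "aug _"] by (fastforce simp: pred_gen_def space_aug)

lemma space_pred: "space pred = {0..} \<times> space P"
  using pred_gen_sub by (simp add: pred_def predictable_algebra_def pred_gen_def space_measure_of_conv)

lemma sets_pred: "sets pred = sigma_sets ({0..} \<times> space P) pred_gen"
  unfolding pred_def predictable_algebra_def pred_gen_def[symmetric]
  by (rule sets_measure_of[OF pred_gen_sub])

lemma pred_genI1: "A \<in> sets (aug 0) \<Longrightarrow> {0} \<times> A \<in> pred_gen"
  by (auto simp: pred_gen_def)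

lemma pred_genI2: "0 \<le> s \<Longrightarrow> s < t \<Longrightarrow> A \<in> sets (aug s) \<Longrightarrow> {s<..t} \<times> A \<in> pred_gen"
  unfolding pred_gen_def by blast

lemma in_sets_pred: "Z \<in> pred_gen \<Longrightarrow> Z \<in> sets pred"
  unfolding sets_pred by (rule sigma_sets.Basic)

lemma pred_gen_cases:
  assumes "Z \<in> pred_gen"
  obtains A where "Z = {0} \<times> A" "A \<in> sets (aug 0)"
    | s t A where "Z = {s<..t} \<times> A" "0 \<le> s" "s < t" "A \<in> sets (aug s)"
  using assms unfolding pred_gen_def by blast

lemma Int_stable_pred_gen: "Int_stable pred_gen"
proof (rule Int_stableI)
  have empty: "{} \<in> pred_gen" using pred_genI1[of "{}"] by simp
  fix Z W assume Z: "Z \<in> pred_gen" and W: "W \<in> pred_gen"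
  from Z show "Z \<inter> W \<in> pred_gen"
  proof (cases rule: pred_gen_cases)
    case (1 A)
    from W show ?thesis
    proof (cases rule: pred_gen_cases)
      case (1 B)
      have "Z \<inter> W = {0} \<times> (A \<inter> B)" unfolding \<open>Z = _\<close> \<open>W = _\<close> by auto
      then show ?thesis using 1 \<open>A \<in> _\<close> pred_genI1[of "A \<inter> B"] by simp
    next
      case (2 s t B)
      have "Z \<inter> W = {}" unfolding \<open>Z = _\<close> \<open>W = _\<close> using 2 by auto
      then show ?thesis using empty by simp
    qed
  next
    case (2 s t A)
    from W show ?thesis
    proof (cases rule: pred_gen_cases)
      case (1 B)
      have "Z \<inter> W = {}" unfolding \<open>Z = _\<close> \<open>W = _\<close> using 2 by auto
      then show ?thesis using empty by simp
    next
      case (2 s' t' B)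
      have eq: "Z \<inter> W = {max s s'<..min t t'} \<times> (A \<inter> B)" unfolding \<open>Z = _\<close> \<open>W = _\<close> by auto
      show ?thesis
      proof (cases "max s s' < min t t'")
        case True
        have "A \<in> sets (aug (max s s'))" "B \<in> sets (aug (max s s'))"
          using \<open>A \<in> _\<close> \<open>B \<in> _\<close> sets_aug_mono[of s "max s s'"] sets_aug_mono[of s' "max s s'"] by auto
        then show ?thesis unfolding eq using True \<open>0 \<le> s\<close> by (intro pred_genI2) auto
      next
        case False
        then have "Z \<inter> W = {}" unfolding eq by auto
        then show ?thesis using empty by simp
      qed
    qed
  qed
qed

lemma measurable_predI:
  assumes "\<And>x. x \<in> space M \<Longrightarrow> f x \<in> {0..} \<times> space P"
    and "\<And>A. A \<in> sets (aug 0) \<Longrightarrow> f -` ({0} \<times> A) \<inter> space M \<in> sets M"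
    and "\<And>s t A. 0 \<le> s \<Longrightarrow> s < t \<Longrightarrow> A \<in> sets (aug s) \<Longrightarrow> f -` ({s<..t} \<times> A) \<inter> space M \<in> sets M"
  shows "f \<in> measurable M pred"
  unfolding pred_def predictable_algebra_def pred_gen_def[symmetric]
proof (rule measurable_measure_of[OF pred_gen_sub])
  show "f \<in> space M \<rightarrow> {0..} \<times> space P" using assms(1) by auto
  show "f -` Z \<inter> space M \<in> sets M" if "Z \<in> pred_gen" for Z
    using that by (cases rule: pred_gen_cases) (use assms in auto)
qed

text \<open>The generating rectangles are closed under intersection but do not include the whole
  space, which is therefore exhausted by time 0 and the intervals up to k + 1.\<close>

lemma measure_eqI_pred:
  assumes sets: "sets M1 = sets pred" "sets M2 = sets pred" and fin: "finite_measure M1"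
    and eq: "\<And>Z. Z \<in> pred_gen \<Longrightarrow> emeasure M1 Z = emeasure M2 Z"
  shows "M1 = M2"
proof (rule measure_eqI_generator_eq[OF Int_stable_pred_gen pred_gen_sub eq])
  interpret finite_measure M1 by fact
  define A where "A n = (case n of 0 \<Rightarrow> {0} \<times> space P | Suc k \<Rightarrow> {0<..real (Suc k)} \<times> space P)" for n :: nat
  have top: "space P \<in> sets (aug 0)" using sets.top[of "aug 0"] by (simp add: space_aug)
  show "range A \<subseteq> pred_gen" by (auto simp: A_def pred_genI1 pred_genI2 top split: nat.splits)
  show "(\<Union>n. A n) = {0..} \<times> space P"
  proof (intro equalityI subsetI)
    fix z :: "real \<times> 'a" assume z: "z \<in> {0..} \<times> space P"
    obtain t :: real and \<omega> where t: "z = (t, \<omega>)" "0 \<le> t" "\<omega> \<in> space P" using z by auto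
    obtain k where "t \<le> real k" using real_arch_simple by blast
    then have "t \<le> real (Suc k)" by simp
    then have "z \<in> A 0 \<or> z \<in> A (Suc k)" using t by (auto simp: A_def)
    then show "z \<in> (\<Union>n. A n)" by blast
  next
    fix z :: "real \<times> 'a" assume "z \<in> (\<Union>n. A n)"
    then obtain n where "z \<in> A n" by auto
    then show "z \<in> {0..} \<times> space P" by (cases n) (auto simp: A_def)
  qed
  show "emeasure M1 (A n) \<noteq> \<infinity>" for n by (simp add: emeasure_eq_measure)
qed (use sets sets_pred in auto)

text \<open>On the event \<open>N q \<omega> \<le> i\<close> the claim time may be the junk value \<open>Inf {}\<close>, hence the cutoff.\<close>

definition tau :: "real \<Rightarrow> nat \<Rightarrow> 'a \<Rightarrow> real" where
  "tau q i \<omega> = (if i < N q \<omega> then claim_time N i \<omega> else 0)"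

lemma tau_bounds: "\<omega> \<in> space P \<Longrightarrow> 0 \<le> q \<Longrightarrow> 0 \<le> tau q i \<omega>" "\<omega> \<in> space P \<Longrightarrow> 0 \<le> q \<Longrightarrow> tau q i \<omega> \<le> q"
  using claim_time_pos[of \<omega> q i] claim_time_le[of \<omega> q i] by (auto simp: tau_def)

lemma tau_measurable: "0 \<le> q \<Longrightarrow> tau q i \<in> borel_measurable (aug q)"
  unfolding tau_def[abs_def] by (rule measurable_F_aug[OF claim_time_adapted])

text \<open>A rectangle starting at some s \<le> q has its scenario set in the past of q, and one
  starting after q is never met because \<open>tau\<close> is at most q. So a predictable process
  evaluated at a claim time before q is known at q.\<close>

lemma tau_pair_adapted:
  assumes q: "0 \<le> q"
  shows "(\<lambda>\<omega>. (tau q i \<omega>, \<omega>)) \<in> measurable (aug q) pred"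
proof (rule measurable_predI)
  note [measurable] = tau_measurable[OF q, of i]
  show "(tau q i \<omega>, \<omega>) \<in> {0..} \<times> space P" if "\<omega> \<in> space (aug q)" for \<omega>
    using that tau_bounds q by (auto simp: space_aug)
  show "(\<lambda>\<omega>. (tau q i \<omega>, \<omega>)) -` ({0} \<times> A) \<inter> space (aug q) \<in> sets (aug q)" if A: "A \<in> sets (aug 0)" for A
  proof -
    have [measurable]: "A \<in> sets (aug q)" using A sets_aug_mono[OF q] by auto
    have "(\<lambda>\<omega>. (tau q i \<omega>, \<omega>)) -` ({0} \<times> A) \<inter> space (aug q) = {\<omega> \<in> space (aug q). tau q i \<omega> = 0} \<inter> A"
      using sets.sets_into_space[OF A] by (auto simp: space_aug)
    also have "\<dots> \<in> sets (aug q)" by measurable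
    finally show ?thesis .
  qed
  show "(\<lambda>\<omega>. (tau q i \<omega>, \<omega>)) -` ({s<..t} \<times> A) \<inter> space (aug q) \<in> sets (aug q)"
    if A: "0 \<le> s" "s < t" "A \<in> sets (aug s)" for s t A
  proof (cases "s \<le> q")
    case True
    then have [measurable]: "A \<in> sets (aug q)" using A sets_aug_mono[OF True] by auto
    have "(\<lambda>\<omega>. (tau q i \<omega>, \<omega>)) -` ({s<..t} \<times> A) \<inter> space (aug q) =
        {\<omega> \<in> space (aug q). s < tau q i \<omega> \<and> tau q i \<omega> \<le> t} \<inter> A"
      using sets.sets_into_space[OF A(3)] by (auto simp: space_aug)
    also have "\<dots> \<in> sets (aug q)" by measurable
    finally show ?thesis .
  next
    case False
    then have "(\<lambda>\<omega>. (tau q i \<omega>, \<omega>)) -` ({s<..t} \<times> A) \<inter> space (aug q) = {}"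
      using tau_bounds(2)[OF _ q, of _ i] by (fastforce simp: space_aug)
    then show ?thesis by (simp only: sets.empty_sets)
  qed
qed

section \<open>Measures generated by the claims up to an integer horizon\<close>

context
  fixes K :: nat
  assumes K: "0 < K"
begin

text \<open>Claim numbers paired with scenarios. Integration against this measure is the expectation
  of a sum over the claims up to K, so such sums can be handled as images and densities of one
  finite measure.\<close>

definition core :: "(nat \<times> 'a) measure" where
  "core = density (count_space UNIV \<Otimes>\<^sub>M P) (\<lambda>(i, \<omega>). if i < N (real K) \<omega> then 1 else 0)"

lemma core_density_measurable:
  "(\<lambda>(i, \<omega>). if i < N (real K) \<omega> then 1 else 0::ennreal) \<in> borel_measurable (count_space UNIV \<Otimes>\<^sub>M P)"
proof (rule measurable_nat_pair)
  note [measurable] = N_measurable[of "real K", simplified]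
  show "(\<lambda>\<omega>. if i < N (real K) \<omega> then 1 else 0::ennreal) \<in> borel_measurable P" for i by measurable
qed

lemma measurable_core: "measurable core L = measurable (count_space UNIV \<Otimes>\<^sub>M P) L"
  unfolding core_def by (rule measurable_cong_sets) simp_all

lemma measurable_coreI: "(\<And>i. f i \<in> measurable P L) \<Longrightarrow> (\<lambda>(i, \<omega>). f i \<omega>) \<in> measurable core L"
  unfolding measurable_core by (rule measurable_nat_pair)

lemma nn_integral_core:
  assumes f: "\<And>i. f i \<in> borel_measurable P"
  shows "(\<integral>\<^sup>+(i, \<omega>). f i \<omega> \<partial>core) = (\<integral>\<^sup>+\<omega>. (\<Sum>i<N (real K) \<omega>. f i \<omega>) \<partial>P)"
proof -
  let ?u = "\<lambda>i \<omega>. (if i < N (real K) \<omega> then 1 else 0::ennreal)"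
  note [measurable] = N_measurable[of "real K", simplified] f
  have "(\<integral>\<^sup>+(i, \<omega>). f i \<omega> \<partial>core) = (\<integral>\<^sup>+x. (case x of (i, \<omega>) \<Rightarrow> ?u i \<omega>) * (case x of (i, \<omega>) \<Rightarrow> f i \<omega>) \<partial>(count_space UNIV \<Otimes>\<^sub>M P))"
    unfolding core_def by (rule nn_integral_density[OF core_density_measurable measurable_nat_pair[OF f]])
  also have "\<dots> = (\<integral>\<^sup>+x. (case x of (i, \<omega>) \<Rightarrow> ?u i \<omega> * f i \<omega>) \<partial>(count_space UNIV \<Otimes>\<^sub>M P))"
    by (rule nn_integral_cong) auto
  also have "\<dots> = (\<integral>\<^sup>+i. \<integral>\<^sup>+\<omega>. ?u i \<omega> * f i \<omega> \<partial>P \<partial>count_space UNIV)"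
  proof (subst nn_integral_fst[symmetric])
    show "(\<lambda>(i, \<omega>). ?u i \<omega> * f i \<omega>) \<in> borel_measurable (count_space UNIV \<Otimes>\<^sub>M P)"
      by (rule measurable_nat_pair) measurable
  qed simp
  also have "\<dots> = (\<Sum>i. \<integral>\<^sup>+\<omega>. ?u i \<omega> * f i \<omega> \<partial>P)" by (rule nn_integral_count_space_nat)
  also have "\<dots> = (\<integral>\<^sup>+\<omega>. (\<Sum>i. ?u i \<omega> * f i \<omega>) \<partial>P)" by (rule nn_integral_suminf[symmetric]) measurable
  also have "\<dots> = (\<integral>\<^sup>+\<omega>. (\<Sum>i<N (real K) \<omega>. f i \<omega>) \<partial>P)"
  proof (rule nn_integral_cong)
    fix \<omega>
    have "(\<Sum>i. ?u i \<omega> * f i \<omega>) = (\<Sum>i<N (real K) \<omega>. ?u i \<omega> * f i \<omega>)"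
      by (rule suminf_finite) auto
    then show "(\<Sum>i. ?u i \<omega> * f i \<omega>) = (\<Sum>i<N (real K) \<omega>. f i \<omega>)" by simp
  qed
  finally show ?thesis .
qed

lemma finite_core: "finite_measure core"
proof
  have "emeasure core (space core) = (\<integral>\<^sup>+\<omega>. (\<Sum>i<N (real K) \<omega>. 1) \<partial>P)"
    using nn_integral_core[of "\<lambda>_ _. 1"] by (simp add: case_prod_unfold)
  also have "\<dots> = (\<integral>\<^sup>+\<omega>. ennreal (real (N (real K) \<omega> - N 0 \<omega>)) \<partial>P)"
    by (intro nn_integral_cong) (simp add: N_zero ennreal_of_nat_eq_real_of_nat)
  also have "\<dots> \<noteq> \<infinity>" using nn_integral_N[of 0 "real K"] K by simp
  finally show "emeasure core (space core) \<noteq> \<infinity>" .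
qed

lemma core_tau_measurable: "(\<lambda>(i, \<omega>). tau K i \<omega>) \<in> borel_measurable core"
  by (rule measurable_coreI) (rule measurable_aug_P[OF tau_measurable], simp)

lemma core_pair_measurable: "(\<lambda>(i, \<omega>). (tau K i \<omega>, \<omega>)) \<in> measurable core pred"
  by (rule measurable_coreI) (rule measurable_aug_P[OF tau_pair_adapted], simp)

lemma core_Y_measurable: "(\<lambda>(i, \<omega>). Y i \<omega>) \<in> borel_measurable core"
  by (rule measurable_coreI) (rule Y_measurable)

definition marked :: "real set \<Rightarrow> (nat \<times> 'a) measure" where
  "marked B = density core (\<lambda>(i, \<omega>). indicator B (Y i \<omega>))"

lemma marked_density_measurable:
  "B \<in> sets borel \<Longrightarrow> (\<lambda>(i, \<omega>). indicator B (Y i \<omega>) :: ennreal) \<in> borel_measurable core"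
  by (rule measurable_coreI) (rule measurable_compose[OF Y_measurable borel_measurable_indicator])

lemma measurable_marked: "measurable (marked B) L = measurable core L"
  unfolding marked_def by (rule measurable_cong_sets) simp_all

lemma emeasure_distr_marked:
  assumes B: "B \<in> sets borel" and f: "\<And>i. f i \<in> measurable P L" and Z: "Z \<in> sets L"
  shows "emeasure (distr (marked B) L (\<lambda>(i, \<omega>). f i \<omega>)) Z =
    (\<integral>\<^sup>+\<omega>. (\<Sum>i<N (real K) \<omega>. indicator Z (f i \<omega>) * indicator B (Y i \<omega>)) \<partial>P)"
proof -
  note [measurable] = B Z f Y_measurable
  have "emeasure (distr (marked B) L (\<lambda>(i, \<omega>). f i \<omega>)) Z = (\<integral>\<^sup>+z. indicator Z z \<partial>distr (marked B) L (\<lambda>(i, \<omega>). f i \<omega>))"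
    using Z by simp
  also have "\<dots> = (\<integral>\<^sup>+x. indicator Z (case x of (i, \<omega>) \<Rightarrow> f i \<omega>) \<partial>marked B)"
    using measurable_coreI[OF f] Z by (intro nn_integral_distr) (auto simp: measurable_marked)
  also have "\<dots> = (\<integral>\<^sup>+x. (case x of (i, \<omega>) \<Rightarrow> indicator B (Y i \<omega>)) * indicator Z (case x of (i, \<omega>) \<Rightarrow> f i \<omega>) \<partial>core)"
    unfolding marked_def
    by (rule nn_integral_density[OF marked_density_measurable[OF B]])
      (rule measurable_compose[OF measurable_coreI[OF f]], use Z in simp)
  also have "\<dots> = (\<integral>\<^sup>+(i, \<omega>). indicator B (Y i \<omega>) * indicator Z (f i \<omega>) \<partial>core)"
    by (rule nn_integral_cong) auto
  also have "\<dots> = (\<integral>\<^sup>+\<omega>. (\<Sum>i<N (real K) \<omega>. indicator B (Y i \<omega>) * indicator Z (f i \<omega>)) \<partial>P)"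
    by (rule nn_integral_core) measurable
  finally show ?thesis by (simp add: mult.commute)
qed

lemma finite_marked: "B \<in> sets borel \<Longrightarrow> finite_measure (marked B)"
proof
  assume B: "B \<in> sets borel"
  interpret finite_measure core by (rule finite_core)
  have "emeasure (marked B) (space (marked B)) = (\<integral>\<^sup>+x. (case x of (i, \<omega>) \<Rightarrow> indicator B (Y i \<omega>)) * indicator (space core) x \<partial>core)"
    unfolding marked_def by (simp add: emeasure_density[OF marked_density_measurable[OF B]])
  also have "\<dots> \<le> (\<integral>\<^sup>+x. 1 \<partial>core)"
    by (rule nn_integral_mono) (auto simp: indicator_def)
  also have "\<dots> < \<infinity>" by (simp add: emeasure_eq_measure)
  finally show "emeasure (marked B) (space (marked B)) \<noteq> \<infinity>" by simp
qed

text \<open>The intensity measure in time of the claims with size in B: its mass on an interval is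
  their expected number there.\<close>

definition law :: "real set \<Rightarrow> real measure" where
  "law B = distr (marked B) borel (\<lambda>(i, \<omega>). tau K i \<omega>)"

text \<open>The Doleans measure, on the predictable \<sigma>-algebra, of the process counting the
  claims with size in B.\<close>

definition pred_law :: "real set \<Rightarrow> (real \<times> 'a) measure" where
  "pred_law B = distr (marked B) pred (\<lambda>(i, \<omega>). (tau K i \<omega>, \<omega>))"

lemma emeasure_law: "B \<in> sets borel \<Longrightarrow> Z \<in> sets borel \<Longrightarrow>
    emeasure (law B) Z = (\<integral>\<^sup>+\<omega>. (\<Sum>i<N (real K) \<omega>. indicator Z (tau K i \<omega>) * indicator B (Y i \<omega>)) \<partial>P)"
  unfolding law_def by (rule emeasure_distr_marked) (auto intro: measurable_aug_P[OF tau_measurable])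

lemma emeasure_pred_law: "B \<in> sets borel \<Longrightarrow> Z \<in> sets pred \<Longrightarrow>
    emeasure (pred_law B) Z = (\<integral>\<^sup>+\<omega>. (\<Sum>i<N (real K) \<omega>. indicator Z (tau K i \<omega>, \<omega>) * indicator B (Y i \<omega>)) \<partial>P)"
  unfolding pred_law_def by (rule emeasure_distr_marked) (auto intro: measurable_aug_P[OF tau_pair_adapted])

lemma finite_law: "B \<in> sets borel \<Longrightarrow> finite_measure (law B)"
  unfolding law_def by (rule finite_measure.finite_measure_distr[OF finite_marked])
    (auto simp: measurable_marked core_tau_measurable)

lemma finite_pred_law: "B \<in> sets borel \<Longrightarrow> finite_measure (pred_law B)"
  unfolding pred_law_def by (rule finite_measure.finite_measure_distr[OF finite_marked])
    (auto simp: measurable_marked core_pair_measurable)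

lemma sets_law: "sets (law B) = sets borel" by (simp add: law_def)

lemma AE_law: "B \<in> sets borel \<Longrightarrow> AE s in law B. s \<in> {0<..real K}"
proof (rule AE_I)
  assume B: "B \<in> sets borel"
  have "emeasure (law B) (- {0<..real K}) =
      (\<integral>\<^sup>+\<omega>. (\<Sum>i<N (real K) \<omega>. indicator (- {0<..real K}) (tau K i \<omega>) * indicator B (Y i \<omega>)) \<partial>P)"
    by (rule emeasure_law[OF B]) simp
  also have "\<dots> = (\<integral>\<^sup>+\<omega>. 0 \<partial>P)"
  proof (rule nn_integral_cong)
    fix \<omega> assume \<omega>: "\<omega> \<in> space P"
    have "0 < tau K i \<omega>" "tau K i \<omega> \<le> K" if "i < N (real K) \<omega>" for i
      using claim_time_pos[OF \<omega> _ that] claim_time_le[OF \<omega> _ that] that by (auto simp: tau_def)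
    then show "(\<Sum>i<N (real K) \<omega>. indicator (- {0<..real K}) (tau K i \<omega>) * indicator B (Y i \<omega>)) = (0::ennreal)"
      by (intro sum.neutral) auto
  qed
  finally show "emeasure (law B) (- {0<..real K}) = 0" by simp
qed (auto simp: sets_law)

lemma sum_tau_claim_count:
  assumes \<omega>: "\<omega> \<in> space P" and s: "0 \<le> s" "s < t"
  shows "(\<Sum>i<N (real K) \<omega>. indicator {s<..t} (tau K i \<omega>) * indicator B (Y i \<omega>)) =
    ennreal (if s < K then claim_count s (min t K) B \<omega> else 0)"
proof -
  have T: "s < tau K i \<omega> \<longleftrightarrow> N s \<omega> \<le> i" "tau K i \<omega> \<le> t \<longleftrightarrow> i < N (min t K) \<omega>" if "i < N (real K) \<omega>" for i
  proof -
    have eq: "tau K i \<omega> = claim_time N i \<omega>" using that by (simp add: tau_def)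
    show "s < tau K i \<omega> \<longleftrightarrow> N s \<omega> \<le> i"
      using claim_time_le_iff[OF \<omega> s(1) _ that] eq by (simp add: not_le[symmetric] not_less)
    have "tau K i \<omega> \<le> K" using tau_bounds(2)[OF \<omega>, of K i] by simp
    moreover have "claim_time N i \<omega> \<le> min t K \<longleftrightarrow> i < N (min t K) \<omega>"
      using s by (intro claim_time_le_iff[OF \<omega> _ _ that]) auto
    ultimately show "tau K i \<omega> \<le> t \<longleftrightarrow> i < N (min t K) \<omega>" using eq by simp
  qed
  have "(\<Sum>i<N (real K) \<omega>. indicator {s<..t} (tau K i \<omega>) * indicator B (Y i \<omega>)) =
      (\<Sum>i<N (real K) \<omega>. ennreal (indicator {s<..t} (tau K i \<omega>) * indicator B (Y i \<omega>)))"
    by (intro sum.cong) (auto simp: indicator_def)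
  also have "\<dots> = ennreal (\<Sum>i<N (real K) \<omega>. indicator {s<..t} (tau K i \<omega>) * indicator B (Y i \<omega>))"
    by (rule sum_ennreal) simp
  also have "(\<Sum>i<N (real K) \<omega>. indicator {s<..t} (tau K i \<omega>) * indicator B (Y i \<omega>)) =
      (\<Sum>i<N (real K) \<omega>. if i \<in> {N s \<omega>..<N (min t K) \<omega>} then indicator B (Y i \<omega>) else (0::real))"
    by (rule sum.cong) (simp_all add: T indicator_def)
  also have "\<dots> = (\<Sum>i\<in>{..<N (real K) \<omega>} \<inter> {N s \<omega>..<N (min t K) \<omega>}. indicator B (Y i \<omega>) :: real)"
    by (rule sum.inter_restrict[symmetric]) simp
  also have "\<dots> = (if s < K then claim_count s (min t K) B \<omega> else 0)"
  proof (cases "s < K")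
    case True
    have "N (min t K) \<omega> \<le> N (real K) \<omega>" using s by (intro N_le[OF \<omega>]) auto
    then have "{..<N (real K) \<omega>} \<inter> {N s \<omega>..<N (min t K) \<omega>} = {N s \<omega>..<N (min t K) \<omega>}" by auto
    then show ?thesis using True by (simp add: claim_count_def)
  next
    case False
    then have "N (real K) \<omega> \<le> N s \<omega>" by (intro N_le[OF \<omega>]) auto
    then have "{..<N (real K) \<omega>} \<inter> {N s \<omega>..<N (min t K) \<omega>} = {}" by auto
    then show ?thesis using False by simp
  qed
  finally show ?thesis .
qed

end

end

section \<open>The intensity of the claims is deterministic\<close>

context claims
begin

context
  fixes K :: nat
  assumes K: "0 < K"
begin

lemma integrable_claim_count:
  assumes ab: "0 \<le> a" "a < b" and B: "B \<in> sets borel"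
  shows "integrable P (claim_count a b B)"
proof (rule Bochner_Integration.integrable_bound[OF integrable_N(1)[OF ab]])
  have [measurable]: "N a \<in> measurable P (count_space UNIV)" "N b \<in> measurable P (count_space UNIV)"
    using N_measurable ab by auto
  note [measurable] = Y_measurable B
  have "(\<lambda>\<omega>. \<Sum>i. if N a \<omega> \<le> i \<and> i < N b \<omega> then indicator B (Y i \<omega>) else (0::real)) \<in> borel_measurable P"
    by measurable
  also have "(\<lambda>\<omega>. \<Sum>i. if N a \<omega> \<le> i \<and> i < N b \<omega> then indicator B (Y i \<omega>) else (0::real)) = claim_count a b B"
    by (intro ext, unfold claim_count_def, subst suminf_finite[of "{N a _..<N b _}"]) auto
  finally show "claim_count a b B \<in> borel_measurable P" .
  show "AE \<omega> in P. norm (claim_count a b B \<omega>) \<le> norm (real (N b \<omega> - N a \<omega>))"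
  proof (rule AE_I2)
    fix \<omega>
    have "claim_count a b B \<omega> \<le> (\<Sum>i\<in>{N a \<omega>..<N b \<omega>}. 1)"
      unfolding claim_count_def by (rule sum_mono) (auto simp: indicator_def)
    then show "norm (claim_count a b B \<omega>) \<le> norm (real (N b \<omega> - N a \<omega>))"
      by (simp add: claim_count_def sum_nonneg)
  qed
qed

lemma nn_integral_claim_sum:
  assumes s: "0 \<le> s" "s < t" and A: "A \<in> sets (aug s)" and B: "B \<in> sets borel"
  shows "(\<integral>\<^sup>+\<omega>. (\<Sum>i<N (real K) \<omega>. indicator ({s<..t} \<times> A) (tau K i \<omega>, \<omega>) * indicator B (Y i \<omega>)) \<partial>P) =
    emeasure P A * (\<integral>\<^sup>+\<omega>. (\<Sum>i<N (real K) \<omega>. indicator {s<..t} (tau K i \<omega>) * indicator B (Y i \<omega>)) \<partial>P)"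
proof -
  have AP[measurable]: "A \<in> sets P" using A sets_aug_P by auto
  define cc where "cc \<omega> = (if s < K then claim_count s (min t K) B \<omega> else 0)" for \<omega>
  have cc0: "0 \<le> cc \<omega>" for \<omega> by (simp add: cc_def claim_count_def sum_nonneg)
  have int: "integrable P cc"
  proof (cases "s < K")
    case True
    then have "integrable P (claim_count s (min t K) B)"
      using s by (intro integrable_claim_count[OF s(1) _ B]) auto
    moreover have "cc = claim_count s (min t K) B" using True by (auto simp: cc_def)
    ultimately show ?thesis by simp
  next
    case False
    then have "cc = (\<lambda>_. 0)" by (auto simp: cc_def)
    then show ?thesis by simp
  qed
  have "(\<integral>\<^sup>+\<omega>. (\<Sum>i<N (real K) \<omega>. indicator ({s<..t} \<times> A) (tau K i \<omega>, \<omega>) * indicator B (Y i \<omega>)) \<partial>P) =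
      (\<integral>\<^sup>+\<omega>. ennreal (indicator A \<omega> * cc \<omega>) \<partial>P)"
  proof (rule nn_integral_cong)
    fix \<omega> assume \<omega>: "\<omega> \<in> space P"
    have "(\<Sum>i<N (real K) \<omega>. indicator ({s<..t} \<times> A) (tau K i \<omega>, \<omega>) * indicator B (Y i \<omega>)) =
        (indicator A \<omega> :: ennreal) * (\<Sum>i<N (real K) \<omega>. indicator {s<..t} (tau K i \<omega>) * indicator B (Y i \<omega>))"
      unfolding sum_distrib_left by (rule sum.cong) (auto simp: indicator_def)
    also have "\<dots> = indicator A \<omega> * ennreal (cc \<omega>)"
      unfolding sum_tau_claim_count[OF K \<omega> s] cc_def ..
    also have "\<dots> = ennreal (indicator A \<omega> * cc \<omega>)" by (simp add: indicator_def)
    finally show "(\<Sum>i<N (real K) \<omega>. indicator ({s<..t} \<times> A) (tau K i \<omega>, \<omega>) * indicator B (Y i \<omega>)) =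
        ennreal (indicator A \<omega> * cc \<omega>)" .
  qed
  also have "\<dots> = ennreal (\<integral>\<omega>. indicator A \<omega> * cc \<omega> \<partial>P)"
    using integrable_real_mult_indicator[OF AP int] cc0
    by (intro nn_integral_eq_integral) (auto simp: mult.commute)
  also have "(\<integral>\<omega>. indicator A \<omega> * cc \<omega> \<partial>P) = prob A * (\<integral>\<omega>. cc \<omega> \<partial>P)"
  proof (cases "s < K")
    case True
    then show ?thesis using claim_count_indep[OF s(1) _ A B, of "min t K"] s by (simp add: cc_def)
  next
    case False then show ?thesis by (simp add: cc_def)
  qed
  also have "ennreal (prob A * (\<integral>\<omega>. cc \<omega> \<partial>P)) = emeasure P A * ennreal (\<integral>\<omega>. cc \<omega> \<partial>P)"
    by (simp add: ennreal_mult' emeasure_eq_measure)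
  also have "ennreal (\<integral>\<omega>. cc \<omega> \<partial>P) = (\<integral>\<^sup>+\<omega>. ennreal (cc \<omega>) \<partial>P)"
    using int cc0 by (intro nn_integral_eq_integral[symmetric]) auto
  also have "(\<integral>\<^sup>+\<omega>. ennreal (cc \<omega>) \<partial>P) =
      (\<integral>\<^sup>+\<omega>. (\<Sum>i<N (real K) \<omega>. indicator {s<..t} (tau K i \<omega>) * indicator B (Y i \<omega>)) \<partial>P)"
    unfolding cc_def by (rule nn_integral_cong) (rule sum_tau_claim_count[OF K _ s, symmetric])
  finally show ?thesis .
qed

text \<open>The laws of claim times live on the whole line, whereas \<open>pred\<close> has only
  nonnegative times. The clamp maps one into the other and changes nothing on (0, K], where the laws
  are concentrated.\<close>

lemma clamp_measurable: "(\<lambda>(s::real, \<omega>). (max 0 s, \<omega>)) \<in> measurable (borel \<Otimes>\<^sub>M P) pred"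
proof (rule measurable_predI)
  show "(case x of (s, \<omega>) \<Rightarrow> (max 0 s, \<omega>)) \<in> {0..} \<times> space P" if "x \<in> space (borel \<Otimes>\<^sub>M P)" for x :: "real \<times> 'a"
    using that by (auto simp: space_pair_measure)
  show "(\<lambda>(s::real, \<omega>). (max 0 s, \<omega>)) -` ({0} \<times> A) \<inter> space (borel \<Otimes>\<^sub>M P) \<in> sets (borel \<Otimes>\<^sub>M P)"
    if "A \<in> sets (aug 0)" for A
  proof -
    have A: "A \<in> sets P" using that sets_aug_P by auto
    have "(\<lambda>(s::real, \<omega>). (max 0 s, \<omega>)) -` ({0} \<times> A) \<inter> space (borel \<Otimes>\<^sub>M P) = {..0} \<times> A"
      using sets.sets_into_space[OF A] by (auto simp: space_pair_measure max_def split: if_splits)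
    then show ?thesis using A by simp
  qed
  show "(\<lambda>(s::real, \<omega>). (max 0 s, \<omega>)) -` ({s<..t} \<times> A) \<inter> space (borel \<Otimes>\<^sub>M P) \<in> sets (borel \<Otimes>\<^sub>M P)"
    if "0 \<le> s" "A \<in> sets (aug s)" for s t A
  proof -
    have A: "A \<in> sets P" using that sets_aug_P by auto
    have "(\<lambda>(s::real, \<omega>). (max 0 s, \<omega>)) -` ({s<..t} \<times> A) \<inter> space (borel \<Otimes>\<^sub>M P) = {s<..t} \<times> A"
      using sets.sets_into_space[OF A] that(1) by (auto simp: space_pair_measure max_def split: if_splits)
    then show ?thesis using A by simp
  qed
qed

lemma clamp_measurable_law: "(\<lambda>(s::real, \<omega>). (max 0 s, \<omega>)) \<in> measurable (law K B \<Otimes>\<^sub>M P) pred"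
  by (subst measurable_cong_sets[OF sets_pair_measure_cong[OF sets_law[OF K] refl] refl]) (rule clamp_measurable)

text \<open>On a rectangle the expected number of claims factorizes, since future counts are
  independent of the past; rectangles at time 0 have mass 0 on both sides because claim times are
  positive. These rectangles determine the measure.\<close>

lemma pred_law_eq:
  assumes B: "B \<in> sets borel"
  shows "pred_law K B = distr (law K B \<Otimes>\<^sub>M P) pred (\<lambda>(s::real, \<omega>). (max 0 s, \<omega>))"
proof (rule measure_eqI_pred)
  show "finite_measure (pred_law K B)" by (rule finite_pred_law[OF K B])
  fix Z assume Z: "Z \<in> pred_gen"
  have Zs: "Z \<in> sets pred" by (rule in_sets_pred[OF Z])
  have right: "emeasure (distr (law K B \<Otimes>\<^sub>M P) pred (\<lambda>(s::real, \<omega>). (max 0 s, \<omega>))) Z =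
      emeasure (law K B \<Otimes>\<^sub>M P) ((\<lambda>(s::real, \<omega>). (max 0 s, \<omega>)) -` Z \<inter> space (law K B \<Otimes>\<^sub>M P))"
    by (rule emeasure_distr[OF clamp_measurable_law Zs])
  have sp: "space (law K B \<Otimes>\<^sub>M P) = UNIV \<times> space P"
    using sets_eq_imp_space_eq[OF sets_law[OF K, of B]] by (simp add: space_pair_measure)
  from Z show "emeasure (pred_law K B) Z = emeasure (distr (law K B \<Otimes>\<^sub>M P) pred (\<lambda>(s::real, \<omega>). (max 0 s, \<omega>))) Z"
  proof (cases rule: pred_gen_cases)
    case (1 A)
    have A: "A \<in> sets P" using 1 sets_aug_P by auto
    have eq: "(\<lambda>(s::real, \<omega>). (max 0 s, \<omega>)) -` Z \<inter> space (law K B \<Otimes>\<^sub>M P) = {..0} \<times> A"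
      using sets.sets_into_space[OF A] unfolding sp 1 by (auto simp: max_def split: if_splits)
    have "AE s in law K B. s \<notin> {..0}" using AE_law[OF K B] by eventually_elim auto
    then have "emeasure (law K B) {..0} = 0"
      by (subst (asm) AE_iff_measurable[of "{..0}"]) (auto simp: sets_law[OF K] sets_eq_imp_space_eq[OF sets_law[OF K]])
    then have "emeasure (law K B \<Otimes>\<^sub>M P) ({..0} \<times> A) = 0"
      using A by (subst emeasure_pair_measure_Times) (auto simp: sets_law[OF K])
    moreover have "emeasure (pred_law K B) Z = (\<integral>\<^sup>+\<omega>. 0 \<partial>P)"
      unfolding emeasure_pred_law[OF K B Zs]
    proof (rule nn_integral_cong)
      fix \<omega> assume \<omega>: "\<omega> \<in> space P"
      have "tau K i \<omega> \<noteq> 0" if "i < N (real K) \<omega>" for i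
        using claim_time_pos[OF \<omega> _ that] that by (auto simp: tau_def)
      then show "(\<Sum>i<N (real K) \<omega>. indicator Z (tau K i \<omega>, \<omega>) * indicator B (Y i \<omega>)) = (0::ennreal)"
        unfolding 1 by (intro sum.neutral) (auto simp: indicator_def)
    qed
    ultimately show ?thesis unfolding right eq by simp
  next
    case (2 s t A)
    have A: "A \<in> sets P" using 2 sets_aug_P by auto
    have eq: "(\<lambda>(s::real, \<omega>). (max 0 s, \<omega>)) -` Z \<inter> space (law K B \<Otimes>\<^sub>M P) = {s<..t} \<times> A"
      using sets.sets_into_space[OF A] 2(2) unfolding sp 2(1) by (auto simp: max_def split: if_splits)
    have "emeasure (pred_law K B) Z = emeasure P A * emeasure (law K B) {s<..t}"
      unfolding emeasure_pred_law[OF K B Zs] unfolding 2(1)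
      by (subst nn_integral_claim_sum[OF 2(2-4) B]) (simp add: emeasure_law[OF K B])
    also have "\<dots> = emeasure (law K B \<Otimes>\<^sub>M P) ({s<..t} \<times> A)"
      using A by (subst emeasure_pair_measure_Times) (auto simp: sets_law[OF K] mult.commute)
    finally show ?thesis unfolding right eq .
  qed
qed (simp_all add: pred_law_def[OF K])

text \<open>Taking sizes in all of UNIV, the mass of (0, q] is the Poisson mean of N q, so the
  distribution functions coincide.\<close>

lemma law_UNIV_eq: "law K UNIV = density lborel (\<lambda>s. ennreal (lam * indicator {0..real K} s))"
proof (rule cdf_unique')
  let ?u = "density lborel (\<lambda>s. ennreal (lam * indicator {0..real K} s))"
  have fu: "finite_measure ?u"
  proof
    have "emeasure ?u (space ?u) = (\<integral>\<^sup>+s. ennreal lam * indicator {0..real K} s \<partial>lborel)"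
      using lam_pos by (subst emeasure_density) (auto intro!: nn_integral_cong simp: indicator_def)
    also have "\<dots> = ennreal lam * ennreal (real K)" by (subst nn_integral_cmult_indicator) auto
    finally show "emeasure ?u (space ?u) \<noteq> \<infinity>" by (simp add: ennreal_mult_eq_top_iff)
  qed
  then show "finite_borel_measure ?u" by (simp add: finite_borel_measure_def finite_borel_measure_axioms_def)
  show "finite_borel_measure (law K UNIV)"
    using finite_law[OF K, of UNIV] sets_law[OF K] by (simp add: finite_borel_measure_def finite_borel_measure_axioms_def)
  show "cdf (law K UNIV) = cdf ?u"
  proof
    fix t :: real
    define q where "q = max 0 (min t K)"
    have "emeasure ?u {..t} = (\<integral>\<^sup>+s. ennreal lam * indicator {0..q} s \<partial>lborel)"
    proof -
      have "AE s in lborel. ennreal (lam * indicator {0..real K} s) * indicator {..t} s = ennreal lam * indicator {0..q} s"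
        using AE_lborel_singleton[of 0] by eventually_elim (auto simp: indicator_def q_def)
      then have "(\<integral>\<^sup>+s. ennreal (lam * indicator {0..real K} s) * indicator {..t} s \<partial>lborel) =
          (\<integral>\<^sup>+s. ennreal lam * indicator {0..q} s \<partial>lborel)"
        by (rule nn_integral_cong_AE)
      then show ?thesis by (subst emeasure_density) auto
    qed
    also have "\<dots> = ennreal (lam * q)" using lam_pos
      by (subst nn_integral_cmult_indicator) (auto simp: q_def ennreal_mult')
    finally have u: "emeasure ?u {..t} = ennreal (lam * q)" .
    have "emeasure (law K UNIV) {..t} = ennreal (lam * q)"
    proof (cases "0 < t")
      case False
      have "AE s in law K UNIV. s \<notin> {..t}" using AE_law[OF K, of UNIV] False by (auto elim!: eventually_mono)
      then have "emeasure (law K UNIV) {..t} = 0"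
        by (subst (asm) AE_iff_measurable[of "{..t}"]) (auto simp: sets_law[OF K] sets_eq_imp_space_eq[OF sets_law[OF K]])
      then show ?thesis using False by (simp add: q_def)
    next
      case True
      have q: "q = min t K" "0 < q" using True K by (auto simp: q_def)
      have "emeasure (law K UNIV) {..t} = emeasure (law K UNIV) {0<..t}"
        by (rule emeasure_eq_AE) (use AE_law[OF K, of UNIV] in \<open>auto elim!: eventually_mono simp: sets_law[OF K]\<close>)
      also have "\<dots> = (\<integral>\<^sup>+\<omega>. ennreal (real (N q \<omega> - N 0 \<omega>)) \<partial>P)"
      proof (subst emeasure_law[OF K], simp, simp, rule nn_integral_cong)
        fix \<omega> assume "\<omega> \<in> space P"
        then show "(\<Sum>i<N (real K) \<omega>. indicator {0<..t} (tau K i \<omega>) * indicator UNIV (Y i \<omega>)) =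
            ennreal (real (N q \<omega> - N 0 \<omega>))"
          using K by (subst sum_tau_claim_count[OF K _ order_refl True]) (auto simp: claim_count_def q(1))
      qed
      also have "\<dots> = ennreal (lam * q)" using nn_integral_N[of 0 q] q by simp
      finally show ?thesis .
    qed
    with u show "cdf (law K UNIV) t = cdf ?u t" by (simp add: cdf_def measure_def)
  qed
qed

end

end

section \<open>Testing the intensity with the number of earlier claims\<close>

context claims
begin

text \<open>The assumption \<open>Y_N_indep\<close> gives independence from the claim numbers at integer times only.\<close>

lemma prob_claim_mark:
  assumes B: "B \<in> sets borel"
  shows "prob {\<omega> \<in> space P. j < N (real K) \<omega> \<and> Y j \<omega> \<in> B} =
    prob {\<omega> \<in> space P. j < N (real K) \<omega>} * measure \<nu> B"
proof -
  let ?A = "\<lambda>\<omega> i. Y i \<omega>" and ?N = "\<lambda>\<omega> k::nat. real ((\<lambda>t\<in>{0..}. N t \<omega>) (real k))"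
  define SA where "SA = (\<lambda>y. y j) -` B \<inter> space (PiM UNIV (\<lambda>_::nat. borel :: real measure))"
  define SN where "SN = (\<lambda>n. n K) -` {real j<..} \<inter> space (PiM {0..} (\<lambda>_::nat. count_space UNIV :: real measure))"
  have SA: "SA \<in> sets (PiM UNIV (\<lambda>_::nat. borel :: real measure))"
    unfolding SA_def
    by (rule measurable_sets[OF measurable_component_singleton[of j UNIV "\<lambda>_::nat. borel :: real measure"] B]) simp
  have SN: "SN \<in> sets (PiM {0..} (\<lambda>_::nat. count_space UNIV :: real measure))"
    unfolding SN_def
    by (rule measurable_sets[OF measurable_component_singleton[of K "{0..}" "\<lambda>_::nat. count_space UNIV :: real measure"]]) simp_all
  have A: "?A \<omega> \<in> SA \<longleftrightarrow> Y j \<omega> \<in> B" for \<omega> by (simp add: SA_def space_PiM)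
  have N: "?N \<omega> \<in> SN \<longleftrightarrow> j < N (real K) \<omega>" for \<omega>
    by (simp add: SN_def space_PiM PiE_def extensional_def)
  have "prob {\<omega> \<in> space P. j < N (real K) \<omega> \<and> Y j \<omega> \<in> B} = prob ((\<lambda>\<omega>. (?A \<omega>, ?N \<omega>)) -` (SA \<times> SN) \<inter> space P)"
    by (rule arg_cong[where f = prob]) (simp only: set_eq_iff Int_iff vimage_eq mem_Times_iff fst_conv snd_conv A N mem_Collect_eq, blast)
  also have "\<dots> = prob (?A -` SA \<inter> space P) * prob (?N -` SN \<inter> space P)"
    by (rule indep_varD[OF Y_N_indep SA SN])
  also have "?A -` SA \<inter> space P = {\<omega> \<in> space P. Y j \<omega> \<in> B}"
    by (simp only: set_eq_iff Int_iff vimage_eq A mem_Collect_eq) blast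
  also have "?N -` SN \<inter> space P = {\<omega> \<in> space P. j < N (real K) \<omega>}"
    by (simp only: set_eq_iff Int_iff vimage_eq N mem_Collect_eq) blast
  also have "prob {\<omega> \<in> space P. Y j \<omega> \<in> B} = measure (distr P borel (Y j)) B"
    using Y_measurable B by (subst measure_distr) (auto intro!: arg_cong[where f = prob])
  finally show ?thesis by (simp add: Y_law mult.commute)
qed

lemma prob_N:
  assumes "0 < s"
  shows "prob {\<omega> \<in> space P. N s \<omega> = j} = (lam * s) ^ j / fact j * exp (- (lam * s))"
proof -
  have [measurable]: "N 0 \<in> measurable P (count_space UNIV)" "N s \<in> measurable P (count_space UNIV)"
    using N_measurable assms by auto
  have "prob {\<omega> \<in> space P. N s \<omega> = j} = measure (distr P (count_space UNIV) (\<lambda>\<omega>. N s \<omega> - N 0 \<omega>)) {j}"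
    by (subst measure_distr) (auto intro!: arg_cong[where f = prob] simp: N_zero)
  also have "\<dots> = pmf (poisson_pmf (lam * (s - 0))) j"
    unfolding N_poisson[OF order_refl assms] by (rule measure_pmf_single)
  finally show ?thesis using lam_pos assms by simp
qed

text \<open>The probability of a claim in (q k, s] is 1 - exp (- lam * (s - q k)) and tends to 0 as
  q k approaches s. The witness is rational because \<open>count_ge\<close> inspects only rational
  times.\<close>

lemma AE_N_left:
  assumes s: "0 < s"
  shows "AE \<omega> in P. \<exists>q\<in>\<rat>. 0 \<le> q \<and> q < s \<and> N q \<omega> = N s \<omega>"
proof -
  obtain q :: "nat \<Rightarrow> real" where q: "\<And>k. q k \<in> \<rat>" "\<And>k. 0 \<le> q k \<and> q k < s" "q \<longlonglongrightarrow> s"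
  proof -
    have "\<exists>r\<in>\<rat>. max 0 (s - 1 / real (Suc k)) < r \<and> r < s" for k
      using Rats_dense_in_real[of "max 0 (s - 1 / real (Suc k))" s] s by auto
    then obtain q where q: "\<And>k. q k \<in> \<rat>" "\<And>k. max 0 (s - 1 / real (Suc k)) < q k" "\<And>k. q k < s" by metis
    have "q \<longlonglongrightarrow> s"
    proof (rule tendsto_sandwich[where h = "\<lambda>_. s"])
      show "(\<lambda>k. s - 1 / real (Suc k)) \<longlonglongrightarrow> s"
        using tendsto_diff[OF tendsto_const LIMSEQ_inverse_real_of_nat, of s] by (simp add: inverse_eq_divide)
      show "\<forall>\<^sub>F k in sequentially. s - 1 / real (Suc k) \<le> q k"
        using q(2) by (intro always_eventually allI) (auto intro: less_imp_le)
      show "\<forall>\<^sub>F k in sequentially. q k \<le> s" using q(3) by (intro always_eventually allI less_imp_le)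
    qed (rule tendsto_const)
    moreover have "0 \<le> q k \<and> q k < s" for k using q(2)[of k] q(3)[of k] by auto
    ultimately show ?thesis using q(1) that by blast
  qed
  define E where "E k = {\<omega> \<in> space P. N s \<omega> - N (q k) \<omega> \<noteq> 0}" for k
  have nm[measurable]: "N (q k) \<in> measurable P (count_space UNIV)" "N s \<in> measurable P (count_space UNIV)" for k
    using N_measurable q s by auto
  have [measurable]: "E k \<in> sets P" for k unfolding E_def by measurable
  have PE: "prob (E k) = 1 - exp (- (lam * (s - q k)))" for k
  proof -
    have "prob (E k) = measure (distr P (count_space UNIV) (\<lambda>\<omega>. N s \<omega> - N (q k) \<omega>)) (UNIV - {0})"
      unfolding E_def by (subst measure_distr) (auto intro!: arg_cong[where f = prob])
    also have "\<dots> = measure (measure_pmf (poisson_pmf (lam * (s - q k)))) (UNIV - {0})"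
      using N_poisson[of "q k" s] q(2)[of k] by simp
    also have "\<dots> = 1 - pmf (poisson_pmf (lam * (s - q k))) 0"
      using measure_pmf.prob_compl[of "{0}" "poisson_pmf (lam * (s - q k))"] by (simp add: measure_pmf_single)
    also have "\<dots> = 1 - exp (- (lam * (s - q k)))" using lam_pos q(2)[of k] by simp
    finally show ?thesis .
  qed
  have "prob (\<Inter>k. E k) \<le> 0"
  proof (rule LIMSEQ_le_const)
    have "(\<lambda>k. 1 - exp (- (lam * (s - q k)))) \<longlonglongrightarrow> 1 - exp (- (lam * (s - s)))"
      by (intro tendsto_intros q(3))
    then show "(\<lambda>k. prob (E k)) \<longlonglongrightarrow> 0" by (simp add: PE)
    have "prob (\<Inter>k. E k) \<le> prob (E k)" for k by (rule finite_measure_mono) auto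
    then show "\<exists>k0. \<forall>k\<ge>k0. prob (\<Inter>k. E k) \<le> prob (E k)" by blast
  qed
  then have "prob (\<Inter>k. E k) = 0" by (simp add: measure_le_0_iff)
  then have "emeasure P (\<Inter>k. E k) = 0" by (simp add: emeasure_eq_measure)
  then have "(\<Inter>k. E k) \<in> null_sets P" by (intro null_setsI) auto
  then have "AE \<omega> in P. \<omega> \<notin> (\<Inter>k. E k)" by (rule AE_not_in)
  then show ?thesis using AE_space
  proof eventually_elim
    case (elim \<omega>)
    then obtain k where k: "\<not> N s \<omega> - N (q k) \<omega> \<noteq> 0" by (auto simp: E_def)
    moreover have "N (q k) \<omega> \<le> N s \<omega>" using q(2)[of k] elim by (intro N_le) auto
    ultimately have "N (q k) \<omega> = N s \<omega>" by simp
    then show ?case using q(1,2)[of k] by blast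
  qed
qed

text \<open>The predictable set on which N_{s-} \<ge> j, written as a countable union of
  rectangles.\<close>

definition count_ge :: "nat \<Rightarrow> (real \<times> 'a) set" where
  "count_ge j = (\<Union>q\<in>\<rat> \<inter> {0..}. {q<..} \<times> {\<omega> \<in> space P. j \<le> N q \<omega>})"

lemma pred_Ioi: "0 \<le> q \<Longrightarrow> A \<in> sets (aug q) \<Longrightarrow> {q<..} \<times> A \<in> sets pred"
proof -
  assume q: "0 \<le> q" "A \<in> sets (aug q)"
  have "{q<..} = (\<Union>n. {q<..q + real (Suc n)})"
  proof (intro equalityI subsetI)
    fix x assume x: "x \<in> {q<..}"
    obtain n where "x - q \<le> real n" using real_arch_simple by blast
    then have "x \<in> {q<..q + real (Suc n)}" using x by simp
    then show "x \<in> (\<Union>n. {q<..q + real (Suc n)})" by blast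
  qed auto
  then have "{q<..} \<times> A = (\<Union>n. {q<..q + real (Suc n)} \<times> A)" by blast
  also have "\<dots> \<in> sets pred"
    using q by (intro sets.countable_UN) (auto intro!: in_sets_pred pred_genI2)
  finally show ?thesis .
qed

lemma count_ge_pred: "count_ge j \<in> sets pred"
  unfolding count_ge_def
proof (rule sets.countable_UN'')
  show "countable (\<rat> \<inter> {0::real..})" using countable_rat by blast
  show "{q<..} \<times> {\<omega> \<in> space P. j \<le> N q \<omega>} \<in> sets pred" if q: "q \<in> \<rat> \<inter> {0..}" for q :: real
  proof (rule pred_Ioi)
    have [measurable]: "N q \<in> measurable (F q) (count_space UNIV)" using N_measurable_F[of q q] q by simp
    have "{\<omega> \<in> space (F q). j \<le> N q \<omega>} \<in> sets (F q)" by measurable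
    then show "{\<omega> \<in> space P. j \<le> N q \<omega>} \<in> sets (aug q)" using sets_F_aug[of q] by (auto simp: space_F)
  qed (use q in auto)
qed

lemma count_ge_at:
  assumes s: "0 < s" and \<omega>: "\<omega> \<in> space P" and q: "\<exists>q\<in>\<rat>. 0 \<le> q \<and> q < s \<and> N q \<omega> = k"
    and le: "\<And>q. 0 \<le> q \<Longrightarrow> q < s \<Longrightarrow> N q \<omega> \<le> k"
  shows "(s, \<omega>) \<in> count_ge j \<longleftrightarrow> j \<le> k"
proof
  assume "(s, \<omega>) \<in> count_ge j"
  then obtain q where "0 \<le> q" "q < s" "j \<le> N q \<omega>" unfolding count_ge_def by auto
  then show "j \<le> k" using le[of q] by simp
next
  assume j: "j \<le> k"
  from q obtain q where "q \<in> \<rat>" "0 \<le> q" "q < s" "N q \<omega> = k" by blast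
  then show "(s, \<omega>) \<in> count_ge j" using j \<omega> unfolding count_ge_def by blast
qed

context
  fixes K :: nat
  assumes K: "0 < K"
begin

text \<open>Both sides are the mass of Z, the set where N_{s-} = j. In the product form, the section
  of Z at time s has the Poisson probability of N s = j. On the side of the claims, only claim
  number j is preceded by exactly j others, so the sum is the indicator of j < N K with Y j in
  B.\<close>

lemma law_kernel:
  assumes B: "B \<in> sets borel"
  shows "(\<integral>\<^sup>+s. ennreal ((lam * s) ^ j / fact j * exp (- (lam * s))) \<partial>law K B) =
    ennreal (prob {\<omega> \<in> space P. j < N (real K) \<omega>} * measure \<nu> B)"
proof -
  define Z where "Z = count_ge j - count_ge (Suc j)"
  have Z: "Z \<in> sets pred" unfolding Z_def using count_ge_pred by auto
  let ?c = "\<lambda>(s::real, \<omega>). (max 0 s, \<omega>)"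
  have "emeasure (pred_law K B) Z = (\<integral>\<^sup>+z. indicator Z z \<partial>pred_law K B)"
    using Z by (simp add: pred_law_def[OF K])
  also have "\<dots> = (\<integral>\<^sup>+z. indicator Z (?c z) \<partial>(law K B \<Otimes>\<^sub>M P))"
    unfolding pred_law_eq[OF K B] using Z by (intro nn_integral_distr clamp_measurable_law[OF K]) auto
  also have "\<dots> = (\<integral>\<^sup>+s. \<integral>\<^sup>+\<omega>. indicator Z (?c (s, \<omega>)) \<partial>P \<partial>law K B)"
    using measurable_compose[OF clamp_measurable_law[OF K], of "indicator Z" borel] Z
    by (intro nn_integral_fst[symmetric]) auto
  also have "\<dots> = (\<integral>\<^sup>+s. ennreal ((lam * s) ^ j / fact j * exp (- (lam * s))) \<partial>law K B)"
  proof (rule nn_integral_cong_AE)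
    show "AE s in law K B. (\<integral>\<^sup>+\<omega>. indicator Z (?c (s, \<omega>)) \<partial>P) = ennreal ((lam * s) ^ j / fact j * exp (- (lam * s)))"
      using AE_law[OF K B]
    proof eventually_elim
      case (elim s)
      then have s: "0 < s" by simp
      have [measurable]: "N s \<in> measurable P (count_space UNIV)" using N_measurable s by simp
      have "(\<integral>\<^sup>+\<omega>. indicator Z (?c (s, \<omega>)) \<partial>P) = (\<integral>\<^sup>+\<omega>. indicator {\<omega> \<in> space P. N s \<omega> = j} \<omega> \<partial>P)"
      proof (rule nn_integral_cong_AE)
        show "AE \<omega> in P. indicator Z (?c (s, \<omega>)) = (indicator {\<omega> \<in> space P. N s \<omega> = j} \<omega> :: ennreal)"
          using AE_N_left[OF s] AE_space
        proof eventually_elim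
          case (elim \<omega>)
          have "(s, \<omega>) \<in> count_ge i \<longleftrightarrow> i \<le> N s \<omega>" for i
            by (rule count_ge_at[OF s elim(2) elim(1)]) (rule N_le[OF elim(2)], auto)
          then show ?case using s elim(2) by (auto simp: Z_def indicator_def)
        qed
      qed
      also have "\<dots> = emeasure P {\<omega> \<in> space P. N s \<omega> = j}" by (rule nn_integral_indicator) measurable
      also have "\<dots> = ennreal ((lam * s) ^ j / fact j * exp (- (lam * s)))"
        unfolding emeasure_eq_measure prob_N[OF s] ..
      finally show ?case .
    qed
  qed
  finally have left: "emeasure (pred_law K B) Z =
      (\<integral>\<^sup>+s. ennreal ((lam * s) ^ j / fact j * exp (- (lam * s))) \<partial>law K B)" .
  note [measurable] = N_measurable[of "real K", simplified] Y_measurable B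
  have "emeasure (pred_law K B) Z =
      (\<integral>\<^sup>+\<omega>. indicator {\<omega> \<in> space P. j < N (real K) \<omega> \<and> Y j \<omega> \<in> B} \<omega> \<partial>P)"
    unfolding emeasure_pred_law[OF K B Z]
  proof (rule nn_integral_cong_AE)
    show "AE \<omega> in P. (\<Sum>i<N (real K) \<omega>. indicator Z (tau K i \<omega>, \<omega>) * indicator B (Y i \<omega>)) =
        (indicator {\<omega> \<in> space P. j < N (real K) \<omega> \<and> Y j \<omega> \<in> B} \<omega> :: ennreal)"
      using AE_N_simple AE_space
    proof eventually_elim
      case (elim \<omega>)
      \<comment> \<open>Just before claim i the count equals i: it is at most i by the definition of
        the claim time, and at least i because the path jumps by at most one.\<close>
      have mem: "(tau K i \<omega>, \<omega>) \<in> Z \<longleftrightarrow> i = j" if i: "i < N (real K) \<omega>" for i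
      proof -
        define T where "T = claim_time N i \<omega>"
        have T: "0 < T" "T \<le> K" using claim_time_pos[OF elim(2) _ i] claim_time_le[OF elim(2) _ i] by (auto simp: T_def)
        have iff: "T \<le> t \<longleftrightarrow> i < N t \<omega>" if "0 \<le> t" for t
          unfolding T_def by (rule claim_time_le_iff[OF elim(2) that _ i]) simp
        have le: "N q \<omega> \<le> i" if "0 \<le> q" "q < T" for q using iff[OF that(1)] that(2) by simp
        obtain s where s: "0 \<le> s" "s < T" "N T \<omega> \<le> N s \<omega> + 1" using elim(1) T(1) by blast
        obtain q where q: "q \<in> \<rat>" "s < q" "q < T" using Rats_dense_in_real[OF s(2)] by auto
        have "i \<le> N s \<omega>" using iff[of T] T(1) s(3) by simp
        also have "N s \<omega> \<le> N q \<omega>" using s q by (intro N_le[OF elim(2)]) auto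
        finally have "N q \<omega> = i" using le[of q] q s by simp
        then have ex: "\<exists>q\<in>\<rat>. 0 \<le> q \<and> q < T \<and> N q \<omega> = i" using q s by force
        have ge: "(T, \<omega>) \<in> count_ge l \<longleftrightarrow> l \<le> i" for l
          by (rule count_ge_at[OF T(1) elim(2) ex le])
        have "tau K i \<omega> = T" using i by (simp add: tau_def T_def)
        then have "(tau K i \<omega>, \<omega>) \<in> Z \<longleftrightarrow> j \<le> i \<and> \<not> Suc j \<le> i"
          unfolding Z_def Diff_iff by (simp only: ge)
        then show ?thesis by linarith
      qed
      have "(\<Sum>i<N (real K) \<omega>. indicator Z (tau K i \<omega>, \<omega>) * indicator B (Y i \<omega>)) =
          (\<Sum>i<N (real K) \<omega>. if i = j then indicator B (Y j \<omega>) else (0::ennreal))"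
        by (rule sum.cong) (auto simp: mem indicator_def)
      then show ?case using elim(2) by (simp add: indicator_def)
    qed
  qed
  also have "\<dots> = emeasure P {\<omega> \<in> space P. j < N (real K) \<omega> \<and> Y j \<omega> \<in> B}"
    by (rule nn_integral_indicator) measurable
  also have "\<dots> = ennreal (prob {\<omega> \<in> space P. j < N (real K) \<omega>} * measure \<nu> B)"
    unfolding emeasure_eq_measure prob_claim_mark[OF B] ..
  finally show ?thesis using left by simp
qed

end

end

section \<open>The compensator of the claims and the compensation formula\<close>

context claims
begin

lemma sets_nu: "sets \<nu> = sets borel" and prob_space_nu: "prob_space \<nu>"
  using Y_law[of 0] prob_space_distr[OF Y_measurable[of 0]] by auto

context
  fixes K :: nat
  assumes K: "0 < K"
begin

lemma law_moment:
  assumes B: "B \<in> sets borel"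
  shows "(\<integral>s. exp (- (lam * s)) * s ^ j \<partial>law K B) =
    fact j / lam ^ j * (prob {\<omega> \<in> space P. j < N (real K) \<omega>} * measure \<nu> B)"
proof -
  have "(\<integral>s. (lam * s) ^ j / fact j * exp (- (lam * s)) \<partial>law K B) =
      prob {\<omega> \<in> space P. j < N (real K) \<omega>} * measure \<nu> B"
  proof (subst integral_eq_nn_integral)
    show "(\<lambda>s. (lam * s) ^ j / fact j * exp (- (lam * s))) \<in> borel_measurable (law K B)"
      by (subst measurable_cong_sets[OF sets_law[OF K] refl]) measurable
    show "AE s in law K B. 0 \<le> (lam * s) ^ j / fact j * exp (- (lam * s))"
      using AE_law[OF K B] by eventually_elim (use lam_pos in simp)
  qed (subst law_kernel[OF K B], simp)
  moreover have "(\<lambda>s. exp (- (lam * s)) * s ^ j) = (\<lambda>s. fact j / lam ^ j * ((lam * s) ^ j / fact j * exp (- (lam * s))))"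
    using lam_pos by (simp add: power_mult_distrib mult.commute)
  ultimately show ?thesis by (simp only: integral_mult_right_zero)
qed

text \<open>In \<open>law_moment\<close> the set B enters only through the factor
  \<open>measure \<nu> B\<close>. So both measures have the same moments weighted by exp (- lam *
  s), and on a compact interval these determine them.\<close>

lemma law_eq:
  assumes B: "B \<in> sets borel"
  shows "law K B = density (law K UNIV) (\<lambda>_. ennreal (measure \<nu> B))"
proof (rule measure_eqI_moments[where \<rho> = "\<lambda>s. exp (- (lam * s))" and K = K])
  let ?d = "density (law K UNIV) (\<lambda>_. ennreal (measure \<nu> B))"
  interpret u: finite_measure "law K UNIV" by (rule finite_law[OF K]) simp
  interpret nu: prob_space \<nu> by (rule prob_space_nu)
  show "finite_measure (law K B)" by (rule finite_law[OF K B])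
  show "finite_measure ?d"
  proof
    have "emeasure ?d (space ?d) = ennreal (measure \<nu> B) * emeasure (law K UNIV) (space (law K UNIV))"
      by (subst emeasure_density) (auto simp: nn_integral_cmult_indicator)
    then show "emeasure ?d (space ?d) \<noteq> \<infinity>" by (simp add: u.emeasure_eq_measure ennreal_mult_eq_top_iff)
  qed
  show "sets (law K B) = sets borel" "sets ?d = sets borel" by (simp_all add: sets_law[OF K])
  show "AE s in law K B. s \<in> {0..real K}" using AE_law[OF K B] by eventually_elim simp
  show "AE s in ?d. s \<in> {0..real K}"
    using AE_law[OF K, of UNIV] by (subst AE_density) (auto elim!: eventually_mono)
  show "continuous_on UNIV (\<lambda>s. exp (- (lam * s)))" by (intro continuous_intros)
  fix j :: nat
  have m: "(\<lambda>s. exp (- (lam * s)) * s ^ j) \<in> borel_measurable (law K UNIV)"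
    by (subst measurable_cong_sets[OF sets_law[OF K] refl]) measurable
  have "(\<integral>s. exp (- (lam * s)) * s ^ j \<partial>?d) = measure \<nu> B * (\<integral>s. exp (- (lam * s)) * s ^ j \<partial>law K UNIV)"
    using m by (subst integral_density) auto
  moreover have "measure \<nu> UNIV = 1" using nu.prob_space sets_eq_imp_space_eq[OF sets_nu] by simp
  ultimately show "(\<integral>s. exp (- (lam * s)) * s ^ j \<partial>law K B) = (\<integral>s. exp (- (lam * s)) * s ^ j \<partial>?d)"
    by (simp add: law_moment B)
qed simp

definition clock :: "real measure" where
  "clock = density lborel (\<lambda>s. ennreal (lam * indicator {0..real K} s))"

definition pred_clock :: "(real \<times> 'a) measure" where
  "pred_clock = distr (clock \<Otimes>\<^sub>M P) pred (\<lambda>(s, \<omega>). (max 0 s, \<omega>))"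

definition claim_map :: "nat \<times> 'a \<Rightarrow> (real \<times> 'a) \<times> real" where
  "claim_map = (\<lambda>(i, \<omega>). ((tau K i \<omega>, \<omega>), Y i \<omega>))"

lemma clock_eq: "clock = law K UNIV" by (simp add: clock_def law_UNIV_eq[OF K])

lemma finite_clock: "finite_measure clock"
  unfolding clock_eq by (rule finite_law[OF K]) simp

lemma clamp_measurable_clock: "(\<lambda>(s::real, \<omega>). (max 0 s, \<omega>)) \<in> measurable (clock \<Otimes>\<^sub>M P) pred"
  unfolding clock_eq by (rule clamp_measurable_law[OF K])

lemma finite_pred_clock: "finite_measure pred_clock"
proof -
  interpret c: finite_measure clock by (rule finite_clock)
  have "finite_measure (clock \<Otimes>\<^sub>M P)"
  proof
    have "emeasure (clock \<Otimes>\<^sub>M P) (space clock \<times> space P) = emeasure clock (space clock) * emeasure P (space P)"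
      by (rule emeasure_pair_measure_Times) auto
    then show "emeasure (clock \<Otimes>\<^sub>M P) (space (clock \<Otimes>\<^sub>M P)) \<noteq> \<infinity>"
      by (simp add: space_pair_measure c.emeasure_eq_measure emeasure_space_1)
  qed
  then show ?thesis unfolding pred_clock_def
    by (rule finite_measure.finite_measure_distr[OF _ clamp_measurable_clock])
qed

lemma emeasure_pred_law_eq:
  assumes B: "B \<in> sets borel" and Z: "Z \<in> sets pred"
  shows "emeasure (pred_law K B) Z = emeasure pred_clock Z * emeasure \<nu> B"
proof -
  interpret nu: prob_space \<nu> by (rule prob_space_nu)
  let ?c = "\<lambda>(s::real, \<omega>). (max 0 s, \<omega>)"
  let ?W = "?c -` Z \<inter> space (law K UNIV \<Otimes>\<^sub>M P)"
  have W: "?W \<in> sets (law K UNIV \<Otimes>\<^sub>M P)" by (rule measurable_sets[OF clamp_measurable_law[OF K] Z])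
  have sp: "space (law K B \<Otimes>\<^sub>M P) = space (law K UNIV \<Otimes>\<^sub>M P)"
    using sets_eq_imp_space_eq[OF sets_law[OF K]] by (simp add: space_pair_measure)
  have W': "?W \<in> sets (law K B \<Otimes>\<^sub>M P)"
    using W by (simp cong: sets_pair_measure_cong add: sets_pair_measure_cong[OF trans[OF sets_law[OF K] sets_law[OF K, symmetric]] refl, of B P UNIV])
  have m: "(\<lambda>s. emeasure P (Pair s -` ?W)) \<in> borel_measurable (law K UNIV)"
    by (rule measurable_emeasure_Pair[OF W])
  have "emeasure (pred_law K B) Z = emeasure (law K B \<Otimes>\<^sub>M P) ?W"
    unfolding pred_law_eq[OF K B] by (subst emeasure_distr[OF clamp_measurable_law[OF K] Z]) (simp add: sp)
  also have "\<dots> = (\<integral>\<^sup>+s. emeasure P (Pair s -` ?W) \<partial>law K B)" by (rule emeasure_pair_measure_alt[OF W'])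
  also have "\<dots> = ennreal (measure \<nu> B) * (\<integral>\<^sup>+s. emeasure P (Pair s -` ?W) \<partial>law K UNIV)"
    unfolding law_eq[OF B] using m by (simp add: nn_integral_density nn_integral_cmult)
  also have "(\<integral>\<^sup>+s. emeasure P (Pair s -` ?W) \<partial>law K UNIV) = emeasure pred_clock Z"
    unfolding pred_clock_def clock_eq
    by (subst emeasure_distr[OF clamp_measurable_law[OF K] Z]) (rule emeasure_pair_measure_alt[OF W, symmetric])
  finally show ?thesis by (simp add: nu.emeasure_eq_measure mult.commute)
qed

lemma claim_map_measurable: "claim_map \<in> measurable (core K) (pred \<Otimes>\<^sub>M borel)"
proof -
  have "(\<lambda>x. ((\<lambda>(i, \<omega>). (tau K i \<omega>, \<omega>)) x, (\<lambda>(i, \<omega>). Y i \<omega>) x)) \<in> measurable (core K) (pred \<Otimes>\<^sub>M borel)"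
    by (rule measurable_Pair[OF core_pair_measurable[OF K] core_Y_measurable[OF K]])
  also have "(\<lambda>x. ((\<lambda>(i, \<omega>). (tau K i \<omega>, \<omega>)) x, (\<lambda>(i, \<omega>). Y i \<omega>) x)) = claim_map"
    by (auto simp: claim_map_def)
  finally show ?thesis .
qed

text \<open>It suffices to compare rectangles Z x B; there the side of the claims is the predictable
  law of those with size in B, already identified as a product.\<close>

lemma compensator: "pred_clock \<Otimes>\<^sub>M \<nu> = distr (core K) (pred \<Otimes>\<^sub>M borel) claim_map"
proof (rule pair_measure_eqI)
  show "sigma_finite_measure pred_clock"
    using finite_pred_clock by (simp add: finite_measure.axioms(1))
  show "sigma_finite_measure \<nu>"
    using prob_space_nu by (rule prob_space_imp_sigma_finite)
  show "sets (pred_clock \<Otimes>\<^sub>M \<nu>) = sets (distr (core K) (pred \<Otimes>\<^sub>M borel) claim_map)"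
    using sets_nu by (simp add: pred_clock_def cong: sets_pair_measure_cong)
  fix Z B assume Z': "Z \<in> sets pred_clock" and B': "B \<in> sets \<nu>"
  have Z: "Z \<in> sets pred" and B: "B \<in> sets borel" using Z' B' by (auto simp: pred_clock_def sets_nu)
  have ZB: "Z \<times> B \<in> sets (pred \<Otimes>\<^sub>M borel)" using Z B by simp
  have "emeasure (distr (core K) (pred \<Otimes>\<^sub>M borel) claim_map) (Z \<times> B) =
      (\<integral>\<^sup>+z. indicator (Z \<times> B) z \<partial>distr (core K) (pred \<Otimes>\<^sub>M borel) claim_map)"
    using ZB by simp
  also have "\<dots> = (\<integral>\<^sup>+x. indicator (Z \<times> B) (claim_map x) \<partial>core K)"
    using ZB by (intro nn_integral_distr claim_map_measurable) auto
  also have "\<dots> = (\<integral>\<^sup>+(i, \<omega>). indicator (Z \<times> B) ((tau K i \<omega>, \<omega>), Y i \<omega>) \<partial>core K)"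
    by (rule nn_integral_cong) (auto simp: claim_map_def)
  also have "\<dots> = (\<integral>\<^sup>+\<omega>. (\<Sum>i<N (real K) \<omega>. indicator (Z \<times> B) ((tau K i \<omega>, \<omega>), Y i \<omega>)) \<partial>P)"
  proof (rule nn_integral_core[OF K])
    have "(\<lambda>\<omega>. ((tau K i \<omega>, \<omega>), Y i \<omega>)) \<in> measurable P (pred \<Otimes>\<^sub>M borel)" for i
      by (intro measurable_Pair Y_measurable measurable_aug_P[OF tau_pair_adapted]) simp
    then show "(\<lambda>\<omega>. indicator (Z \<times> B) ((tau K i \<omega>, \<omega>), Y i \<omega>) :: ennreal) \<in> borel_measurable P" for i
      by (rule measurable_compose) (rule borel_measurable_indicator[OF ZB])
  qed
  also have "\<dots> = emeasure (pred_law K B) Z"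
    unfolding emeasure_pred_law[OF K B Z]
    by (intro nn_integral_cong sum.cong) (auto simp: indicator_def)
  finally show "emeasure pred_clock Z * emeasure \<nu> B = emeasure (distr (core K) (pred \<Otimes>\<^sub>M borel) claim_map) (Z \<times> B)"
    by (simp add: emeasure_pred_law_eq[OF B Z])
qed

text \<open>The signed counterpart of \<open>nn_integral_core\<close>, by Fubini over claim number
  and scenario.\<close>

lemma integral_core:
  fixes f :: "nat \<Rightarrow> 'a \<Rightarrow> real"
  assumes f: "\<And>i. f i \<in> borel_measurable P" and int: "integrable (core K) (\<lambda>(i, \<omega>). f i \<omega>)"
  shows "integrable P (\<lambda>\<omega>. \<Sum>i<N (real K) \<omega>. f i \<omega>)"
    "(\<integral>(i, \<omega>). f i \<omega> \<partial>core K) = (\<integral>\<omega>. (\<Sum>i<N (real K) \<omega>. f i \<omega>) \<partial>P)"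
proof -
  let ?u = "\<lambda>(i, \<omega>). if i < N (real K) \<omega> then 1 else 0::real"
  let ?g = "\<lambda>i \<omega>. if i < N (real K) \<omega> then f i \<omega> else 0"
  have u: "?u \<in> borel_measurable (count_space UNIV \<Otimes>\<^sub>M P)"
  proof (rule measurable_nat_pair)
    note [measurable] = N_measurable[of "real K", simplified]
    show "(\<lambda>\<omega>. if i < N (real K) \<omega> then 1 else 0::real) \<in> borel_measurable P" for i by measurable
  qed
  have core: "core K = density (count_space UNIV \<Otimes>\<^sub>M P) (\<lambda>x. ennreal (?u x))"
    unfolding core_def[OF K] by (rule arg_cong[where f = "density _"]) (auto simp: fun_eq_iff)
  have fm: "(\<lambda>(i, \<omega>). f i \<omega>) \<in> borel_measurable (count_space UNIV \<Otimes>\<^sub>M P)"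
    by (rule measurable_nat_pair[OF f])
  have g: "(\<lambda>x. ?u x *\<^sub>R (case x of (i, \<omega>) \<Rightarrow> f i \<omega>)) = case_prod ?g" by (auto simp: fun_eq_iff)
  have u0: "AE x in count_space UNIV \<Otimes>\<^sub>M P. 0 \<le> ?u x" by (rule AE_I2) auto
  have gi: "integrable (count_space UNIV \<Otimes>\<^sub>M P) (case_prod ?g)"
    using int unfolding core integrable_density[OF fm u u0] g .
  interpret c: sigma_finite_measure "count_space (UNIV::nat set)"
    by (rule sigma_finite_measure_count_space_countable) simp
  interpret pair_sigma_finite "count_space (UNIV::nat set)" P ..
  have sum: "(\<integral>i. ?g i \<omega> \<partial>count_space UNIV) = (\<Sum>i<N (real K) \<omega>. f i \<omega>)" for \<omega>
  proof -
    have "finite {i \<in> UNIV. ?g i \<omega> \<noteq> 0}" by (rule finite_subset[of _ "{..<N (real K) \<omega>}"]) auto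
    then have "(\<integral>i. ?g i \<omega> \<partial>count_space UNIV) = (\<Sum>i | i \<in> UNIV \<and> ?g i \<omega> \<noteq> 0. ?g i \<omega>)"
      by (rule lebesgue_integral_count_space_finite_support)
    also have "\<dots> = (\<Sum>i<N (real K) \<omega>. f i \<omega>)"
      by (rule sum.mono_neutral_cong_left) auto
    finally show ?thesis .
  qed
  show "integrable P (\<lambda>\<omega>. \<Sum>i<N (real K) \<omega>. f i \<omega>)"
    using integrable_snd[OF gi] by (simp only: sum)
  have "(\<integral>(i, \<omega>). f i \<omega> \<partial>core K) = integral\<^sup>L (count_space UNIV \<Otimes>\<^sub>M P) (case_prod ?g)"
    unfolding core integral_density[OF fm u u0] g ..
  also have "\<dots> = (\<integral>\<omega>. (\<Sum>i<N (real K) \<omega>. f i \<omega>) \<partial>P)"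
    using integral_snd[OF gi] by (simp only: sum)
  finally show "(\<integral>(i, \<omega>). f i \<omega> \<partial>core K) = (\<integral>\<omega>. (\<Sum>i<N (real K) \<omega>. f i \<omega>) \<partial>P)" .
qed

text \<open>H is integrated against the two descriptions of one finite measure in
  \<open>compensator\<close>. One side unfolds to a random sum over claims, the other by Fubini to a
  time integral of means over the size. Boundedness of H gives integrability, and the clamp
  disappears because the clock is supported in [0, K].\<close>

theorem compensation:
  fixes H :: "(real \<times> 'a) \<times> real \<Rightarrow> real"
  assumes H: "H \<in> borel_measurable (pred \<Otimes>\<^sub>M borel)" and bound: "\<And>z. \<bar>H z\<bar> \<le> C"
  defines "g \<equiv> \<lambda>s \<omega>. \<integral>y. H ((s, \<omega>), y) \<partial>\<nu>"
  shows "integrable P (\<lambda>\<omega>. \<Sum>i<N (real K) \<omega>. H ((tau K i \<omega>, \<omega>), Y i \<omega>))" (is ?A)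
    and "integrable P (\<lambda>\<omega>. LINT s:{0..real K}|lborel. g s \<omega>)" (is ?B)
    and "(\<integral>\<omega>. (\<Sum>i<N (real K) \<omega>. H ((tau K i \<omega>, \<omega>), Y i \<omega>)) \<partial>P) =
      lam * (\<integral>\<omega>. (LINT s:{0..real K}|lborel. g s \<omega>) \<partial>P)" (is ?C)
proof -
  interpret nu: prob_space \<nu> by (rule prob_space_nu)
  interpret core: finite_measure "core K" by (rule finite_core[OF K])
  interpret pc: finite_measure pred_clock by (rule finite_pred_clock)
  interpret clock: finite_measure clock by (rule finite_clock)
  interpret p1: pair_sigma_finite pred_clock \<nu> ..
  interpret p2: pair_sigma_finite clock P ..
  let ?c = "\<lambda>(s::real, \<omega>). (max 0 s, \<omega>)"
  have sets1: "sets (pred_clock \<Otimes>\<^sub>M \<nu>) = sets (pred \<Otimes>\<^sub>M borel)"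
    using sets_nu by (simp add: pred_clock_def cong: sets_pair_measure_cong)
  have Hint: "integrable (distr (core K) (pred \<Otimes>\<^sub>M borel) claim_map) H"
  proof (rule finite_measure.integrable_const_bound[where B = C])
    show "finite_measure (distr (core K) (pred \<Otimes>\<^sub>M borel) claim_map)"
      by (rule core.finite_measure_distr[OF claim_map_measurable])
  qed (use H bound in auto)
  have meas: "(\<lambda>\<omega>. H ((tau K i \<omega>, \<omega>), Y i \<omega>)) \<in> borel_measurable P" for i
  proof -
    have "(\<lambda>\<omega>. ((tau K i \<omega>, \<omega>), Y i \<omega>)) \<in> measurable P (pred \<Otimes>\<^sub>M borel)"
      by (intro measurable_Pair Y_measurable measurable_aug_P[OF tau_pair_adapted]) simp
    then show ?thesis by (rule measurable_compose[OF _ H])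
  qed
  have Hc: "(\<lambda>x. H (claim_map x)) = (\<lambda>(i, \<omega>). H ((tau K i \<omega>, \<omega>), Y i \<omega>))"
    by (auto simp: claim_map_def)
  have "integrable (core K) (\<lambda>x. H (claim_map x))"
    using integrable_distr[OF claim_map_measurable Hint] .
  then have core_int: "integrable (core K) (\<lambda>(i, \<omega>). H ((tau K i \<omega>, \<omega>), Y i \<omega>))" unfolding Hc .
  show ?A by (rule integral_core(1)[OF meas core_int])
  have "(\<integral>\<omega>. (\<Sum>i<N (real K) \<omega>. H ((tau K i \<omega>, \<omega>), Y i \<omega>)) \<partial>P) = (\<integral>x. H (claim_map x) \<partial>core K)"
    unfolding Hc by (rule integral_core(2)[OF meas core_int, symmetric])
  also have "\<dots> = integral\<^sup>L (distr (core K) (pred \<Otimes>\<^sub>M borel) claim_map) H"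
    by (rule integral_distr[OF claim_map_measurable H, symmetric])
  also have "\<dots> = integral\<^sup>L (pred_clock \<Otimes>\<^sub>M \<nu>) H" unfolding compensator ..
  also have "\<dots> = (\<integral>z. (\<integral>y. H (z, y) \<partial>\<nu>) \<partial>pred_clock)"
    by (rule p1.integral_fst'[symmetric]) (use Hint in \<open>simp add: compensator\<close>)
  also have "\<dots> = (\<integral>z. g (fst z) (snd z) \<partial>pred_clock)" by (simp add: g_def)
  also have "\<dots> = (\<integral>x. g (fst (?c x)) (snd (?c x)) \<partial>(clock \<Otimes>\<^sub>M P))"
  proof -
    have "(\<lambda>z. \<integral>y. H (z, y) \<partial>\<nu>) \<in> borel_measurable pred_clock"
      by (rule borel_measurable_integrable[OF p1.integrable_fst']) (use Hint in \<open>simp add: compensator\<close>)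
    then have "(\<lambda>z. g (fst z) (snd z)) \<in> borel_measurable pred"
      by (simp add: g_def pred_clock_def)
    then show ?thesis unfolding pred_clock_def by (rule integral_distr[OF clamp_measurable_clock])
  qed
  finally have 1: "(\<integral>\<omega>. (\<Sum>i<N (real K) \<omega>. H ((tau K i \<omega>, \<omega>), Y i \<omega>)) \<partial>P) =
    (\<integral>(s, \<omega>). g (max 0 s) \<omega> \<partial>(clock \<Otimes>\<^sub>M P))" by (simp add: case_prod_unfold)
  have gpred: "(\<lambda>z. g (fst z) (snd z)) \<in> borel_measurable pred"
  proof -
    have "(\<lambda>z. \<integral>y. H (z, y) \<partial>\<nu>) \<in> borel_measurable pred_clock"
      by (rule borel_measurable_integrable[OF p1.integrable_fst']) (use Hint in \<open>simp add: compensator\<close>)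
    then show ?thesis by (simp add: g_def pred_clock_def)
  qed
  have gint: "integrable (clock \<Otimes>\<^sub>M P) (\<lambda>(s, \<omega>). g (max 0 s) \<omega>)"
  proof -
    have "integrable pred_clock (\<lambda>z. \<integral>y. H (z, y) \<partial>\<nu>)"
      by (rule p1.integrable_fst') (use Hint in \<open>simp add: compensator\<close>)
    then have "integrable pred_clock (\<lambda>z. g (fst z) (snd z))" by (simp add: g_def)
    then have "integrable (clock \<Otimes>\<^sub>M P) (\<lambda>x. g (fst (?c x)) (snd (?c x)))"
      unfolding pred_clock_def by (rule integrable_distr[OF clamp_measurable_clock])
    then show ?thesis by (simp add: case_prod_unfold)
  qed
  have inner: "(\<integral>s. g (max 0 s) \<omega> \<partial>clock) = lam * (LINT s:{0..real K}|lborel. g s \<omega>)" if \<omega>: "\<omega> \<in> space P" for \<omega>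
  proof -
    have "(\<lambda>s. (s, \<omega>)) \<in> measurable borel (borel \<Otimes>\<^sub>M P)" using \<omega> by measurable
    from measurable_compose[OF measurable_compose[OF this clamp_measurable[OF K]] gpred]
    have m: "(\<lambda>s. g (max 0 s) \<omega>) \<in> borel_measurable lborel" by simp
    have "(\<integral>s. g (max 0 s) \<omega> \<partial>clock) = (\<integral>s. (lam * indicator {0..real K} s) *\<^sub>R g (max 0 s) \<omega> \<partial>lborel)"
      unfolding clock_def using lam_pos by (intro integral_density[OF m]) auto
    also have "\<dots> = (\<integral>s. lam * (indicator {0..real K} s *\<^sub>R g s \<omega>) \<partial>lborel)"
      by (rule Bochner_Integration.integral_cong) (auto simp: indicator_def max_def)
    also have "\<dots> = lam * (LINT s:{0..real K}|lborel. g s \<omega>)"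
      unfolding set_lebesgue_integral_def by (rule integral_mult_right_zero)
    finally show ?thesis .
  qed
  have "integrable P (\<lambda>\<omega>. \<integral>s. g (max 0 s) \<omega> \<partial>clock)" by (rule p2.integrable_snd[OF gint])
  then have "integrable P (\<lambda>\<omega>. lam * (LINT s:{0..real K}|lborel. g s \<omega>))"
    by (rule Bochner_Integration.integrable_cong[THEN iffD1, OF refl, rotated]) (rule inner)
  then show ?B using lam_pos by simp
  have "(\<integral>(s, \<omega>). g (max 0 s) \<omega> \<partial>(clock \<Otimes>\<^sub>M P)) = (\<integral>\<omega>. (\<integral>s. g (max 0 s) \<omega> \<partial>clock) \<partial>P)"
    by (rule p2.integral_snd[OF gint, symmetric])
  also have "\<dots> = (\<integral>\<omega>. lam * (LINT s:{0..real K}|lborel. g s \<omega>) \<partial>P)"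
    by (rule Bochner_Integration.integral_cong) (auto simp: inner)
  finally show ?C unfolding 1 by simp
qed

end

end

section \<open>The market\<close>

context drawdown_market
begin

lemma borel_nu: "f \<in> borel_measurable borel \<Longrightarrow> f \<in> borel_measurable \<nu>"
  by (subst measurable_cong_sets[OF events_eq_borel refl])

lemma AE_pos: "AE y in \<nu>. 0 < y"
proof -
  have "measure \<nu> {..0} = 0" using cdf_zero by (simp add: cdf_def)
  then have "emeasure \<nu> {..0} = 0" by (simp add: emeasure_eq_measure)
  then have "AE y in \<nu>. y \<notin> {..0}" by (intro AE_not_in null_setsI) auto
  then show ?thesis by eventually_elim auto
qed

text \<open>Degree four is what the square of the quadratic weight \<open>G\<close> in
  \<open>retention_bounded_below\<close> calls for; every other integrand in this context grows more
  slowly.\<close>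

lemma integrable_power4: "integrable \<nu> (\<lambda>y. y ^ 4)"
proof -
  obtain \<epsilon> where e: "\<epsilon> > 0" "\<And>r. \<bar>r\<bar> < \<epsilon> \<Longrightarrow> integrable \<nu> (\<lambda>y. exp (r * y))" using mgf_finite by auto
  \<comment> \<open>Then 4 * r = \<epsilon> / 2 is inside the range of finite exponential moments,
    and r * y \<le> exp (r * y) can be raised to the fourth power.\<close>
  define r where "r = \<epsilon> / 8"
  have r: "0 < r" using e by (simp add: r_def)
  have int: "integrable \<nu> (\<lambda>y. exp (4 * r * y) / r ^ 4)"
    using e(2)[of "4 * r"] e(1) by (simp add: r_def)
  show ?thesis
  proof (rule Bochner_Integration.integrable_bound[OF int])
    show "(\<lambda>y. y ^ 4) \<in> borel_measurable \<nu>" by (rule borel_nu) measurable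
    show "AE y in \<nu>. norm (y ^ 4) \<le> norm (exp (4 * r * y) / r ^ 4)"
      using AE_pos
    proof eventually_elim
      case (elim y)
      have "r * y \<le> exp (r * y)" using exp_ge_add_one_self[of "r * y"] by linarith
      then have "(r * y) ^ 4 \<le> exp (r * y) ^ 4" using r elim by (intro power_mono) auto
      also have "\<dots> = exp (4 * r * y)" by (simp add: exp_of_nat_mult[symmetric] mult.assoc)
      finally show ?case using r elim by (simp add: power_mult_distrib pos_le_divide_eq mult.commute)
    qed
  qed
qed

lemma integrable_by_power4:
  assumes f: "f \<in> borel_measurable borel" and bound: "\<And>y. 0 < y \<Longrightarrow> \<bar>f y\<bar> \<le> A * (1 + y ^ 4)"
  shows "integrable \<nu> f"
proof (rule Bochner_Integration.integrable_bound[where f = "\<lambda>y. A * (1 + y ^ 4)"])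
  show "integrable \<nu> (\<lambda>y. A * (1 + y ^ 4))" using integrable_power4 by simp
  show "AE y in \<nu>. norm (f y) \<le> norm (A * (1 + y ^ 4))"
    using AE_pos by eventually_elim (use bound in force)
qed (rule borel_nu[OF f])

lemma power_le_power4:
  assumes "0 < (y::real)" shows "y \<le> 1 + y ^ 4" "y ^ 2 \<le> 1 + y ^ 4" "y ^ 3 \<le> 1 + y ^ 4"
proof -
  have *: "y ^ k \<le> 1 + y ^ 4" if "k \<le> 4" for k
  proof (cases "y \<le> 1")
    case True
    then have "y ^ k \<le> 1" using assms by (intro power_le_one) auto
    moreover have "0 \<le> y ^ 4" using assms by simp
    ultimately show ?thesis by linarith
  next
    case False
    then have "y ^ k \<le> y ^ 4" using that by (intro power_increasing) auto
    then show ?thesis by simp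
  qed
  show "y \<le> 1 + y ^ 4" "y ^ 2 \<le> 1 + y ^ 4" "y ^ 3 \<le> 1 + y ^ 4" using *[of 1] *[of 2] *[of 3] by auto
qed

lemma integrable_moments: "integrable \<nu> (\<lambda>y. y)" "integrable \<nu> (\<lambda>y. y\<^sup>2)"
  by (rule integrable_by_power4[where A = 1]; use power_le_power4 in \<open>auto simp: abs_of_pos\<close>)+

context
  fixes R :: "real \<Rightarrow> real"
  assumes R: "R \<in> borel_measurable borel" and bounds: "retention_bounds R"
begin

lemma R_bounds: "0 \<le> R y" "0 < y \<Longrightarrow> R y \<le> y"
  using bounds by (auto simp: retention_bounds_def max_def dest: spec[of _ y])

lemma R_integrable: "integrable \<nu> R" "integrable \<nu> (\<lambda>y. (R y)\<^sup>2)" "integrable \<nu> (\<lambda>y. y * R y)"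
proof -
  note [measurable] = R
  show "integrable \<nu> R"
    by (rule integrable_by_power4[where A = 1])
      (use R_bounds power_le_power4(1) in \<open>auto intro: order_trans\<close>)
  show "integrable \<nu> (\<lambda>y. (R y)\<^sup>2)"
  proof (rule integrable_by_power4[where A = 1])
    fix y :: real assume "0 < y"
    then have "(R y)\<^sup>2 \<le> y\<^sup>2" using R_bounds by (intro power_mono) auto
    then show "\<bar>(R y)\<^sup>2\<bar> \<le> 1 * (1 + y ^ 4)" using power_le_power4(2)[OF \<open>0 < y\<close>] by simp
  qed measurable
  show "integrable \<nu> (\<lambda>y. y * R y)"
  proof (rule integrable_by_power4[where A = 1])
    fix y :: real assume y: "0 < y"
    then have "y * R y \<le> y * y" using R_bounds by (intro mult_left_mono) auto
    also have "\<dots> \<le> 1 + y ^ 4" using power_le_power4(2)[OF y] by (simp add: power2_eq_square)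
    finally show "\<bar>y * R y\<bar> \<le> 1 * (1 + y ^ 4)" using y R_bounds(1)[of y] by (simp add: abs_of_nonneg)
  qed measurable
qed

lemma drift_eq:
  "drift \<nu> lam \<theta> \<eta> c R = - kappa \<nu> lam \<theta> \<eta> c +
    lam * ((1 + \<theta>) * (LINT y|\<nu>. R y) + \<eta> * (LINT y|\<nu>. y * R y) - \<eta> / 2 * (LINT y|\<nu>. (R y)\<^sup>2))"
proof -
  have 1: "(LINT y|\<nu>. y - R y) = (LINT y|\<nu>. y) - (LINT y|\<nu>. R y)"
    using R_integrable integrable_moments by simp
  have "(LINT y|\<nu>. (y - R y)\<^sup>2) = (LINT y|\<nu>. y\<^sup>2 - 2 * (y * R y) + (R y)\<^sup>2)"
    by (rule Bochner_Integration.integral_cong) (auto simp: power2_diff)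
  also have "\<dots> = (LINT y|\<nu>. y\<^sup>2) - 2 * (LINT y|\<nu>. y * R y) + (LINT y|\<nu>. (R y)\<^sup>2)"
    using R_integrable integrable_moments by simp
  finally have 2: "(LINT y|\<nu>. (y - R y)\<^sup>2) = (LINT y|\<nu>. y\<^sup>2) - 2 * (LINT y|\<nu>. y * R y) + (LINT y|\<nu>. (R y)\<^sup>2)" .
  show ?thesis unfolding drift_def kappa_def 1 2 by (simp add: algebra_simps)
qed

text \<open>The loading terms together with \<kappa> are the expanded drift. In this form the
  generator matches what the path gives (drift times derivative) plus what the compensation formula
  gives (mean jump times \<open>lam\<close>).\<close>

lemma generator_eq:
  "generator \<nu> lam \<theta> \<eta> c R u ux x m =
    drift \<nu> lam \<theta> \<eta> c R * ux x m + lam * ((LINT y|\<nu>. u (x - R y) m) - u x m)"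
  unfolding generator_def drift_eq by (simp add: algebra_simps)

lemma drift_le: "drift \<nu> lam \<theta> \<eta> c R \<le> c"
proof -
  have "0 \<le> (LINT y|\<nu>. y - R y)"
    by (rule integral_nonneg_AE) (use AE_pos R_bounds in \<open>auto elim!: eventually_mono\<close>)
  then have "0 \<le> (1 + \<theta>) * lam * (LINT y|\<nu>. y - R y)" using lam theta by simp
  moreover have "0 \<le> \<eta> / 2 * lam * (LINT y|\<nu>. (y - R y)\<^sup>2)" using lam eta by simp
  ultimately show ?thesis unfolding drift_def by linarith
qed

text \<open>Since (R y)^2 \<le> y * R y, the terms added to - \<kappa> are nonnegative. The bound
  uses only the retention bounds, so the drift is bounded also in those scenarios where the net
  profit condition fails.\<close>

lemma drift_ge: "- kappa \<nu> lam \<theta> \<eta> c \<le> drift \<nu> lam \<theta> \<eta> c R"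
proof -
  have "0 \<le> (LINT y|\<nu>. R y)" using R_bounds by simp
  moreover have "(LINT y|\<nu>. (R y)\<^sup>2) \<le> (LINT y|\<nu>. y * R y)"
  proof (rule integral_mono_AE)
    show "AE y in \<nu>. (R y)\<^sup>2 \<le> y * R y"
      using AE_pos by eventually_elim (use R_bounds in \<open>auto simp: power2_eq_square intro!: mult_right_mono\<close>)
  qed (use R_integrable in auto)
  moreover have "0 \<le> (LINT y|\<nu>. (R y)\<^sup>2)" by simp
  ultimately have "0 \<le> (LINT y|\<nu>. R y)" "0 \<le> 2 * (LINT y|\<nu>. y * R y) - (LINT y|\<nu>. (R y)\<^sup>2)"
    by linarith+
  then have "0 \<le> (1 + \<theta>) * (LINT y|\<nu>. R y)" "0 \<le> \<eta> / 2 * (2 * (LINT y|\<nu>. y * R y) - (LINT y|\<nu>. (R y)\<^sup>2))"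
    using theta eta by (auto intro!: mult_nonneg_nonneg)
  then have "0 \<le> (1 + \<theta>) * (LINT y|\<nu>. R y) + \<eta> * (LINT y|\<nu>. y * R y) - \<eta> / 2 * (LINT y|\<nu>. (R y)\<^sup>2)"
    by (simp add: algebra_simps)
  then have "0 \<le> lam * ((1 + \<theta>) * (LINT y|\<nu>. R y) + \<eta> * (LINT y|\<nu>. y * R y) - \<eta> / 2 * (LINT y|\<nu>. (R y)\<^sup>2))"
    using lam by (intro mult_nonneg_nonneg) auto
  then show ?thesis unfolding drift_eq by linarith
qed

lemma drift_pos: "net_profit \<nu> lam \<theta> \<eta> c R \<Longrightarrow> 0 \<le> drift \<nu> lam \<theta> \<eta> c R"
proof -
  assume "net_profit \<nu> lam \<theta> \<eta> c R"
  moreover have "0 \<le> lam * (LINT y|\<nu>. R y)" using lam R_bounds by simp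
  ultimately show ?thesis unfolding net_profit_def by linarith
qed

text \<open>Subtracting the expected retained claims turns the factor 1 + \<theta> into \<theta>,
  and the quadratic term has the right sign to be dropped.\<close>

lemma kappa_less:
  assumes "net_profit \<nu> lam \<theta> \<eta> c R"
  shows "kappa \<nu> lam \<theta> \<eta> c \<le> lam * (LINT y|\<nu>. (\<theta> + \<eta> * y) * R y)"
proof -
  have "(LINT y|\<nu>. (\<theta> + \<eta> * y) * R y) = \<theta> * (LINT y|\<nu>. R y) + \<eta> * (LINT y|\<nu>. y * R y)"
    using R_integrable by (simp add: distrib_right mult.assoc)
  moreover have "0 \<le> lam * (\<eta> / 2 * (LINT y|\<nu>. (R y)\<^sup>2))" using lam eta by simp
  ultimately show ?thesis
    using assms unfolding net_profit_def drift_eq by (simp add: algebra_simps)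
qed

end

lemma c_pos: "0 < c"
proof -
  have "0 \<le> (LINT y|\<nu>. y)" by (rule integral_nonneg_AE) (use AE_pos in \<open>auto elim!: eventually_mono\<close>)
  then have "0 \<le> lam * (LINT y|\<nu>. y)" using lam by simp
  then show ?thesis using c_lower by linarith
qed

text \<open>An admissible retention function cannot be close to zero, since full reinsurance has drift
  \<open>- \<kappa>\<close>; quantitatively by AM-GM applied to \<open>((\<theta> + \<eta> y) (1 + y)) * min (R y) 1\<close>.\<close>

lemma retention_bounded_below:
  "\<exists>q>0. \<forall>R. admissible_retention \<nu> lam \<theta> \<eta> c R \<longrightarrow> q \<le> (LINT y|\<nu>. (min (R y) 1)\<^sup>2)"
proof -
  define G where "G y = (\<theta> + \<eta> * y) * (1 + y)" for y :: real
  define \<kappa> where "\<kappa> = kappa \<nu> lam \<theta> \<eta> c"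
  have kpos: "0 < \<kappa>" using c_upper by (simp add: \<kappa>_def kappa_def)
  have Gint: "integrable \<nu> (\<lambda>y. (G y)\<^sup>2)"
  proof (rule integrable_by_power4[where A = "16 * (\<theta> + \<eta>)\<^sup>2"])
    show "(\<lambda>y. (G y)\<^sup>2) \<in> borel_measurable borel" unfolding G_def by measurable
    fix y :: real assume y: "0 < y"
    have "G y \<le> ((\<theta> + \<eta>) * (1 + y)) * (1 + y)"
      unfolding G_def using y theta eta by (intro mult_right_mono) (auto simp: algebra_simps)
    then have "(G y)\<^sup>2 \<le> ((\<theta> + \<eta>) * (1 + y) * (1 + y))\<^sup>2"
      using y theta eta by (intro power_mono) (auto simp: G_def)
    also have "\<dots> = (\<theta> + \<eta>)\<^sup>2 * (1 + y) ^ 4"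
      by (simp add: power_mult_distrib power2_eq_square power4_eq_xxxx mult_ac)
    also have "\<dots> \<le> (\<theta> + \<eta>)\<^sup>2 * (16 * (1 + y ^ 4))"
    proof (rule mult_left_mono)
      have "(1 + y) ^ 4 = 1 + 4 * y + 6 * y ^ 2 + 4 * y ^ 3 + y ^ 4"
        by (simp add: power4_eq_xxxx power2_eq_square power3_eq_cube algebra_simps)
      moreover have "a \<le> 16 * (1 + d)"
        if "a = 1 + 4 * y + 6 * b + 4 * c + d" "y \<le> 1 + d" "b \<le> 1 + d" "c \<le> 1 + d" "0 \<le> d" for a b c d :: real
        using that by argo
      ultimately show "(1 + y) ^ 4 \<le> 16 * (1 + y ^ 4)"
        using power_le_power4[OF y] zero_le_power[OF less_imp_le[OF y], of 4] by blast
    qed simp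
    finally show "\<bar>(G y)\<^sup>2\<bar> \<le> 16 * (\<theta> + \<eta>)\<^sup>2 * (1 + y ^ 4)" by (simp add: algebra_simps)
  qed
  define A where "A = (LINT y|\<nu>. (G y)\<^sup>2)"
  have A0: "0 \<le> A" by (simp add: A_def)
  \<comment> \<open>The AM-GM weight is chosen such that lam * s * A \<le> \<kappa>: the part with
    \<open>G\<close> absorbs at most half of \<kappa>, and the truncated second moment has to supply
    the rest. The summand 1 covers A = 0.\<close>
  define s where "s = \<kappa> / (lam * (A + 1))"
  have s: "0 < s" using kpos lam A0 by (simp add: s_def)
  define q where "q = s * \<kappa> / lam"
  have "q \<le> (LINT y|\<nu>. (min (R y) 1)\<^sup>2)" if adm: "admissible_retention \<nu> lam \<theta> \<eta> c R" for R
  proof -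
    have R[measurable]: "R \<in> borel_measurable borel" and b: "retention_bounds R" and np: "net_profit \<nu> lam \<theta> \<eta> c R"
      using adm by (auto simp: admissible_retention_def)
    note Rb = R_bounds[OF R b]
    have mint: "integrable \<nu> (\<lambda>y. (min (R y) 1)\<^sup>2)"
      by (rule integrable_const_bound[where B = 1])
        (use Rb in \<open>auto intro!: borel_nu power_le_one\<close>)
    have "\<kappa> \<le> lam * (LINT y|\<nu>. (\<theta> + \<eta> * y) * R y)" using kappa_less[OF R b np] by (simp add: \<kappa>_def)
    also have "(LINT y|\<nu>. (\<theta> + \<eta> * y) * R y) \<le> (LINT y|\<nu>. (s * (G y)\<^sup>2 + (min (R y) 1)\<^sup>2 / s) / 2)"
    proof (rule integral_mono_AE)
      show "integrable \<nu> (\<lambda>y. (\<theta> + \<eta> * y) * R y)"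
        using R_integrable[OF R b] by (simp add: distrib_right mult.assoc)
      show "integrable \<nu> (\<lambda>y. (s * (G y)\<^sup>2 + (min (R y) 1)\<^sup>2 / s) / 2)" using Gint mint by simp
      show "AE y in \<nu>. (\<theta> + \<eta> * y) * R y \<le> (s * (G y)\<^sup>2 + (min (R y) 1)\<^sup>2 / s) / 2"
        using AE_pos
      proof eventually_elim
        case (elim y)
        define z where "z = min (R y) 1"
        \<comment> \<open>As R y \<le> y, truncation at 1 costs at most the factor 1 + y.\<close>
        have "R y \<le> (1 + y) * z"
        proof (cases "R y \<le> 1")
          case True
          then show ?thesis using elim Rb(1)[of y] by (simp add: z_def algebra_simps)
        next
          case False
          then show ?thesis using elim Rb(2)[of y] by (simp add: z_def)
        qed
        then have "(\<theta> + \<eta> * y) * R y \<le> (\<theta> + \<eta> * y) * ((1 + y) * z)"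
          using elim theta eta by (intro mult_left_mono) auto
        also have "\<dots> = G y * z" by (simp add: G_def)
        also have "\<dots> \<le> (s * (G y)\<^sup>2 + z\<^sup>2 / s) / 2"
        proof -
          have "0 \<le> (s * G y - z)\<^sup>2 / s" using s by simp
          also have "\<dots> = s * (G y)\<^sup>2 - 2 * (G y * z) + z\<^sup>2 / s"
            using s by (simp add: power2_eq_square field_simps)
          finally show ?thesis by simp
        qed
        finally show ?case unfolding z_def .
      qed
    qed
    also have "(LINT y|\<nu>. (s * (G y)\<^sup>2 + (min (R y) 1)\<^sup>2 / s) / 2) =
        (s * A + (LINT y|\<nu>. (min (R y) 1)\<^sup>2) / s) / 2"
      using Gint mint by (simp add: A_def)
    finally have *: "\<kappa> \<le> lam * ((s * A + (LINT y|\<nu>. (min (R y) 1)\<^sup>2) / s) / 2)" using lam by simp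
    have "lam * (s * A) \<le> lam * (s * (A + 1))" using lam s by simp
    also have "\<dots> = \<kappa>" using lam A0 by (simp add: s_def)
    finally have "\<kappa> \<le> lam * (LINT y|\<nu>. (min (R y) 1)\<^sup>2) / s" using * by (simp add: algebra_simps)
    then show ?thesis using lam s by (simp add: q_def field_simps)
  qed
  moreover have "0 < q" using s kpos lam by (simp add: q_def)
  ultimately show ?thesis by blast
qed

text \<open>Without reinsurance the net profit condition is \<open>c_lower\<close>. Full retention
  later shows that the infimum over strategies runs over a nonempty set.\<close>

lemma full_retention_admissible: "admissible_retention \<nu> lam \<theta> \<eta> c (max 0)"
proof -
  have eq: "AE y in \<nu>. max 0 y = y" using AE_pos by eventually_elim simp
  have m: "(max 0 :: real \<Rightarrow> real) \<in> borel_measurable borel" by measurable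
  have "(LINT y|\<nu>. y - max 0 y) = 0" "(LINT y|\<nu>. (y - max 0 y)\<^sup>2) = 0"
    by (rule integral_eq_zero_AE; use eq in \<open>auto elim!: eventually_mono\<close>)+
  moreover have "(LINT y|\<nu>. max 0 y) = (LINT y|\<nu>. y)"
    by (rule integral_cong_AE) (use eq in \<open>auto intro!: borel_nu\<close>)
  ultimately have "net_profit \<nu> lam \<theta> \<eta> c (max 0)" using c_lower by (simp add: net_profit_def drift_def)
  then show ?thesis using m by (simp add: admissible_retention_def retention_bounds_def)
qed

text \<open>The cutoff bounds the exponential below the domain, where a claim may throw the surplus
  arbitrarily far, and leaves it unchanged for x \<ge> 0.\<close>

definition lyap :: "real \<Rightarrow> real \<Rightarrow> real \<Rightarrow> real" where "lyap g x m = exp (- g * max x (- 1))"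

text \<open>Of each jump only min (R y) 1 is used; from x \<ge> 0 it does not pass the cutoff. The
  quadratic Taylor bound of exp then gives a gain of lam * g^2 * q / 2, the drift costs at most g *
  c, and by \<open>gq\<close> at least g * c remains. The common factor exp (- g * x) is at least
  exp (- g * n).\<close>

lemma lyap_generator:
  assumes g: "0 < g" and x: "0 \<le> x" "x \<le> n" and q: "q \<le> (LINT y|\<nu>. (min (R y) 1)\<^sup>2)"
    and adm: "admissible_retention \<nu> lam \<theta> \<eta> c R" and gq: "2 * c \<le> lam * g * q / 2"
  shows "exp (- g * n) * (g * c) \<le> generator \<nu> lam \<theta> \<eta> c R (lyap g) (\<lambda>x m. - g * exp (- g * x)) x m"
proof -
  have R[measurable]: "R \<in> borel_measurable borel" and b: "retention_bounds R"
    using adm by (auto simp: admissible_retention_def)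
  note Rb = R_bounds[OF R b]
  have mint: "integrable \<nu> (\<lambda>y. (min (R y) 1)\<^sup>2)"
    by (rule integrable_const_bound[where B = 1])
      (use Rb in \<open>auto intro!: borel_nu power_le_one\<close>)
  have lint: "integrable \<nu> (\<lambda>y. lyap g (x - R y) m)"
  proof (rule integrable_const_bound[where B = "exp g"])
    show "(\<lambda>y. lyap g (x - R y) m) \<in> borel_measurable \<nu>" unfolding lyap_def by (rule borel_nu) measurable
    show "AE y in \<nu>. norm (lyap g (x - R y) m) \<le> exp g"
    proof (rule AE_I2)
      fix y
      have "g * (- 1) \<le> g * max (x - R y) (- 1)" using g by (intro mult_left_mono) auto
      then show "norm (lyap g (x - R y) m) \<le> exp g" by (simp add: lyap_def)
    qed
  qed
  have "(LINT y|\<nu>. exp (- g * x) * (1 + g\<^sup>2 / 2 * (min (R y) 1)\<^sup>2)) \<le> (LINT y|\<nu>. lyap g (x - R y) m)"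
  proof (rule integral_mono)
    fix y
    define z where "z = min (R y) 1"
    have z: "0 \<le> z" "z \<le> 1" "z \<le> R y" using Rb(1)[of y] by (auto simp: z_def)
    have "1 + g\<^sup>2 / 2 * z\<^sup>2 \<le> 1 + g * z + (g * z)\<^sup>2 / 2" using g z by (simp add: power_mult_distrib)
    also have "\<dots> \<le> exp (g * z)" using g z by (intro exp_lower_Taylor_quadratic) simp
    finally have "exp (- g * x) * (1 + g\<^sup>2 / 2 * z\<^sup>2) \<le> exp (- g * x) * exp (g * z)" by simp
    also have "\<dots> = exp (g * (z - x))" by (simp add: exp_add[symmetric] algebra_simps)
    also have "\<dots> \<le> lyap g (x - R y) m"
    proof -
      have "max (x - R y) (- 1) \<le> x - z" using z x by simp
      then have "g * max (x - R y) (- 1) \<le> g * (x - z)" using g by (intro mult_left_mono) auto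
      then show ?thesis by (simp add: lyap_def algebra_simps)
    qed
    finally show "exp (- g * x) * (1 + g\<^sup>2 / 2 * (min (R y) 1)\<^sup>2) \<le> lyap g (x - R y) m" unfolding z_def .
  qed (use mint lint in auto)
  moreover have "(LINT y|\<nu>. exp (- g * x) * (1 + g\<^sup>2 / 2 * (min (R y) 1)\<^sup>2)) =
      exp (- g * x) * (1 + g\<^sup>2 / 2 * (LINT y|\<nu>. (min (R y) 1)\<^sup>2))"
    using mint by (simp add: prob_space[unfolded space_eq_univ])
  moreover have "exp (- g * x) * (1 + g\<^sup>2 / 2 * q) \<le> exp (- g * x) * (1 + g\<^sup>2 / 2 * (LINT y|\<nu>. (min (R y) 1)\<^sup>2))"
    using q by (intro mult_left_mono add_left_mono) auto
  ultimately have "exp (- g * x) * (1 + g\<^sup>2 / 2 * q) \<le> (LINT y|\<nu>. lyap g (x - R y) m)" by linarith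
  moreover have "lyap g x m = exp (- g * x)" using x by (simp add: lyap_def)
  ultimately have jump: "exp (- g * x) * (g\<^sup>2 / 2 * q) \<le> (LINT y|\<nu>. lyap g (x - R y) m) - lyap g x m"
    unfolding distrib_left mult_1_right by linarith
  have "exp (- g * n) * (g * c) \<le> exp (- g * x) * (g * c)"
    using g x c_pos by (intro mult_right_mono) auto
  also have "\<dots> \<le> exp (- g * x) * (g * (lam * g * q / 2 - c))"
    using gq g by (intro mult_left_mono) auto
  also have "\<dots> = c * (- g * exp (- g * x)) + lam * (exp (- g * x) * (g\<^sup>2 / 2 * q))"
    by (simp add: power2_eq_square algebra_simps)
  also have "\<dots> \<le> drift \<nu> lam \<theta> \<eta> c R * (- g * exp (- g * x)) +
      lam * ((LINT y|\<nu>. lyap g (x - R y) m) - lyap g x m)"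
    using jump lam g drift_le[OF R b] by (intro add_mono mult_left_mono mult_right_mono_neg) auto
  finally show ?thesis unfolding generator_eq[OF R b] .
qed

lemma lyap_smooth: "C11_on (domain_D \<alpha>) (lyap g) (\<lambda>x m. - g * exp (- g * x)) (\<lambda>x m. 0)"
  unfolding C11_on_def
proof (intro conjI ballI)
  show "continuous_on (domain_D \<alpha>) (\<lambda>(x, m). lyap g x m)"
    unfolding lyap_def case_prod_unfold by (intro continuous_intros)
  show "continuous_on (domain_D \<alpha>) (\<lambda>(x, m). - g * exp (- g * x))"
    unfolding case_prod_unfold by (intro continuous_intros)
  show "continuous_on (domain_D \<alpha>) (\<lambda>(x, m). 0::real)" by (simp add: case_prod_unfold)
  fix z assume z: "z \<in> domain_D \<alpha>"
  obtain x m where xm: "z = (x, m)" by (cases z)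
  have "((\<lambda>x'. exp (- g * x')) has_real_derivative - g * exp (- g * x)) (at x within {x'. (x', m) \<in> domain_D \<alpha>})"
    by (auto intro!: derivative_eq_intros)
  then have "((\<lambda>x'. lyap g x' m) has_real_derivative - g * exp (- g * x)) (at x within {x'. (x', m) \<in> domain_D \<alpha>})"
    by (rule has_field_derivative_transform_within[OF _ zero_less_one])
      (use z in \<open>auto simp: xm domain_D_def lyap_def\<close>)
  moreover have "((\<lambda>m'. lyap g x m') has_real_derivative 0) (at m within {m'. (x, m') \<in> domain_D \<alpha>})"
    by (simp add: lyap_def)
  ultimately show "case z of (x, m) \<Rightarrow>
      ((\<lambda>x'. lyap g x' m) has_real_derivative - g * exp (- g * x)) (at x within {x'. (x', m) \<in> domain_D \<alpha>}) \<and>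
      ((\<lambda>m'. lyap g x m') has_real_derivative 0) (at m within {m'. (x, m') \<in> domain_D \<alpha>})"
    unfolding xm by simp
qed

end

text \<open>Close before s there is no claim, so the path rises towards Xl s and the left limit
  inherits the drawdown bound that \<open>active\<close> provides at an earlier time.\<close>

lemma (in smooth_surplus_path) active_in_domain:
  assumes act: "active s" and s: "0 < s"
  shows "(Xl s, Ml s) \<in> domain_D \<alpha>" "Ml s < n"
proof -
  show "Ml s < n" using act by (simp add: active_def)
  obtain p where p: "0 \<le> p" "p < s" and c: "\<And>a r. p \<le> a \<Longrightarrow> a \<le> r \<Longrightarrow> r < s \<Longrightarrow> N r = N a"
    using N_left[OF s] by blast
  have const: "N r = N p" if "p \<le> r" "r < s" for r by (rule c[OF order_refl that])
  have Ml: "Ml s = max (Xl s) (M p)" by (rule Ml_between[OF p const p(2) order_refl])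
  have Xp: "X p = X p + (LINT u:{p..p}|lborel. d u)" by (rule X_incr[OF p(1)]) auto
  have "X p \<le> Xl s"
    using Xl_between[OF p const p(2) order_refl] integral_d_mono[OF p(1) order_refl less_imp_le[OF p(2)]] Xp by linarith
  moreover have "\<alpha> * M p \<le> X p" using act p by (auto simp: active_iff)
  moreover have Mp: "0 \<le> M p" using M_ge(1)[OF p(1)] m_nonneg by simp
  moreover from Mp have "0 \<le> \<alpha> * M p" using alpha by simp
  ultimately have low: "\<alpha> * M p \<le> Xl s" "0 \<le> Xl s" by linarith+
  then have "\<alpha> * Xl s \<le> Xl s" using alpha by (auto intro!: mult_left_le_one_le)
  with low Mp show "(Xl s, Ml s) \<in> domain_D \<alpha>" unfolding Ml by (auto simp: in_domain_iff max_def)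
qed

section \<open>The controlled surplus as a predictable process\<close>

context claims
begin

lemma measurable_random_sum:
  fixes f :: "nat \<Rightarrow> 'a \<Rightarrow> real"
  assumes "\<And>i. f i \<in> borel_measurable M" "k \<in> measurable M (count_space UNIV)"
  shows "(\<lambda>\<omega>. \<Sum>i<k \<omega>. f i \<omega>) \<in> borel_measurable M"
  by (rule measurable_compose_countable[where f = "\<lambda>j \<omega>. \<Sum>i<j. f i \<omega>", OF _ assms(2)])
    (use assms(1) in measurable)

text \<open>A quantity known at q and switched on strictly after q is predictable. Left limits and
  running suprema are assembled from such pieces.\<close>

lemma pred_after:
  assumes f: "f \<in> borel_measurable (aug q)" and q: "0 \<le> q"
  shows "(\<lambda>(s, \<omega>). if q < s then f \<omega> else (a::real)) \<in> borel_measurable pred"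
proof (rule measurableI)
  fix B :: "real set" assume B: "B \<in> sets borel"
  have top: "space P \<in> sets (aug q)" using sets.top[of "aug q"] by (simp add: space_aug)
  have fB: "f -` B \<inter> space P \<in> sets (aug q)" using measurable_sets[OF f B] by (simp add: space_aug)
  have "(\<lambda>(s, \<omega>). if q < s then f \<omega> else a) -` B \<inter> space pred =
      {q<..} \<times> (f -` B \<inter> space P) \<union> (if a \<in> B then space pred - {q<..} \<times> space P else {})"
    using q by (auto simp: space_pred split: if_splits)
  also have "\<dots> \<in> sets pred"
    using pred_Ioi[OF q fB] pred_Ioi[OF q top] by auto
  finally show "(\<lambda>(s, \<omega>). if q < s then f \<omega> else a) -` B \<inter> space pred \<in> sets pred" .
qed simp

lemma pred_time: "fst \<in> borel_measurable pred"
  unfolding borel_measurable_iff_greater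
proof (intro allI)
  fix a :: real
  have top: "space P \<in> sets (aug a)" for a using sets.top[of "aug a"] by (simp add: space_aug)
  show "{w \<in> space pred. a < fst w} \<in> sets pred"
  proof (cases "0 \<le> a")
    case True
    then have "{w \<in> space pred. a < fst w} = {a<..} \<times> space P" by (auto simp: space_pred)
    then show ?thesis using pred_Ioi[OF True top] by simp
  next
    case False
    then have "{w \<in> space pred. a < fst w} = space pred" by (auto simp: space_pred)
    then show ?thesis by simp
  qed
qed

text \<open>At level k the last dyadic before s has a natural number as predictable index, so each
  approximation patches together countably many processes from \<open>pred_after\<close>. At s = 0
  no such dyadic lies strictly before s, which produces the default 0.\<close>

lemma pred_left_dyadic:
  fixes Z :: "real \<Rightarrow> 'a \<Rightarrow> real"
  assumes Z: "\<And>q. 0 \<le> q \<Longrightarrow> Z q \<in> borel_measurable (aug q)"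
  shows "(\<lambda>(s, \<omega>). if 0 < s then lim (\<lambda>k. Z ((of_int \<lceil>2 ^ k * s\<rceil> - 1) / 2 ^ k) \<omega>) else 0) \<in> borel_measurable pred"
proof -
  note [measurable] = pred_time
  define j :: "nat \<Rightarrow> real \<times> 'a \<Rightarrow> nat" where "j k z = nat (\<lceil>2 ^ k * fst z\<rceil> - 1)" for k z
  have j: "j k \<in> measurable pred (count_space UNIV)" for k unfolding j_def by measurable
  define f where "f k i = (\<lambda>(s, \<omega>). if real i / 2 ^ k < s then Z (real i / 2 ^ k) \<omega> else 0)" for k i :: nat
  have f: "f k i \<in> borel_measurable pred" for k i unfolding f_def by (rule pred_after[OF Z]) auto
  have "(\<lambda>z. lim (\<lambda>k. f k (j k z) z)) \<in> borel_measurable pred"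
    by (rule borel_measurable_lim_metric, rule measurable_compose_countable[OF f j])
  moreover have "lim (\<lambda>k. f k (j k z) z) =
      (case z of (s, \<omega>) \<Rightarrow> if 0 < s then lim (\<lambda>k. Z ((of_int \<lceil>2 ^ k * s\<rceil> - 1) / 2 ^ k) \<omega>) else 0)"
    if "z \<in> space pred" for z
  proof -
    obtain s \<omega> where z: "z = (s, \<omega>)" "0 \<le> s" using \<open>z \<in> space pred\<close> by (auto simp: space_pred)
    show ?thesis
    proof (cases "0 < s")
      case True
      have "f k (j k z) z = Z ((of_int \<lceil>2 ^ k * s\<rceil> - 1) / 2 ^ k) \<omega>" for k
      proof -
        have "0 < 2 ^ k * s" using True by simp
        then have "0 < \<lceil>2 ^ k * s\<rceil>" by simp
        then have r: "real (j k z) = of_int \<lceil>2 ^ k * s\<rceil> - 1" by (simp add: j_def z)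
        have "of_int \<lceil>2 ^ k * s\<rceil> - 1 < 2 ^ k * s" by linarith
        then have "(of_int \<lceil>2 ^ k * s\<rceil> - 1) / 2 ^ k < s"
          by (subst pos_divide_less_eq) (auto simp: mult.commute[of s])
        then show ?thesis by (simp add: f_def z(1) r[unfolded z(1)])
      qed
      then show ?thesis using True by (simp add: z)
    next
      case False
      then have "s = 0" using z by simp
      then have "f k (j k z) z = 0" for k by (auto simp: f_def z divide_less_0_iff)
      then show ?thesis using \<open>s = 0\<close> by (simp add: z)
    qed
  qed
  ultimately show ?thesis by (simp cong: measurable_cong)
qed

text \<open>Stopping the clock at q makes every predictable process jointly measurable in time and
  the past of q, i.e. progressively measurable. Its time integral up to q is then adapted by
  Fubini.\<close>

lemma clamp_adapted:
  assumes q: "0 \<le> q"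
  shows "(\<lambda>(s, \<omega>). (max 0 (min s q), \<omega>)) \<in> measurable (borel \<Otimes>\<^sub>M aug q) pred"
proof (rule measurable_predI)
  show "(case z of (s, \<omega>) \<Rightarrow> (max 0 (min s q), \<omega>)) \<in> {0..} \<times> space P" if "z \<in> space (borel \<Otimes>\<^sub>M aug q)" for z
    using that by (auto simp: space_pair_measure space_aug)
  show "(\<lambda>(s, \<omega>). (max 0 (min s q), \<omega>)) -` ({0} \<times> A) \<inter> space (borel \<Otimes>\<^sub>M aug q) \<in> sets (borel \<Otimes>\<^sub>M aug q)"
    if "A \<in> sets (aug 0)" for A
  proof -
    have A: "A \<in> sets (aug q)" using that sets_aug_mono[OF q] by auto
    have "(\<lambda>(s, \<omega>). (max 0 (min s q), \<omega>)) -` ({0} \<times> A) \<inter> space (borel \<Otimes>\<^sub>M aug q) = {s. max 0 (min s q) = 0} \<times> A"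
      using sets.sets_into_space[OF A] by (auto simp: space_pair_measure)
    moreover have "{s. max 0 (min s q) = 0} \<in> sets borel" by measurable
    ultimately show ?thesis using A by simp
  qed
  show "(\<lambda>(s, \<omega>). (max 0 (min s q), \<omega>)) -` ({a<..b} \<times> A) \<inter> space (borel \<Otimes>\<^sub>M aug q) \<in> sets (borel \<Otimes>\<^sub>M aug q)"
    if "0 \<le> a" "A \<in> sets (aug a)" for a b A
  proof (cases "a \<le> q")
    case True
    have A: "A \<in> sets (aug q)" using that sets_aug_mono[OF True] by auto
    have "(\<lambda>(s, \<omega>). (max 0 (min s q), \<omega>)) -` ({a<..b} \<times> A) \<inter> space (borel \<Otimes>\<^sub>M aug q) =
        {s. max 0 (min s q) \<in> {a<..b}} \<times> A"
      using sets.sets_into_space[OF A] by (auto simp: space_pair_measure)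
    moreover have "{s. max 0 (min s q) \<in> {a<..b}} \<in> sets borel" by measurable
    ultimately show ?thesis using A by simp
  next
    case False
    then have "(\<lambda>(s, \<omega>). (max 0 (min s q), \<omega>)) -` ({a<..b} \<times> A) \<inter> space (borel \<Otimes>\<^sub>M aug q) = {}"
      using q by (auto simp: max_def min_def split: if_splits)
    then show ?thesis by (simp only: sets.empty_sets)
  qed
qed

lemma integral_time_adapted:
  assumes f: "(\<lambda>(s, \<omega>). f s \<omega> :: real) \<in> borel_measurable pred" and q: "0 \<le> q"
  shows "(\<lambda>\<omega>. LINT s:{0..q}|lborel. f s \<omega>) \<in> borel_measurable (aug q)"
proof -
  have "(\<lambda>z. (\<lambda>(s, \<omega>). f s \<omega>) ((\<lambda>(s, \<omega>). (max 0 (min s q), \<omega>)) z)) \<in> borel_measurable (borel \<Otimes>\<^sub>M aug q)"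
    by (rule measurable_compose[OF clamp_adapted[OF q] f])
  then have [measurable]: "(\<lambda>(s, \<omega>). f (max 0 (min s q)) \<omega>) \<in> borel_measurable (borel \<Otimes>\<^sub>M aug q)"
    by (simp add: case_prod_unfold)
  have "(\<lambda>(\<omega>, s). indicator {0..q} s *\<^sub>R f (max 0 (min s q)) \<omega>) \<in> borel_measurable (aug q \<Otimes>\<^sub>M lborel)"
    by measurable
  then have "(\<lambda>\<omega>. \<integral>s. indicator {0..q} s *\<^sub>R f (max 0 (min s q)) \<omega> \<partial>lborel) \<in> borel_measurable (aug q)"
    by (rule lborel.borel_measurable_lebesgue_integral)
  also have "(\<lambda>\<omega>. \<integral>s. indicator {0..q} s *\<^sub>R f (max 0 (min s q)) \<omega> \<partial>lborel) = (\<lambda>\<omega>. LINT s:{0..q}|lborel. f s \<omega>)"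
    unfolding set_lebesgue_integral_def
    by (intro ext Bochner_Integration.integral_cong refl) (auto simp: indicator_def)
  finally show ?thesis .
qed

lemma pred_section_integrable:
  assumes f: "(\<lambda>(s, \<omega>). f s \<omega> :: real) \<in> borel_measurable pred" and \<omega>: "\<omega> \<in> space P"
    and b: "\<And>s. 0 \<le> s \<Longrightarrow> \<bar>f s \<omega>\<bar> \<le> B"
  shows "set_integrable lborel {0..t} (\<lambda>s. f s \<omega>)"
proof -
  have "(\<lambda>s. (s, \<omega>)) \<in> measurable borel (borel \<Otimes>\<^sub>M P)" using \<omega> by measurable
  from measurable_compose[OF measurable_compose[OF this clamp_measurable[OF zero_less_one]] f]
  have m: "(\<lambda>s. f (max 0 s) \<omega>) \<in> borel_measurable borel" by simp
  have "set_integrable lborel {0..t} (\<lambda>s. f (max 0 s) \<omega>)" unfolding set_integrable_def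
  proof (rule integrableI_bounded_set_indicator[where B = B])
    show "AE s in lborel. s \<in> {0..t} \<longrightarrow> norm (f (max 0 s) \<omega>) \<le> B" by (rule AE_I2) (auto simp: b)
  qed (use m in \<open>auto simp: emeasure_lborel_Icc_eq\<close>)
  then show ?thesis by (subst (asm) set_integrable_cong[OF refl refl]) (auto simp: max_def)
qed

text \<open>The compensation formula for an integrand that ignores the claim size; averaging over
  \<nu> then changes nothing, since \<nu> has mass one.\<close>

lemma pred_integral_integrable:
  assumes f: "(\<lambda>(s, \<omega>). f s \<omega> :: real) \<in> borel_measurable pred" and b: "\<And>s \<omega>. \<bar>f s \<omega>\<bar> \<le> B" and K: "0 < (K::nat)"
  shows "integrable P (\<lambda>\<omega>. LINT s:{0..real K}|lborel. f s \<omega>)"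
proof -
  interpret nu: prob_space \<nu> by (rule prob_space_nu)
  have "integrable P (\<lambda>\<omega>. LINT s:{0..real K}|lborel. (\<integral>y. (\<lambda>z. f (fst (fst z)) (snd (fst z))) ((s, \<omega>), y) \<partial>\<nu>))"
  proof (rule compensation(2)[OF K])
    show "(\<lambda>z. f (fst (fst z)) (snd (fst z))) \<in> borel_measurable (pred \<Otimes>\<^sub>M borel)"
      using measurable_compose[OF measurable_fst f, of borel] by (simp add: case_prod_unfold)
  qed (use b in auto)
  then show ?thesis by (simp add: nu.prob_space)
qed

end

section \<open>Measurability of the surplus under an admissible strategy\<close>

locale strategy =
  mk: drawdown_market \<nu> \<alpha> lam \<theta> \<eta> c + claims P F \<nu> lam N Y
  for \<nu> \<alpha> lam \<theta> \<eta> c and P :: "'a measure" and F :: "real \<Rightarrow> 'a measure" and N Y +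
  fixes R :: "real \<Rightarrow> 'a \<Rightarrow> real \<Rightarrow> real" and x m :: real
  assumes strat: "admissible_strategy \<nu> lam \<theta> \<eta> c P F R"
begin

lemma R_measurable: "(\<lambda>((t, \<omega>), y). R t \<omega> y) \<in> borel_measurable (pred \<Otimes>\<^sub>M borel)"
proof -
  have "sets (predictable_algebra P F) \<subseteq> sets pred"
  proof -
    let ?G = "{{0} \<times> A | A. A \<in> sets (F 0)} \<union> {{s<..t} \<times> A | s t A. 0 \<le> s \<and> s < t \<and> A \<in> sets (F s)}"
    have sub: "?G \<subseteq> pred_gen" unfolding pred_gen_def using sets_F_aug by blast
    have "sets (predictable_algebra P F) = sigma_sets ({0..} \<times> space P) ?G"
      unfolding predictable_algebra_def using sub pred_gen_sub by (intro sets_measure_of) blast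
    also have "\<dots> \<subseteq> sets pred" unfolding sets_pred by (rule sigma_sets_mono') (rule sub)
    finally show ?thesis .
  qed
  moreover have "space (predictable_algebra P F) = space pred"
    unfolding space_pred unfolding predictable_algebra_def
    using sets.sets_into_space[of _ "F _"] by (subst space_measure_of_conv) (auto simp: space_F)
  ultimately have "(\<lambda>z. z) \<in> measurable pred (predictable_algebra P F)"
    by (auto simp: measurable_def intro: sets.Int_space_eq2[THEN ssubst])
  then have "(\<lambda>z. (fst z, snd z)) \<in> measurable (pred \<Otimes>\<^sub>M borel) (predictable_algebra P F \<Otimes>\<^sub>M (borel :: real measure))"
    by measurable
  moreover have "(\<lambda>((t, \<omega>), y). R t \<omega> y) \<in> borel_measurable (predictable_algebra P F \<Otimes>\<^sub>M borel)"
    using strat unfolding admissible_strategy_def by blast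
  ultimately have "(\<lambda>z. (\<lambda>((t, \<omega>), y). R t \<omega> y) (fst z, snd z)) \<in> borel_measurable (pred \<Otimes>\<^sub>M borel)"
    by (rule measurable_compose)
  then show ?thesis by simp
qed

lemma R_section:
  assumes "0 \<le> s" "\<omega> \<in> space P" shows "R s \<omega> \<in> borel_measurable borel" "retention_bounds (R s \<omega>)"
proof -
  have "(\<lambda>y. ((s, \<omega>), y)) \<in> measurable borel (pred \<Otimes>\<^sub>M borel)"
    using assms by (intro measurable_Pair measurable_const) (auto simp: space_pred)
  from measurable_compose[OF this R_measurable] show "R s \<omega> \<in> borel_measurable borel" by simp
  show "retention_bounds (R s \<omega>)" using strat assms unfolding admissible_strategy_def by blast
qed

definition D :: "real \<Rightarrow> 'a \<Rightarrow> real" where "D s \<omega> = drift \<nu> lam \<theta> \<eta> c (R s \<omega>)"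

lemma D_bounds: "0 \<le> s \<Longrightarrow> \<omega> \<in> space P \<Longrightarrow> D s \<omega> \<le> c"
    "0 \<le> s \<Longrightarrow> \<omega> \<in> space P \<Longrightarrow> - kappa \<nu> lam \<theta> \<eta> c \<le> D s \<omega>"
  unfolding D_def using mk.drift_le[OF R_section] mk.drift_ge[OF R_section] by auto

definition D_bound :: real where "D_bound = \<bar>c\<bar> + \<bar>kappa \<nu> lam \<theta> \<eta> c\<bar>"

lemma D_abs: "0 \<le> s \<Longrightarrow> \<omega> \<in> space P \<Longrightarrow> \<bar>D s \<omega>\<bar> \<le> D_bound"
  using D_bounds[of s \<omega>] by (simp add: D_bound_def)

lemma integral_nu_pred:
  assumes f: "f \<in> borel_measurable (pred \<Otimes>\<^sub>M borel)"
  shows "(\<lambda>z. LINT y|\<nu>. f (z, y) :: real) \<in> borel_measurable pred"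
proof -
  have "f \<in> borel_measurable (pred \<Otimes>\<^sub>M \<nu>)"
    by (subst measurable_cong_sets[OF sets_pair_measure_cong[OF refl sets_nu] refl]) (rule f)
  then show ?thesis using mk.borel_measurable_lebesgue_integral[of "\<lambda>z y. f (z, y)" pred] by simp
qed

lemma D_pred: "(\<lambda>(s, \<omega>). D s \<omega>) \<in> borel_measurable pred"
proof -
  have R': "(\<lambda>z. R (fst (fst z)) (snd (fst z)) (snd z)) \<in> borel_measurable (pred \<Otimes>\<^sub>M borel)"
    using R_measurable by (simp add: case_prod_unfold)
  note [measurable] = R'
  have 1: "(\<lambda>z. LINT y|\<nu>. (\<lambda>z. snd z - R (fst (fst z)) (snd (fst z)) (snd z)) (z, y)) \<in> borel_measurable pred"
    by (rule integral_nu_pred) measurable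
  have 2: "(\<lambda>z. LINT y|\<nu>. (\<lambda>z. (snd z - R (fst (fst z)) (snd (fst z)) (snd z))\<^sup>2) (z, y)) \<in> borel_measurable pred"
    by (rule integral_nu_pred) measurable
  show ?thesis using 1 2 unfolding D_def drift_def case_prod_unfold by simp
qed

text \<open>A claim that never occurs has a junk claim time, while retention bounds are given only
  for nonnegative times. The maximum with 0 secures nonnegative payments for every i, as the path
  locale demands.\<close>

definition V :: "nat \<Rightarrow> 'a \<Rightarrow> real" where "V i \<omega> = R (max 0 (claim_time N i \<omega>)) \<omega> (Y i \<omega>)"

lemma path: "\<omega> \<in> space P \<Longrightarrow> surplus_path (\<lambda>t. N t \<omega>) (\<lambda>i. V i \<omega>) (\<lambda>s. D s \<omega>) c"
proof
  assume \<omega>: "\<omega> \<in> space P"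
  show "N 0 \<omega> = 0" by (rule N_zero[OF \<omega>])
  show "0 \<le> V i \<omega>" for i using R_section(2)[OF _ \<omega>, of "max 0 (claim_time N i \<omega>)"]
    by (simp add: V_def retention_bounds_def)
  show "set_integrable lborel {0..t} (\<lambda>s. D s \<omega>)" for t
    by (rule pred_section_integrable[OF D_pred \<omega>]) (rule D_abs[OF _ \<omega>])
  show "D s \<omega> \<le> c" if "0 \<le> s" for s using D_bounds(1)[OF that \<omega>] .
  show "0 \<le> c" using mk.c_pos by simp
qed (use N_le N_right in auto)

definition X :: "real \<Rightarrow> 'a \<Rightarrow> real" where
  "X t \<omega> = surplus_path.X (\<lambda>t. N t \<omega>) (\<lambda>i. V i \<omega>) (\<lambda>s. D s \<omega>) x t"
definition M :: "real \<Rightarrow> 'a \<Rightarrow> real" where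
  "M t \<omega> = surplus_path.M (\<lambda>t. N t \<omega>) (\<lambda>i. V i \<omega>) (\<lambda>s. D s \<omega>) x m t"
definition Xl :: "real \<Rightarrow> 'a \<Rightarrow> real" where
  "Xl t \<omega> = surplus_path.Xl (\<lambda>t. N t \<omega>) (\<lambda>i. V i \<omega>) (\<lambda>s. D s \<omega>) x t"
definition Ml :: "real \<Rightarrow> 'a \<Rightarrow> real" where
  "Ml t \<omega> = surplus_path.Ml (\<lambda>t. N t \<omega>) (\<lambda>i. V i \<omega>) (\<lambda>s. D s \<omega>) x m t"

lemma X_eq_surplus:
  assumes "\<omega> \<in> space P" "0 \<le> t" shows "X t \<omega> = surplus \<nu> lam \<theta> \<eta> c N Y R x t \<omega>"
proof -
  have "(\<Sum>i<N t \<omega>. V i \<omega>) = (\<Sum>i<N t \<omega>. R (claim_time N i \<omega>) \<omega> (Y i \<omega>))"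
    using claim_time_pos[OF assms] by (intro sum.cong) (auto simp: V_def max_def less_imp_le)
  then show ?thesis unfolding X_def surplus_path.X_def[OF path[OF assms(1)]] surplus_def by (simp add: D_def)
qed

text \<open>Summands are rewritten with \<open>tau\<close> and with sizes set to 0 for claims after
  q. These variables are measurable at q as they stand and agree with the true ones whenever i < N
  q.\<close>

lemma X_adapted:
  assumes q: "0 \<le> q" shows "X q \<in> borel_measurable (aug q)"
proof -
  define v where "v i \<omega> = R (tau q i \<omega>) \<omega> (if i < N q \<omega> then Y i \<omega> else 0)" for i \<omega>
  have v: "v i \<in> borel_measurable (aug q)" for i
  proof -
    have "(\<lambda>\<omega>. ((tau q i \<omega>, \<omega>), if i < N q \<omega> then Y i \<omega> else 0)) \<in> measurable (aug q) (pred \<Otimes>\<^sub>M borel)"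
      by (rule measurable_Pair[OF tau_pair_adapted[OF q] Y_adapted[OF q]])
    from measurable_compose[OF this R_measurable] show ?thesis by (simp add: v_def[abs_def])
  qed
  have "(\<lambda>\<omega>. x + (LINT s:{0..q}|lborel. D s \<omega>) - (\<Sum>i<N q \<omega>. v i \<omega>)) \<in> borel_measurable (aug q)"
    using integral_time_adapted[OF D_pred q] measurable_random_sum[OF v measurable_F_aug[OF N_adapted[OF q]]] by simp
  moreover have "x + (LINT s:{0..q}|lborel. D s \<omega>) - (\<Sum>i<N q \<omega>. v i \<omega>) = X q \<omega>" if \<omega>: "\<omega> \<in> space (aug q)" for \<omega>
  proof -
    have \<omega>: "\<omega> \<in> space P" using \<omega> by (simp add: space_aug)
    have "(\<Sum>i<N q \<omega>. v i \<omega>) = (\<Sum>i<N q \<omega>. V i \<omega>)"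
      using claim_time_pos[OF \<omega> q] by (intro sum.cong) (auto simp: V_def v_def tau_def max_def less_imp_le)
    then show ?thesis unfolding X_def surplus_path.X_def[OF path[OF \<omega>]] by simp
  qed
  ultimately show ?thesis by (simp cong: measurable_cong)
qed

lemma Ml_eq: "\<omega> \<in> space P \<Longrightarrow> Ml s \<omega> = max (SUP q\<in>\<rat> \<inter> {0..}. if q < s then X q \<omega> else x) m"
  unfolding Ml_def X_def by (rule surplus_path.Ml_def[OF path])

lemma Ml_bdd: "\<omega> \<in> space P \<Longrightarrow> bdd_above ((\<lambda>q. if q < s then X q \<omega> else x) ` (\<rat> \<inter> {0..}))"
  unfolding X_def by (rule surplus_path.Ml_bdd[OF path])

lemma countable_nonneg_rat: "countable (\<rat> \<inter> {0::real..})"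
  by (rule countable_Int1[OF countable_rat])

lemma Ml_adapted: "Ml q \<in> borel_measurable (aug q)"
proof -
  have "(\<lambda>\<omega>. SUP r\<in>\<rat> \<inter> {0..}. if r < q then X r \<omega> else x) \<in> borel_measurable (aug q)"
  proof (rule borel_measurable_cSUP[OF countable_nonneg_rat])
    show "(\<lambda>\<omega>. if r < q then X r \<omega> else x) \<in> borel_measurable (aug q)" if "r \<in> \<rat> \<inter> {0..}" for r
      using that measurable_aug_mono[OF X_adapted[of r], of q] by (cases "r < q") auto
  qed (use Ml_bdd in \<open>auto simp: space_aug\<close>)
  then have "(\<lambda>\<omega>. max (SUP r\<in>\<rat> \<inter> {0..}. if r < q then X r \<omega> else x) m) \<in> borel_measurable (aug q)" by simp
  then show ?thesis by (rule measurable_cong[THEN iffD1, rotated]) (auto simp: space_aug Ml_eq)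
qed

lemma Ml_pred: "(\<lambda>(s, \<omega>). Ml s \<omega>) \<in> borel_measurable pred"
proof -
  have "(\<lambda>z. SUP r\<in>\<rat> \<inter> {0..}. case z of (s, \<omega>) \<Rightarrow> if r < s then X r \<omega> else x) \<in> borel_measurable pred"
  proof (rule borel_measurable_cSUP[OF countable_nonneg_rat])
    show "(\<lambda>z. case z of (s, \<omega>) \<Rightarrow> if r < s then X r \<omega> else x) \<in> borel_measurable pred" if "r \<in> \<rat> \<inter> {0..}" for r
      using that by (intro pred_after X_adapted) auto
  qed (use Ml_bdd in \<open>auto simp: space_pred\<close>)
  then have "(\<lambda>z. max (SUP r\<in>\<rat> \<inter> {0..}. case z of (s, \<omega>) \<Rightarrow> if r < s then X r \<omega> else x) m) \<in> borel_measurable pred" by simp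
  then show ?thesis by (rule measurable_cong[THEN iffD1, rotated]) (auto simp: space_pred Ml_eq)
qed

lemma M_adapted:
  assumes q: "0 \<le> q" shows "M q \<in> borel_measurable (aug q)"
proof (cases "q = 0")
  case True
  have "(\<lambda>_. max x m) \<in> borel_measurable (aug q)" by simp
  then show ?thesis
    by (rule measurable_cong[THEN iffD1, rotated])
      (auto simp: True space_aug M_def surplus_path.M_0[OF path])
next
  case False
  have "(\<lambda>\<omega>. max (Ml q \<omega>) (X q \<omega>)) \<in> borel_measurable (aug q)"
    using Ml_adapted X_adapted[OF q] by simp
  then show ?thesis
    by (rule measurable_cong[THEN iffD1, rotated])
      (use False q in \<open>auto simp: space_aug M_def X_def Ml_def surplus_path.M_eq[OF path]\<close>)
qed

lemma Xl_pred: "(\<lambda>(s, \<omega>). if 0 < s then Xl s \<omega> else 0) \<in> borel_measurable pred"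
proof (rule measurable_cong[THEN iffD1, rotated, OF pred_left_dyadic[OF X_adapted]])
  show "(case z of (s, \<omega>) \<Rightarrow> if 0 < s then lim (\<lambda>k. X ((of_int \<lceil>2 ^ k * s\<rceil> - 1) / 2 ^ k) \<omega>) else 0) =
      (case z of (s, \<omega>) \<Rightarrow> if 0 < s then Xl s \<omega> else 0)" if "z \<in> space pred" for z
    using that by (auto simp: space_pred Xl_def X_def surplus_path.Xl_def[OF path])
qed

definition drawdown_event :: "'a set" where
  "drawdown_event = {\<omega>\<in>space P. drawdown_time \<alpha> (surplus \<nu> lam \<theta> \<eta> c N Y R x) m \<omega> < \<infinity>}"

lemma drawdown_event_eq: "drawdown_event = {\<omega> \<in> space P. \<exists>t\<ge>0. X t \<omega> < \<alpha> * M t \<omega>}"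
proof -
  have "running_max (surplus \<nu> lam \<theta> \<eta> c N Y R x) m t \<omega> = M t \<omega>" if "\<omega> \<in> space P" "0 \<le> t" for t \<omega>
  proof -
    have "(SUP s\<in>{0..t}. surplus \<nu> lam \<theta> \<eta> c N Y R x s \<omega>) = (SUP s\<in>{0..t}. X s \<omega>)"
      by (rule SUP_cong) (use X_eq_surplus that in auto)
    then show ?thesis unfolding M_def surplus_path.M_def[OF path[OF that(1)]] running_max_def X_def by simp
  qed
  note rm = this
  have "drawdown_time \<alpha> (surplus \<nu> lam \<theta> \<eta> c N Y R x) m \<omega> < \<infinity> \<longleftrightarrow> (\<exists>t\<ge>0. X t \<omega> < \<alpha> * M t \<omega>)"
    if "\<omega> \<in> space P" for \<omega>
  proof -
    have "drawdown_time \<alpha> (surplus \<nu> lam \<theta> \<eta> c N Y R x) m \<omega> < \<infinity> \<longleftrightarrow>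
        (\<exists>t. 0 \<le> t \<and> surplus \<nu> lam \<theta> \<eta> c N Y R x t \<omega> <
          \<alpha> * running_max (surplus \<nu> lam \<theta> \<eta> c N Y R x) m t \<omega>)"
      unfolding drawdown_time_def Inf_less_iff by auto
    also have "\<dots> \<longleftrightarrow> (\<exists>t. 0 \<le> t \<and> X t \<omega> < \<alpha> * M t \<omega>)"
      by (intro ex_cong1 conj_cong refl) (simp add: rm[OF that] X_eq_surplus[OF that])
    finally show ?thesis .
  qed
  then show ?thesis unfolding drawdown_event_def by blast
qed

lemma drawdown_event_sets: "drawdown_event \<in> sets P"
proof -
  have "drawdown_event = (\<Union>q\<in>\<rat> \<inter> {0..}. {\<omega> \<in> space P. X q \<omega> < \<alpha> * M q \<omega>})"
  proof -
    have "(\<exists>t\<ge>0. X t \<omega> < \<alpha> * M t \<omega>) \<longleftrightarrow> (\<exists>q\<in>\<rat>. 0 \<le> q \<and> X q \<omega> < \<alpha> * M q \<omega>)"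
      if "\<omega> \<in> space P" for \<omega>
      unfolding X_def M_def by (rule surplus_path.drawdown_rational[OF path[OF that] mk.alpha(1)])
    then show ?thesis unfolding drawdown_event_eq by auto
  qed
  also have "\<dots> \<in> sets P"
  proof (rule sets.countable_UN''[OF countable_nonneg_rat])
    fix q :: real assume "q \<in> \<rat> \<inter> {0..}"
    then have [measurable]: "X q \<in> borel_measurable P" "M q \<in> borel_measurable P"
      using measurable_aug_P[OF X_adapted] measurable_aug_P[OF M_adapted] by auto
    show "{\<omega> \<in> space P. X q \<omega> < \<alpha> * M q \<omega>} \<in> sets P" by measurable
  qed
  finally show ?thesis .
qed

text \<open>A copy of \<open>active\<close> outside its locale: that locale presupposes net profit
  and unit jumps, which hold only almost surely, whereas predictability is a statement about all
  scenarios.\<close>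

definition act :: "real \<Rightarrow> real \<Rightarrow> 'a \<Rightarrow> bool" where
  "act n s \<omega> \<longleftrightarrow> 0 < s \<and> (\<forall>q\<in>\<rat>. 0 \<le> q \<and> q < s \<longrightarrow> \<alpha> * M q \<omega> \<le> X q \<omega>) \<and> Ml s \<omega> < n"

lemma act_pred: "{(s, \<omega>) \<in> space pred. act n s \<omega>} \<in> sets pred"
proof -
  note [measurable] = pred_time Ml_pred
  have 1: "{z \<in> space pred. 0 < fst z \<and> (case z of (s, \<omega>) \<Rightarrow> Ml s \<omega>) < n} \<in> sets pred" by measurable
  have 2: "(\<Union>q\<in>\<rat> \<inter> {0..}. {q<..} \<times> {\<omega> \<in> space P. X q \<omega> < \<alpha> * M q \<omega>}) \<in> sets pred"
  proof (rule sets.countable_UN''[OF countable_nonneg_rat])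
    fix q :: real assume q: "q \<in> \<rat> \<inter> {0..}"
    then have [measurable]: "X q \<in> borel_measurable (aug q)" "M q \<in> borel_measurable (aug q)"
      using X_adapted M_adapted by auto
    have "{\<omega> \<in> space (aug q). X q \<omega> < \<alpha> * M q \<omega>} \<in> sets (aug q)" by measurable
    then show "{q<..} \<times> {\<omega> \<in> space P. X q \<omega> < \<alpha> * M q \<omega>} \<in> sets pred"
      using q by (intro pred_Ioi) (auto simp: space_aug)
  qed
  have "{(s, \<omega>) \<in> space pred. act n s \<omega>} =
      {z \<in> space pred. 0 < fst z \<and> (case z of (s, \<omega>) \<Rightarrow> Ml s \<omega>) < n} -
      (\<Union>q\<in>\<rat> \<inter> {0..}. {q<..} \<times> {\<omega> \<in> space P. X q \<omega> < \<alpha> * M q \<omega>})"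
    by (auto simp: act_def space_pred not_less)
  then show ?thesis using 1 2 by auto
qed

end

section \<open>The verification argument\<close>

lemma closed_domain_D: "closed (domain_D \<alpha>)"
proof -
  have "domain_D \<alpha> = {p. 0 \<le> fst p} \<inter> {p. 0 \<le> snd p} \<inter> {p. \<alpha> * snd p \<le> fst p} \<inter> {p. fst p \<le> snd p}"
    by (auto simp: domain_D_def)
  then show ?thesis by (auto intro!: closed_Int closed_Collect_le continuous_intros)
qed

lemma compact_domain_slice: "compact (domain_D \<alpha> \<inter> {p. snd p \<le> n})"
proof -
  have "domain_D \<alpha> \<inter> {p. snd p \<le> n} = ({0..n} \<times> {0..n}) \<inter> (domain_D \<alpha> \<inter> {p. snd p \<le> n})"
    by (auto simp: domain_D_def)
  moreover have "closed (domain_D \<alpha> \<inter> {p. snd p \<le> n})"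
    by (intro closed_Int closed_domain_D closed_Collect_le continuous_intros)
  moreover have "compact ({0..n} \<times> {0..n})" by (intro compact_Times compact_Icc)
  ultimately show ?thesis by (metis compact_Int_closed)
qed

section \<open>Expected gain of a bounded test function\<close>

locale strategy_test = strategy \<nu> \<alpha> lam \<theta> \<eta> c P F N Y R x m
  for \<nu> \<alpha> lam \<theta> \<eta> c and P :: "'a measure" and F :: "real \<Rightarrow> 'a measure" and N Y R x m +
  fixes w wx wm :: "real \<Rightarrow> real \<Rightarrow> real" and n C \<delta> :: real
  assumes start: "(x, m) \<in> domain_D \<alpha>" "m < n"
    and smooth: "C11_on (domain_D \<alpha>) w wx wm"
    and diag: "\<And>b. 0 \<le> b \<Longrightarrow> wm b b \<ge> 0"
    and w_measurable: "(\<lambda>p. w (fst p) (snd p)) \<in> borel_measurable borel"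
    and w_bound: "\<And>a b. \<bar>w a b\<bar> \<le> C"
    and gen: "\<And>a b Q. (a, b) \<in> domain_D \<alpha> \<Longrightarrow> b < n \<Longrightarrow> admissible_retention \<nu> lam \<theta> \<eta> c Q \<Longrightarrow>
      \<delta> \<le> generator \<nu> lam \<theta> \<eta> c Q w wx a b"
begin

lemma m_nonneg: "0 \<le> m" and x_bounds: "\<alpha> * m \<le> x" "x \<le> m"
  using start by (auto simp: domain_D_def)

text \<open>The derivative is continuous on the domain only. Cut off to the compact slice below
  level n it becomes bounded and Borel, and every active state of a \<open>good\<close> scenario
  lies in that slice.\<close>

definition wx_slice :: "real \<times> real \<Rightarrow> real" where
  "wx_slice p = indicator (domain_D \<alpha> \<inter> {p. snd p \<le> n}) p *\<^sub>R (case p of (a, b) \<Rightarrow> wx a b)"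

lemma wx_slice_measurable: "wx_slice \<in> borel_measurable borel"
  unfolding wx_slice_def[abs_def]
proof (rule borel_measurable_continuous_on_indicator)
  show "domain_D \<alpha> \<inter> {p. snd p \<le> n} \<in> sets borel"
    using compact_imp_closed[OF compact_domain_slice] by simp
  show "continuous_on (domain_D \<alpha> \<inter> {p. snd p \<le> n}) (\<lambda>p. case p of (a, b) \<Rightarrow> wx a b)"
    by (rule continuous_on_subset[OF C11_onD(2)[OF smooth]]) auto
qed

lemma wx_slice_bounded: "\<exists>B\<ge>0. \<forall>p. \<bar>wx_slice p\<bar> \<le> B"
proof -
  have "compact ((\<lambda>p. case p of (a, b) \<Rightarrow> wx a b) ` (domain_D \<alpha> \<inter> {p. snd p \<le> n}))"
    by (rule compact_continuous_image[OF continuous_on_subset[OF C11_onD(2)[OF smooth]] compact_domain_slice]) auto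
  from compact_imp_bounded[OF this] obtain B where "\<forall>v\<in>(\<lambda>p. case p of (a, b) \<Rightarrow> wx a b) ` (domain_D \<alpha> \<inter> {p. snd p \<le> n}). norm v \<le> B"
    unfolding bounded_iff by blast
  then have B: "norm (case p of (a, b) \<Rightarrow> wx a b) \<le> B" if "p \<in> domain_D \<alpha> \<inter> {p. snd p \<le> n}" for p
    using that by blast
  have "\<bar>wx_slice p\<bar> \<le> max 0 B" for p
    using B[of p] by (cases "p \<in> domain_D \<alpha> \<inter> {p. snd p \<le> n}") (auto simp: wx_slice_def)
  then show ?thesis by (intro exI[of _ "max 0 B"]) auto
qed

text \<open>Membership in \<open>space P\<close> is included so that the drift rate is bounded for
  all arguments, as the integrability lemma asks.\<close>

definition act_ind :: "real \<Rightarrow> 'a \<Rightarrow> real" where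
  "act_ind s \<omega> = (if act n s \<omega> \<and> \<omega> \<in> space P then 1 else 0)"

definition drift_rate :: "real \<Rightarrow> 'a \<Rightarrow> real" where
  "drift_rate s \<omega> = act_ind s \<omega> * (wx_slice (if 0 < s then Xl s \<omega> else 0, Ml s \<omega>) * D s \<omega>)"

definition jump_size :: "(real \<times> 'a) \<times> real \<Rightarrow> real" where
  "jump_size = (\<lambda>((s, \<omega>), y). act_ind s \<omega> *
     (w ((if 0 < s then Xl s \<omega> else 0) - R s \<omega> y) (Ml s \<omega>) - w (if 0 < s then Xl s \<omega> else 0) (Ml s \<omega>)))"

lemma act_ind_pred: "(\<lambda>(s, \<omega>). act_ind s \<omega>) \<in> borel_measurable pred"
proof -
  have "(indicator {(s, \<omega>) \<in> space pred. act n s \<omega>} :: real \<times> 'a \<Rightarrow> real) \<in> borel_measurable pred"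
    by (rule borel_measurable_indicator[OF act_pred])
  then show ?thesis
    by (rule measurable_cong[THEN iffD1, rotated]) (auto simp: act_ind_def indicator_def space_pred split: if_splits)
qed

lemma state_pred: "(\<lambda>(s, \<omega>). (if 0 < s then Xl s \<omega> else 0, Ml s \<omega>)) \<in> measurable pred (borel \<Otimes>\<^sub>M borel)"
  using measurable_Pair[OF Xl_pred Ml_pred] by (simp add: case_prod_unfold)

lemma drift_rate_pred: "(\<lambda>(s, \<omega>). drift_rate s \<omega>) \<in> borel_measurable pred"
proof -
  have "wx_slice \<in> borel_measurable (borel \<Otimes>\<^sub>M borel)" using wx_slice_measurable by (simp add: borel_prod)
  from measurable_compose[OF state_pred this]
  have "(\<lambda>z. (case z of (s, \<omega>) \<Rightarrow> act_ind s \<omega>) * (wx_slice (case z of (s, \<omega>) \<Rightarrow> (if 0 < s then Xl s \<omega> else 0, Ml s \<omega>)) * (case z of (s, \<omega>) \<Rightarrow> D s \<omega>)))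
      \<in> borel_measurable pred"
    by (intro borel_measurable_times act_ind_pred D_pred)
  then show ?thesis by (simp add: drift_rate_def case_prod_unfold)
qed

lemma jump_size_measurable: "jump_size \<in> borel_measurable (pred \<Otimes>\<^sub>M borel)"
proof -
  have wm: "(\<lambda>p. w (fst p) (snd p)) \<in> borel_measurable (borel \<Otimes>\<^sub>M borel)" using w_measurable by (simp add: borel_prod)
  have a: "(\<lambda>z. act_ind (fst (fst z)) (snd (fst z))) \<in> borel_measurable (pred \<Otimes>\<^sub>M (borel :: real measure))"
    using measurable_compose[OF measurable_fst act_ind_pred] by (simp add: case_prod_unfold)
  have b: "(\<lambda>z. if 0 < fst (fst z) then Xl (fst (fst z)) (snd (fst z)) else 0) \<in> borel_measurable (pred \<Otimes>\<^sub>M (borel :: real measure))"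
    using measurable_compose[OF measurable_fst Xl_pred] by (simp add: case_prod_unfold)
  have e: "(\<lambda>z. Ml (fst (fst z)) (snd (fst z))) \<in> borel_measurable (pred \<Otimes>\<^sub>M (borel :: real measure))"
    using measurable_compose[OF measurable_fst Ml_pred] by (simp add: case_prod_unfold)
  have r: "(\<lambda>z. R (fst (fst z)) (snd (fst z)) (snd z)) \<in> borel_measurable (pred \<Otimes>\<^sub>M borel)"
    using R_measurable by (simp add: case_prod_unfold)
  have 1: "(\<lambda>z. w ((if 0 < fst (fst z) then Xl (fst (fst z)) (snd (fst z)) else 0) - R (fst (fst z)) (snd (fst z)) (snd z)) (Ml (fst (fst z)) (snd (fst z))))
      \<in> borel_measurable (pred \<Otimes>\<^sub>M borel)"
    using measurable_compose[OF measurable_Pair[OF borel_measurable_diff[OF b r] e] wm] by simp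
  have 2: "(\<lambda>z. w (if 0 < fst (fst z) then Xl (fst (fst z)) (snd (fst z)) else 0) (Ml (fst (fst z)) (snd (fst z))))
      \<in> borel_measurable (pred \<Otimes>\<^sub>M (borel :: real measure))"
    using measurable_compose[OF measurable_Pair[OF b e] wm] by simp
  show ?thesis
    using borel_measurable_times[OF a borel_measurable_diff[OF 1 2]] by (simp add: jump_size_def case_prod_unfold)
qed

lemma C_nonneg: "0 \<le> C" using w_bound[of 0 0] by linarith

lemma jump_size_bound: "\<bar>jump_size z\<bar> \<le> 2 * C"
proof -
  have "\<bar>w a b - w a' b\<bar> \<le> 2 * C" for a a' b using w_bound[of a b] w_bound[of a' b] by linarith
  then show ?thesis using C_nonneg by (auto simp: jump_size_def act_ind_def split: prod.split)
qed

lemma drift_rate_bounded: "\<exists>B. \<forall>s \<omega>. \<bar>drift_rate s \<omega>\<bar> \<le> B"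
proof -
  obtain B where B: "0 \<le> B" "\<And>p. \<bar>wx_slice p\<bar> \<le> B" using wx_slice_bounded by blast
  have Db: "0 \<le> D_bound" by (simp add: D_bound_def)
  have "\<bar>drift_rate s \<omega>\<bar> \<le> B * D_bound" for s \<omega>
  proof (cases "act n s \<omega> \<and> \<omega> \<in> space P")
    case True
    then have "\<bar>D s \<omega>\<bar> \<le> D_bound" by (intro D_abs) (auto simp: act_def)
    then have "\<bar>wx_slice (if 0 < s then Xl s \<omega> else 0, Ml s \<omega>)\<bar> * \<bar>D s \<omega>\<bar> \<le> B * D_bound"
      by (intro mult_mono B) auto
    then show ?thesis using True by (simp add: drift_rate_def act_ind_def abs_mult)
  next
    case False
    then have "act_ind s \<omega> = 0" unfolding act_ind_def by presburger
    then show ?thesis using B(1) Db by (simp add: drift_rate_def)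
  qed
  then show ?thesis by blast
qed

definition total_gain :: "nat \<Rightarrow> 'a \<Rightarrow> real" where
  "total_gain K \<omega> = (\<Sum>i<N (real K) \<omega>. jump_size ((tau K i \<omega>, \<omega>), Y i \<omega>)) + (LINT s:{0..real K}|lborel. drift_rate s \<omega>)"

definition good :: "'a \<Rightarrow> bool" where
  "good \<omega> \<longleftrightarrow> \<omega> \<in> space P \<and> (\<forall>t>0. \<exists>s. 0 \<le> s \<and> s < t \<and> N t \<omega> \<le> N s \<omega> + 1) \<and>
    (\<forall>t\<ge>0. net_profit \<nu> lam \<theta> \<eta> c (R t \<omega>))"

lemma AE_good: "AE \<omega> in P. good \<omega>"
proof -
  have "AE \<omega> in P. \<forall>t\<ge>0. net_profit \<nu> lam \<theta> \<eta> c (R t \<omega>)" using strat unfolding admissible_strategy_def by blast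
  with AE_N_simple AE_space show ?thesis unfolding good_def by eventually_elim blast
qed

lemma smooth_path:
  assumes "good \<omega>"
  shows "smooth_surplus_path (\<lambda>t. N t \<omega>) (\<lambda>i. V i \<omega>) (\<lambda>s. D s \<omega>) m c \<alpha> w wx wm"
proof -
  have \<omega>: "\<omega> \<in> space P" using assms by (simp add: good_def)
  interpret sp: surplus_path "\<lambda>t. N t \<omega>" "\<lambda>i. V i \<omega>" "\<lambda>s. D s \<omega>" x m c by (rule path[OF \<omega>])
  show ?thesis
  proof
    show "0 \<le> \<alpha>" "\<alpha> < 1" by (rule mk.alpha)+
    show "0 \<le> D s \<omega>" if "0 \<le> s" for s
      unfolding D_def using assms that by (intro mk.drift_pos R_section \<omega>) (auto simp: good_def)
  qed (use smooth diag m_nonneg assms in \<open>auto simp: good_def\<close>)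
qed

context
  fixes \<omega> assumes g: "good \<omega>"
begin

interpretation sp: smooth_surplus_path "\<lambda>t. N t \<omega>" "\<lambda>i. V i \<omega>" "\<lambda>s. D s \<omega>" x m c \<alpha> w wx wm n
  by (rule smooth_path[OF g])

lemma good_space: "\<omega> \<in> space P" using g by (simp add: good_def)

lemma act_iff_active: "act n s \<omega> \<longleftrightarrow> sp.active s"
  unfolding act_def sp.active_def X_def M_def Ml_def ..

lemma act_in_domain: "act n s \<omega> \<Longrightarrow> (Xl s \<omega>, Ml s \<omega>) \<in> domain_D \<alpha> \<and> Ml s \<omega> < n \<and> 0 < s"
  using sp.active_in_domain[of s] unfolding act_iff_active Xl_def Ml_def by (auto simp: sp.active_def)

lemma wx_slice_active: "act n s \<omega> \<Longrightarrow> wx_slice (Xl s \<omega>, Ml s \<omega>) = wx (Xl s \<omega>) (Ml s \<omega>)"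
  using act_in_domain[of s] by (simp add: wx_slice_def)

lemma drift_gain_eq: "sp.drift_gain s = drift_rate s \<omega>"
proof (cases "act n s \<omega>")
  case True
  then show ?thesis
    using act_in_domain[OF True] wx_slice_active[OF True] good_space
    by (simp add: sp.drift_gain_def drift_rate_def act_ind_def act_iff_active[symmetric] Xl_def Ml_def)
next
  case False
  then show ?thesis by (simp add: sp.drift_gain_def drift_rate_def act_ind_def act_iff_active[symmetric])
qed

lemma jump_gain_eq:
  assumes i: "i < N (real K) \<omega>"
  shows "sp.jump_gain i = jump_size ((tau K i \<omega>, \<omega>), Y i \<omega>)"
proof -
  have T: "sp.T i = claim_time N i \<omega>" unfolding sp.T_def claim_time_def ..
  have tau: "tau K i \<omega> = claim_time N i \<omega>" using i by (simp add: tau_def)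
  have pos: "0 < claim_time N i \<omega>" using claim_time_pos[OF good_space _ i] by simp
  have V: "V i \<omega> = R (claim_time N i \<omega>) \<omega> (Y i \<omega>)" using pos by (simp add: V_def max_def)
  show ?thesis
    using pos good_space
    by (simp add: sp.jump_gain_def jump_size_def T tau V act_ind_def act_iff_active[symmetric] Xl_def Ml_def)
qed

lemma act_later: "act n t \<omega> \<Longrightarrow> 0 < s \<Longrightarrow> s \<le> t \<Longrightarrow> act n s \<omega>"
proof -
  assume t: "act n t \<omega>" and s: "0 < s" "s \<le> t"
  have "sp.Ml s \<le> sp.Ml t"
    using sp.Ml_le_iff[of t "sp.Ml t"] s by (subst sp.Ml_le_iff) auto
  then show ?thesis using t s unfolding act_iff_active sp.active_def by auto
qed

text \<open>The possible situations at time K: stopped at level n, stopped by drawdown, or still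
  running. In the last case \<open>alive\<close> is weakened to the predictable \<open>act\<close>,
  whose probability is estimated separately.\<close>

lemma total_gain_cases:
  assumes K: "0 < K"
  shows "total_gain K \<omega> \<le> w n n - w x m \<or>
    (\<exists>r\<ge>0. X r \<omega> < \<alpha> * M r \<omega> \<and> total_gain K \<omega> \<le> w (X r \<omega>) (M r \<omega>) - w x m) \<or>
    (act n (real K) \<omega> \<and> total_gain K \<omega> \<le> w (X (real K) \<omega>) (M (real K) \<omega>) - w x m)"
proof -
  obtain B where B: "\<And>s \<omega>. \<bar>drift_rate s \<omega>\<bar> \<le> B" using drift_rate_bounded by blast
  have int: "set_integrable lborel {0..real K} sp.drift_gain"
    unfolding drift_gain_eq[abs_def] by (rule pred_section_integrable[OF drift_rate_pred good_space B])
  have M0: "sp.M 0 = m" using sp.M_0 x_bounds by simp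
  have al: "sp.alive 0" using sp.X_0 M0 start(2) x_bounds by (simp add: sp.alive_def)
  have v0: "sp.value_at 0 = w x m" by (simp add: sp.value_at_def sp.X_0 M0)
  have dg: "sp.drift_gain = (\<lambda>s. drift_rate s \<omega>)" by (rule ext) (rule drift_gain_eq)
  have "sp.gain 0 (real K) = total_gain K \<omega>"
    unfolding sp.gain_def total_gain_def dg
    by (simp add: sp.N_0 lessThan_atLeast0 jump_gain_eq[of _ K] cong: sum.cong_simp)
  moreover have "sp.alive (real K) \<Longrightarrow> act n (real K) \<omega>"
    using sp.alive_imp_active[of "real K" "real K"] K by (simp add: act_iff_active)
  ultimately show ?thesis
    using sp.gain_bound_all[OF _ int] al unfolding sp.gain_bound_def v0
    by (auto simp: sp.value_at_def X_def M_def)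
qed

text \<open>While active, the left limits lie in the domain below n and the current retention is
  admissible, so the generator hypothesis applies to them; otherwise both sides are 0.\<close>

lemma rate_bound:
  assumes s: "0 \<le> s"
  shows "\<delta> * act_ind s \<omega> \<le> lam * (LINT y|\<nu>. jump_size ((s, \<omega>), y)) + drift_rate s \<omega>"
proof (cases "act n s \<omega>")
  case True
  have D: "(Xl s \<omega>, Ml s \<omega>) \<in> domain_D \<alpha>" "Ml s \<omega> < n" "0 < s" using act_in_domain[OF True] by auto
  have Rm: "R s \<omega> \<in> borel_measurable borel" "retention_bounds (R s \<omega>)" using R_section[OF s good_space] .
  have adm: "admissible_retention \<nu> lam \<theta> \<eta> c (R s \<omega>)"
    using Rm g s by (auto simp: admissible_retention_def good_def)
  have "(\<lambda>y. (Xl s \<omega> - R s \<omega> y, Ml s \<omega>)) \<in> measurable borel borel"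
    unfolding borel_prod[symmetric] using Rm(1) by (intro measurable_Pair) auto
  from measurable_compose[OF this w_measurable]
  have "(\<lambda>y. w (Xl s \<omega> - R s \<omega> y) (Ml s \<omega>)) \<in> borel_measurable \<nu>" by (intro mk.borel_nu) simp
  then have int: "integrable \<nu> (\<lambda>y. w (Xl s \<omega> - R s \<omega> y) (Ml s \<omega>))"
    using w_bound by (intro mk.integrable_const_bound[where B = C]) auto
  have "(LINT y|\<nu>. jump_size ((s, \<omega>), y)) = (LINT y|\<nu>. w (Xl s \<omega> - R s \<omega> y) (Ml s \<omega>)) - w (Xl s \<omega>) (Ml s \<omega>)"
    using int True D(3) good_space by (simp add: jump_size_def act_ind_def mk.prob_space[unfolded mk.space_eq_univ])
  moreover have "drift_rate s \<omega> = D s \<omega> * wx (Xl s \<omega>) (Ml s \<omega>)"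
    using True D(3) good_space wx_slice_active[OF True] by (simp add: drift_rate_def act_ind_def)
  moreover have "act_ind s \<omega> = 1" using True good_space by (simp add: act_ind_def)
  ultimately show ?thesis
    using gen[OF D(1,2) adm] unfolding mk.generator_eq[OF Rm] D_def by simp
next
  case False
  then show ?thesis by (simp add: jump_size_def drift_rate_def act_ind_def)
qed

end

lemma act_sets:
  assumes K: "0 < K"
  shows "{\<omega> \<in> space P. act n (real K) \<omega>} \<in> sets P"
proof -
  have "(\<lambda>\<omega>. (\<lambda>(s::real, \<omega>). (max 0 s, \<omega>)) (real K, \<omega>)) \<in> measurable P pred"
    by (rule measurable_compose[OF _ clamp_measurable[OF K]]) (intro measurable_Pair measurable_const, simp_all)
  then have "(\<lambda>\<omega>. (real K, \<omega>)) \<in> measurable P pred" by simp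
  from measurable_sets[OF this act_pred[of n]]
  show ?thesis by (rule back_subst[where P = "\<lambda>S. S \<in> sets P"]) (auto simp: space_pred)
qed

text \<open>Compensation turns the expected total gain into the expected time integral of a rate
  that is at least \<delta> while active and 0 otherwise. A good path active at K was active
  throughout (0, K], which produces the factor K.\<close>

theorem dynkin:
  assumes K: "0 < K" and \<delta>: "0 \<le> \<delta>" and G: "integrable P G" and le: "AE \<omega> in P. total_gain K \<omega> \<le> G \<omega>"
  shows "\<delta> * real K * prob {\<omega> \<in> space P. act n (real K) \<omega>} \<le> (\<integral>\<omega>. G \<omega> \<partial>P)"
proof -
  define j where "j s \<omega> = (LINT y|\<nu>. jump_size ((s, \<omega>), y))" for s \<omega>
  have jb: "\<bar>j s \<omega>\<bar> \<le> 2 * C" for s \<omega>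
  proof -
    have "norm (j s \<omega>) \<le> (LINT y|\<nu>. norm (jump_size ((s, \<omega>), y)))"
      unfolding j_def by (rule integral_norm_bound)
    also have "\<dots> \<le> (LINT y|\<nu>. 2 * C)"
      using jump_size_bound C_nonneg by (intro integral_mono') auto
    finally show ?thesis by (simp add: mk.prob_space[unfolded mk.space_eq_univ])
  qed
  have jp: "(\<lambda>(s, \<omega>). j s \<omega>) \<in> borel_measurable pred"
    using integral_nu_pred[OF jump_size_measurable] by (simp add: j_def case_prod_unfold)
  obtain B where B: "\<And>s \<omega>. \<bar>drift_rate s \<omega>\<bar> \<le> B" using drift_rate_bounded by blast
  note comp = compensation[OF K jump_size_measurable jump_size_bound, folded j_def]
  have dint: "integrable P (\<lambda>\<omega>. LINT s:{0..real K}|lborel. drift_rate s \<omega>)"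
    by (rule pred_integral_integrable[OF drift_rate_pred B K])
  have gint: "integrable P (total_gain K)"
    unfolding total_gain_def[abs_def] by (intro Bochner_Integration.integrable_add comp(1) dint)
  have "(\<integral>\<omega>. total_gain K \<omega> \<partial>P) = (\<integral>\<omega>. lam * (LINT s:{0..real K}|lborel. j s \<omega>) + (LINT s:{0..real K}|lborel. drift_rate s \<omega>) \<partial>P)"
    unfolding total_gain_def using comp dint by simp
  moreover have "(\<integral>\<omega>. \<delta> * real K * indicator {\<omega> \<in> space P. act n (real K) \<omega>} \<omega> \<partial>P) \<le>
      (\<integral>\<omega>. lam * (LINT s:{0..real K}|lborel. j s \<omega>) + (LINT s:{0..real K}|lborel. drift_rate s \<omega>) \<partial>P)"
  proof (rule integral_mono_AE)
    show "integrable P (\<lambda>\<omega>. \<delta> * real K * indicator {\<omega> \<in> space P. act n (real K) \<omega>} \<omega>)"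
      using act_sets[OF K] by (intro integrable_mult_right integrable_real_indicator) (auto simp: emeasure_eq_measure)
    show "integrable P (\<lambda>\<omega>. lam * (LINT s:{0..real K}|lborel. j s \<omega>) + (LINT s:{0..real K}|lborel. drift_rate s \<omega>))"
      using comp(2) dint by simp
    show "AE \<omega> in P. \<delta> * real K * indicator {\<omega> \<in> space P. act n (real K) \<omega>} \<omega> \<le>
        lam * (LINT s:{0..real K}|lborel. j s \<omega>) + (LINT s:{0..real K}|lborel. drift_rate s \<omega>)"
      using AE_good
    proof eventually_elim
      case (elim \<omega>)
      have \<omega>: "\<omega> \<in> space P" by (rule good_space[OF elim])
      have i1: "set_integrable lborel {0..real K} (\<lambda>s. j s \<omega>)" by (rule pred_section_integrable[OF jp \<omega> jb])
      have i2: "set_integrable lborel {0..real K} (\<lambda>s. drift_rate s \<omega>)"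
        by (rule pred_section_integrable[OF drift_rate_pred \<omega> B])
      have i3: "set_integrable lborel {0..real K} (\<lambda>s. act_ind s \<omega>)"
        by (rule pred_section_integrable[OF act_ind_pred \<omega>, where B = 1]) (simp add: act_ind_def)
      have "real K * indicator {\<omega> \<in> space P. act n (real K) \<omega>} \<omega> \<le> (LINT s:{0..real K}|lborel. act_ind s \<omega>)"
      proof (cases "act n (real K) \<omega>")
        case True
        have "(LINT s:{0..real K}|lborel. act_ind s \<omega>) = (LINT s:{0..real K}|lborel. 1)"
        proof (rule set_integral_cong_open[OF i3])
          show "set_integrable lborel {0..real K} (\<lambda>s. 1::real)"
            by (rule borel_integrable_atLeastAtMost') (rule continuous_on_const)
          show "act_ind s \<omega> = 1" if "0 < s" "s < real K" for s
            using act_later[OF elim True that(1)] that \<omega> by (simp add: act_ind_def)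
        qed
        also have "\<dots> = real K" by (simp add: set_lebesgue_integral_def)
        finally show ?thesis by (simp add: indicator_def)
      next
        case False
        have "0 \<le> (LINT s:{0..real K}|lborel. act_ind s \<omega>)"
          unfolding set_lebesgue_integral_def by (rule integral_nonneg_AE) (auto simp: act_ind_def)
        then show ?thesis using False by simp
      qed
      then have "\<delta> * (real K * indicator {\<omega> \<in> space P. act n (real K) \<omega>} \<omega>) \<le> \<delta> * (LINT s:{0..real K}|lborel. act_ind s \<omega>)"
        using \<delta> by (rule mult_left_mono)
      also have "\<dots> = (LINT s:{0..real K}|lborel. \<delta> * act_ind s \<omega>)" by simp
      also have "\<dots> \<le> (LINT s:{0..real K}|lborel. lam * j s \<omega> + drift_rate s \<omega>)"
      proof (rule set_integral_mono)
        show "\<delta> * act_ind s \<omega> \<le> lam * j s \<omega> + drift_rate s \<omega>" if "s \<in> {0..real K}" for s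
          using rate_bound[OF elim, of s] that by (simp add: j_def)
      qed (intro set_integrable_mult_right set_integral_add i1 i2 i3)+
      also have "\<dots> = lam * (LINT s:{0..real K}|lborel. j s \<omega>) + (LINT s:{0..real K}|lborel. drift_rate s \<omega>)"
        using set_integral_add(2)[OF set_integrable_mult_right[of lam, OF i1] i2] by simp
      finally show ?case by (simp add: mult.assoc)
    qed
  qed
  moreover have "(\<integral>\<omega>. total_gain K \<omega> \<partial>P) \<le> (\<integral>\<omega>. G \<omega> \<partial>P)" by (rule integral_mono_AE[OF gint G le])
  moreover have "(\<integral>\<omega>. \<delta> * real K * indicator {\<omega> \<in> space P. act n (real K) \<omega>} \<omega> \<partial>P) =
      \<delta> * real K * prob ({\<omega> \<in> space P. act n (real K) \<omega>} \<inter> space P)" by simp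
  moreover have "{\<omega> \<in> space P. act n (real K) \<omega>} \<inter> space P = {\<omega> \<in> space P. act n (real K) \<omega>}" by auto
  ultimately show ?thesis by simp
qed

end

section \<open>Decay of the survival probability, and the comparison with the drawdown
  probability\<close>

context strategy
begin

text \<open>The total gain of the bounded function \<open>lyap\<close> never exceeds 2 * exp g on a
  good path, while its mean is at least \<delta> * K times the probability in question.\<close>

lemma prob_act_le:
  assumes start: "(x, m) \<in> domain_D \<alpha>" "m < n"
  shows "\<exists>C'. \<forall>K>0. prob {\<omega> \<in> space P. act n (real K) \<omega>} \<le> C' / real K"
proof -
  obtain q where q: "q > 0" "\<And>Q. admissible_retention \<nu> lam \<theta> \<eta> c Q \<Longrightarrow> q \<le> (LINT y|\<nu>. (min (Q y) 1)\<^sup>2)"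
    using mk.retention_bounded_below by blast
  \<comment> \<open>Solves lam * g * q / 2 = 2 * c, the balance between jumps and drift in
    \<open>lyap_generator\<close>.\<close>
  define g where "g = 4 * c / (lam * q)"
  have g: "0 < g" using mk.c_pos lam_pos q(1) by (simp add: g_def)
  have gq: "2 * c \<le> lam * g * q / 2" using lam_pos q(1) by (simp add: g_def)
  define \<delta> where "\<delta> = exp (- g * n) * (g * c)"
  have \<delta>: "0 < \<delta>" using g mk.c_pos by (simp add: \<delta>_def)
  interpret t: strategy_test \<nu> \<alpha> lam \<theta> \<eta> c P F N Y R x m "mk.lyap g" "\<lambda>x m. - g * exp (- g * x)" "\<lambda>x m. 0"
    n "exp g" \<delta>
  proof
    show "(x, m) \<in> domain_D \<alpha>" "m < n" by (rule start)+
    show "C11_on (domain_D \<alpha>) (mk.lyap g) (\<lambda>x m. - g * exp (- g * x)) (\<lambda>x m. 0)" by (rule mk.lyap_smooth)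
    show "(\<lambda>p. mk.lyap g (fst p) (snd p)) \<in> borel_measurable borel"
      unfolding mk.lyap_def by (intro borel_measurable_continuous_onI continuous_intros)
    show "\<bar>mk.lyap g a b\<bar> \<le> exp g" for a b
    proof -
      have "g * (- 1) \<le> g * max a (- 1)" using g by (intro mult_left_mono) auto
      then show ?thesis by (simp add: mk.lyap_def)
    qed
    show "\<delta> \<le> generator \<nu> lam \<theta> \<eta> c Q (mk.lyap g) (\<lambda>x m. - g * exp (- g * x)) a b"
      if "(a, b) \<in> domain_D \<alpha>" "b < n" "admissible_retention \<nu> lam \<theta> \<eta> c Q" for a b Q
      unfolding \<delta>_def using that g gq q(2) by (intro mk.lyap_generator[where q = q]) (auto simp: domain_D_def)
  qed auto
  have "prob {\<omega> \<in> space P. act n (real K) \<omega>} \<le> (2 * exp g / \<delta>) / real K" if K: "0 < K" for K :: nat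
  proof -
    have "AE \<omega> in P. t.total_gain K \<omega> \<le> 2 * exp g"
      using t.AE_good
    proof eventually_elim
      case (elim \<omega>)
      have "mk.lyap g a b - mk.lyap g x m \<le> 2 * exp g" for a b
        using t.w_bound[of a b] t.w_bound[of x m] by linarith
      then show ?case using t.total_gain_cases[OF elim K] by (meson order_trans)
    qed
    then have "\<delta> * real K * prob {\<omega> \<in> space P. act n (real K) \<omega>} \<le> (\<integral>\<omega>. 2 * exp g \<partial>P)"
      using \<delta> by (intro t.dynkin[OF K]) auto
    then show ?thesis using \<delta> K by (simp add: prob_space field_simps)
  qed
  then show ?thesis by blast
qed

theorem drawdown_prob_ge:
  assumes start: "(x, m) \<in> domain_D \<alpha>"
    and smooth: "C11_on (domain_D \<alpha>) u ux um"
    and bdd: "bounded ((\<lambda>(x, m). u x m) ` {(x, m). 0 \<le> m \<and> x \<le> m})"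
    and limit: "l \<le> 0" "((\<lambda>m. u m m) \<longlongrightarrow> l) at_top"
    and below: "\<And>x m. 0 \<le> m \<Longrightarrow> x < \<alpha> * m \<Longrightarrow> u x m = 1"
    and diag: "\<And>m. 0 \<le> m \<Longrightarrow> um m m \<ge> 0"
    and gen: "\<And>x m R. (x, m) \<in> domain_D \<alpha> \<Longrightarrow> admissible_retention \<nu> lam \<theta> \<eta> c R \<Longrightarrow>
                generator \<nu> lam \<theta> \<eta> c R u ux x m \<ge> 0"
  shows "u x m \<le> prob drawdown_event"
proof (rule field_le_epsilon)
  fix e :: real assume e: "0 < e"
  have "eventually (\<lambda>n. u n n < e) at_top" using order_tendstoD(2)[OF limit(2)] limit(1) e by simp
  then obtain n0 where n0: "\<And>n. n0 \<le> n \<Longrightarrow> u n n < e" unfolding eventually_at_top_linorder by blast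
  define n where "n = max n0 (m + 1)"
  have n: "m < n" "u n n \<le> e" using n0[of n] by (auto simp: n_def)
  have m0: "0 \<le> m" using start by (simp add: domain_D_def)
  from bdd obtain C0 where C0': "\<forall>v\<in>(\<lambda>(x, m). u x m) ` {(x, m). 0 \<le> m \<and> x \<le> m}. norm v \<le> C0"
    unfolding bounded_iff by blast
  have C0: "\<bar>u a b\<bar> \<le> C0" if "0 \<le> b" "a \<le> b" for a b
  proof -
    have "(\<lambda>(x, m). u x m) (a, b) \<in> (\<lambda>(x, m). u x m) ` {(x, m). 0 \<le> m \<and> x \<le> m}"
      using that by (intro imageI) simp
    from bspec[OF C0' this] show ?thesis by simp
  qed
  define C where "C = max 1 C0"
  \<comment> \<open>The hypotheses control \<open>u\<close> only for 0 \<le> m and x \<le> m,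
    whereas the test locale wants a Borel function bounded on the whole plane. A jump starting in
    the domain stays within x \<le> m, so the generators of v and u agree there.\<close>
  define v where "v a b = (if a < \<alpha> * b then 1 else if (a, b) \<in> domain_D \<alpha> then u a b else 0)" for a b
  have vD: "v a b = u a b" if "(a, b) \<in> domain_D \<alpha>" for a b using that by (auto simp: v_def domain_D_def)
  have vu: "v a b = u a b" if "0 \<le> b" "a \<le> b" for a b
  proof (cases "a < \<alpha> * b")
    case True then show ?thesis using below[OF that(1)] by (simp add: v_def)
  next
    case False
    moreover have "0 \<le> \<alpha> * b" using that mk.alpha by simp
    ultimately have "(a, b) \<in> domain_D \<alpha>" using that by (auto simp: domain_D_def)
    then show ?thesis by (rule vD)
  qed
  interpret t: strategy_test \<nu> \<alpha> lam \<theta> \<eta> c P F N Y R x m v ux um n C 0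
  proof
    show "(x, m) \<in> domain_D \<alpha>" "m < n" by (rule start, rule n)
    show "C11_on (domain_D \<alpha>) v ux um"
      unfolding C11_on_def
    proof (intro conjI ballI)
      show "continuous_on (domain_D \<alpha>) (\<lambda>(x, m). v x m)"
        using C11_onD(1)[OF smooth] by (rule continuous_on_cong[THEN iffD1, OF refl, rotated]) (auto simp: vD)
      show "continuous_on (domain_D \<alpha>) (\<lambda>(x, m). ux x m)" "continuous_on (domain_D \<alpha>) (\<lambda>(x, m). um x m)"
        using C11_onD[OF smooth] by auto
      fix z assume z: "z \<in> domain_D \<alpha>"
      obtain a b where ab: "z = (a, b)" by (cases z)
      have D: "(a, b) \<in> domain_D \<alpha>" using z ab by simp
      have "((\<lambda>x'. v x' b) has_real_derivative ux a b) (at a within {x'. (x', b) \<in> domain_D \<alpha>})"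
        by (rule has_field_derivative_transform_within[OF C11_onD(4)[OF smooth D] zero_less_one])
          (use D in \<open>auto simp: vD\<close>)
      moreover have "((\<lambda>m'. v a m') has_real_derivative um a b) (at b within {m'. (a, m') \<in> domain_D \<alpha>})"
        by (rule has_field_derivative_transform_within[OF C11_onD(5)[OF smooth D] zero_less_one])
          (use D in \<open>auto simp: vD\<close>)
      ultimately show "case z of (a, b) \<Rightarrow>
          ((\<lambda>x'. v x' b) has_real_derivative ux a b) (at a within {x'. (x', b) \<in> domain_D \<alpha>}) \<and>
          ((\<lambda>m'. v a m') has_real_derivative um a b) (at b within {m'. (a, m') \<in> domain_D \<alpha>})"
        unfolding ab by simp
    qed
    show "0 \<le> um b b" if "0 \<le> b" for b by (rule diag[OF that])
    have 1: "(\<lambda>p. indicator (domain_D \<alpha>) p *\<^sub>R (case p of (a, b) \<Rightarrow> u a b)) \<in> borel_measurable borel"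
      using closed_domain_D by (intro borel_measurable_continuous_on_indicator C11_onD(1)[OF smooth]) simp
    have "open {p :: real \<times> real. fst p < \<alpha> * snd p}" by (intro open_Collect_less continuous_intros)
    then have 2: "(indicator {p :: real \<times> real. fst p < \<alpha> * snd p} :: _ \<Rightarrow> real) \<in> borel_measurable borel" by simp
    have "(\<lambda>p. v (fst p) (snd p)) = (\<lambda>p. indicator {p. fst p < \<alpha> * snd p} p +
        indicator (domain_D \<alpha>) p *\<^sub>R (case p of (a, b) \<Rightarrow> u a b))"
      by (auto simp: fun_eq_iff v_def indicator_def domain_D_def)
    then show "(\<lambda>p. v (fst p) (snd p)) \<in> borel_measurable borel" using borel_measurable_add[OF 2 1] by simp
    show "\<bar>v a b\<bar> \<le> C" for a b
      using C0[of b a] by (auto simp: v_def C_def domain_D_def max_def)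
    show "0 \<le> generator \<nu> lam \<theta> \<eta> c Q v ux a b"
      if D: "(a, b) \<in> domain_D \<alpha>" and adm: "admissible_retention \<nu> lam \<theta> \<eta> c Q" for a b Q
    proof -
      have Q0: "0 \<le> Q y" for y using adm by (auto simp: admissible_retention_def retention_bounds_def)
      have "v (a - Q y) b = u (a - Q y) b" for y
        using D Q0[of y] by (intro vu) (auto simp: domain_D_def)
      then show ?thesis using gen[OF D adm] vD[OF D] by (simp add: generator_def)
    qed
  qed
  have vxm: "v x m = u x m" by (rule vD[OF start])
  have nn: "v n n = u n n" using n m0 by (intro vu) auto
  obtain C' where C': "\<And>K::nat. 0 < K \<Longrightarrow> prob {\<omega> \<in> space P. act n (real K) \<omega>} \<le> C' / real K"
    using prob_act_le[OF start n(1)] by blast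
  have C1: "0 \<le> C" by (simp add: C_def)
  have step: "u x m \<le> prob drawdown_event + e + C * (C' / real (Suc k))" for k
  proof -
    let ?A = "{\<omega> \<in> space P. act n (real (Suc k)) \<omega>}"
    \<comment> \<open>A majorant of the total gain with one term for each case of
      \<open>total_gain_cases\<close>: a drawdown state has value 1, level n has value at most e,
      and a running path at most C.\<close>
    let ?G = "\<lambda>\<omega>. indicator drawdown_event \<omega> + e + C * indicator ?A \<omega> - u x m"
    have A: "?A \<in> sets P" by (rule t.act_sets) simp
    have dd: "drawdown_event \<in> sets P" by (rule drawdown_event_sets)
    have "AE \<omega> in P. t.total_gain (Suc k) \<omega> \<le> ?G \<omega>"
      using t.AE_good
    proof eventually_elim
      case (elim \<omega>)
      have \<omega>: "\<omega> \<in> space P" by (rule t.good_space[OF elim])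
      have Ci: "0 \<le> C * indicator ?A \<omega>" using C1 by simp
      have di: "0 \<le> (indicator drawdown_event \<omega> :: real)" by simp
      from t.total_gain_cases[OF elim zero_less_Suc[of k]]
      consider "t.total_gain (Suc k) \<omega> \<le> v n n - v x m"
        | r where "0 \<le> r" "X r \<omega> < \<alpha> * M r \<omega>" "t.total_gain (Suc k) \<omega> \<le> v (X r \<omega>) (M r \<omega>) - v x m"
        | "act n (real (Suc k)) \<omega>" "t.total_gain (Suc k) \<omega> \<le> v (X (real (Suc k)) \<omega>) (M (real (Suc k)) \<omega>) - v x m"
        by blast
      then show ?case
      proof cases
        case 1
        then show ?thesis using n(2) Ci di unfolding nn vxm by linarith
      next
        case 2
        have "\<omega> \<in> drawdown_event" unfolding drawdown_event_eq using 2(1,2) \<omega> by blast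
        then have "indicator drawdown_event \<omega> = (1::real)" by simp
        moreover have "v (X r \<omega>) (M r \<omega>) = 1" using 2(2) by (simp add: v_def)
        ultimately show ?thesis using 2(3) Ci e unfolding vxm by linarith
      next
        case 3
        have "C * indicator ?A \<omega> = C" using 3(1) \<omega> by simp
        moreover have "v (X (real (Suc k)) \<omega>) (M (real (Suc k)) \<omega>) \<le> C"
          using t.w_bound[of "X (real (Suc k)) \<omega>" "M (real (Suc k)) \<omega>"] by linarith
        ultimately show ?thesis using 3(2) di e unfolding vxm by linarith
      qed
    qed
    moreover have "integrable P ?G" using A dd by (auto simp: emeasure_eq_measure)
    \<comment> \<open>With \<delta> = 0, \<open>dynkin\<close> says just that the majorant has
      nonnegative mean.\<close>
    ultimately have "0 * real (Suc k) * prob ?A \<le> (\<integral>\<omega>. ?G \<omega> \<partial>P)"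
      by (intro t.dynkin) auto
    also have "(\<integral>\<omega>. ?G \<omega> \<partial>P) = prob drawdown_event + e + C * prob ?A - u x m"
      using A dd by (simp add: emeasure_eq_measure prob_space)
    finally have "u x m \<le> prob drawdown_event + e + C * prob ?A" by simp
    moreover have "C * prob ?A \<le> C * (C' / real (Suc k))" using C'[of "Suc k"] C1 by (intro mult_left_mono) auto
    ultimately show ?thesis by linarith
  qed
  have "(\<lambda>k. prob drawdown_event + e + C * (C' / real (Suc k))) \<longlonglongrightarrow> prob drawdown_event + e + C * 0"
    by (intro tendsto_intros LIMSEQ_Suc[OF lim_const_over_n])
  then have "u x m \<le> prob drawdown_event + e + C * 0"
    by (rule LIMSEQ_le_const) (use step in blast)
  then show "u x m \<le> prob drawdown_event + e" by simp
qed

end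

theorem theorem2p1:
  fixes \<nu> :: "real measure" and \<alpha> lam \<theta> \<eta> c :: real
    and P :: "'a measure" and F :: "real \<Rightarrow> 'a measure"
    and N :: "real \<Rightarrow> 'a \<Rightarrow> nat" and Y :: "nat \<Rightarrow> 'a \<Rightarrow> real"
    and u ux um :: "real \<Rightarrow> real \<Rightarrow> real"
  assumes market: "drawdown_market \<nu> \<alpha> lam \<theta> \<eta> c"
    and claims: "claim_process P F \<nu> lam N Y"
    and smooth: "C11_on (domain_D \<alpha>) u ux um"
    and bdd: "bounded ((\<lambda>(x, m). u x m) ` {(x, m). 0 \<le> m \<and> x \<le> m})"
    and limit: "\<exists>l\<le>0. ((\<lambda>m. u m m) \<longlongrightarrow> l) at_top"
    and below: "\<And>x m. 0 \<le> m \<Longrightarrow> x < \<alpha> * m \<Longrightarrow> u x m = 1"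
    and diag: "\<And>m. 0 \<le> m \<Longrightarrow> um m m \<ge> 0"
    and gen: "\<And>x m R. (x, m) \<in> domain_D \<alpha> \<Longrightarrow> admissible_retention \<nu> lam \<theta> \<eta> c R \<Longrightarrow>
                generator \<nu> lam \<theta> \<eta> c R u ux x m \<ge> 0"
  shows "\<forall>(x, m)\<in>domain_D \<alpha>. u x m \<le> min_drawdown_prob \<nu> \<alpha> lam \<theta> \<eta> c P F N Y x m"
proof -
  interpret mk: drawdown_market \<nu> \<alpha> lam \<theta> \<eta> c by (rule market)
  have cl: "claims P F \<nu> lam N Y"
    by (intro claims.intro claims claims_axioms.intro mk.lam)
  obtain l where l: "l \<le> 0" "((\<lambda>m. u m m) \<longlongrightarrow> l) at_top" using limit by auto
  have "u x m \<le> min_drawdown_prob \<nu> \<alpha> lam \<theta> \<eta> c P F N Y x m" if D: "(x, m) \<in> domain_D \<alpha>" for x m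
    unfolding min_drawdown_prob_def
  proof (rule cINF_greatest)
    have full: "admissible_retention \<nu> lam \<theta> \<eta> c (max 0)" by (rule mk.full_retention_admissible)
    have bounds: "retention_bounds (max 0)" and profit: "net_profit \<nu> lam \<theta> \<eta> c (max 0)"
      using full unfolding admissible_retention_def by blast+
    \<comment> \<open>Full retention at all times witnesses that strategies exist, as the
      greatest-lower-bound rule requires.\<close>
    have "admissible_strategy \<nu> lam \<theta> \<eta> c P F (\<lambda>t \<omega>. max 0)"
      unfolding admissible_strategy_def
    proof (intro conjI allI impI ballI)
      show "AE \<omega> in P. \<forall>t\<ge>0. net_profit \<nu> lam \<theta> \<eta> c (max 0)" by (intro AE_I2 allI impI profit)
    qed (simp_all add: case_prod_unfold bounds)
    then show "{R. admissible_strategy \<nu> lam \<theta> \<eta> c P F R} \<noteq> {}" by blast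
    fix R assume "R \<in> {R. admissible_strategy \<nu> lam \<theta> \<eta> c P F R}"
    then have "strategy \<nu> \<alpha> lam \<theta> \<eta> c P F N Y R"
      by (intro strategy.intro market cl strategy_axioms.intro) simp
    then interpret strategy \<nu> \<alpha> lam \<theta> \<eta> c P F N Y R x m .
    show "u x m \<le> measure P {\<omega> \<in> space P. drawdown_time \<alpha> (surplus \<nu> lam \<theta> \<eta> c N Y R x) m \<omega> < \<infinity>}"
      using drawdown_prob_ge[OF D smooth bdd l below diag gen] by (simp add: drawdown_event_def)
  qed
  then show ?thesis by auto
qed

end
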